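(* Let $M$ be a cactus configuration on the ground set $[d]$, and let $Q_M\subseteq[d]$ be the set of points of $M$ lying on at least three lines. Suppose that $Q_M$ does not contain a cycle. Then \[ I_M=\sqrt{I_{\mathcal{C}(M)}+G_M}. \]
   Context: All matroids have rank at most three and ground set $[d]=\{1,\dots,d\}$. A family $\gamma=(\gamma_1,\dots,\gamma_d)$ of vectors in $\mathbb{C}^3$ is identified with a point of $\mathbb{C}^{3d}$ (a $3\times d$ matrix). It is a realization of $M$ if, for every $S\subseteq[d]$, $S$ is dependent in $M$ if and only if $\{\gamma_i:i\in S\}$ is linearly dependent. $\Gamma_M$ denotes the set of realizations, the matroid variety $V_M$ is the Zariski closure of $\Gamma_M$ in $\mathbb{C}^{3d}$, and $I_M\subseteq\mathbb{C}[X]$ is its vanishing ideal, where $X=(x_{ij})$ is a $3\times d$ matrix of indeterminates. The circuit ideal $I_{\mathcal{C}(M)}$ is generated by all minors of $X$ with column set a circuit $B$ of $M$ and any row set $A\subseteq[3]$ with $|A|=|B|$. For columns $i,j,k$, $[i,j,k]$ denotes the determinant of the $3\times3$ submatrix of $X$ with those columns. Let $M$ be simple (no loops and no parallel pairs) of rank three. A line of $M$ is a maximal subset of $[d]$ with at least three elements all of whose $3$-subsets are dependent. $\mathcal{L}_p$ is the set of lines containing $p$, and $|\mathcal{L}_p|$ is the degree of $p$. The Grassmann–Cayley ideal $G_M$ is defined as follows. Let $X_0$ be the set of brackets $[i,j,k]$ with $\{i,j,k\}$ a circuit of $M$. Given a polynomial $P$, a point $x$, two distinct lines $l_1\ne l_2$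 through $x$, distinct points $p_1,p_2\in l_1$ and distinct points $p_3,p_4\in l_2$, one obtains a new polynomial by replacing the column of variables of $x$ in $P$ by the vector $[p_1,p_2,p_3]\,X_{p_4}-[p_1,p_2,p_4]\,X_{p_3}$, where $X_p$ denotes the $p$-th column of $X$. For $j\ge1$, $X_j$ is the set of polynomials obtained from those of $X_{j-1}$ by performing such replacements on some (possibly none) of their variables. $G_M$ is the stabilization of the ascending chain of ideals generated by $X_0\subseteq X_1\subseteq\cdots$. A subset $Y\subseteq[d]$ contains a cycle if there exist $k\ge2$, distinct points $x_1,\dots,x_k\in Y$ and distinct lines $l_1,\dots,l_k$ of $M$ with $\{x_i,x_{i+1}\}\subseteq l_i$ for all $i$, where $x_{k+1}=x_1$. Cactus configurations are defined as follows. - A line matroid is the uniform matroid $U_{2,n}$: subsets of size at most $2$ are independent and larger subsets are dependent. - A simple matroid with $n$ lines is a cycle if there are points $p_1,\dots,p_n$ and an ordering $l_1,\dots,l_n$ of its lines such that $\mathcal{L}_{p_i}=\{l_i,l_{i+1}\}$ (indices mod $n$), and every other point lies on exactly one line. - The free gluing $M\amalg_{p,q}N$ of simple matroids $M$ on $[d_1]$ and $N$ on $[d_2]$ at points $p\in[d_1]$, $q\in[d_2]$ is the simple rank-three matroid on $([d_1]\setminus\{p\})\sqcup([d_2]\setminus\{q\})\sqcup\{P\}$. Its lines are the lines of $M$ and of $N$, with $p$ and $q$ replaced by the new point $P$ in the lines containing them; no other dependencies are present. - A connected cactus configuration is a simple rank-three matroid obtained from a line matroid or a cycle by successively freely gluing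 with a line matroid or a cycle. - A cactus configuration is a simple rank-three matroid each of whose connected components (with respect to the relation of lying on a common line) is a connected cactus configuration. *)

theory Defs
  imports
    "HOL-Analysis.Analysis"
    "HOL-Library.Poly_Mapping"
    "HOL-Library.Set_Algebras"
begin

section \<open>Matroids and point-line configurations\<close>

record 'a matroid =
  ground :: "'a set"
  indep :: "'a set \<Rightarrow> bool"

definition is_matroid :: "'a matroid \<Rightarrow> bool" where
  "is_matroid M \<longleftrightarrow>
     finite (ground M) \<and>
     (\<forall>S. indep M S \<longrightarrow> S \<subseteq> ground M) \<and>
     indep M {} \<and>
     (\<forall>S T. indep M T \<and> S \<subseteq> T \<longrightarrow> indep M S) \<and>
     (\<forall>S T. indep M S \<and> indep M T \<and> card S < card T \<longrightarrow> (\<exists>x\<in>T - S. indep M (insert x S)))"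

definition dependent_set :: "'a matroid \<Rightarrow> 'a set \<Rightarrow> bool" where
  "dependent_set M S \<longleftrightarrow> S \<subseteq> ground M \<and> \<not> indep M S"

definition circuit :: "'a matroid \<Rightarrow> 'a set \<Rightarrow> bool" where
  "circuit M S \<longleftrightarrow> dependent_set M S \<and> (\<forall>T. T \<subset> S \<longrightarrow> indep M T)"

definition matroid_rank :: "'a matroid \<Rightarrow> nat" where
  "matroid_rank M = Max (card ` {S. indep M S})"

definition simple_matroid :: "'a matroid \<Rightarrow> bool" where
  "simple_matroid M \<longleftrightarrow>
     is_matroid M \<and> (\<forall>x\<in>ground M. indep M {x}) \<and> (\<forall>x\<in>ground M. \<forall>y\<in>ground M. indep M {x, y})"

definition restrict_matroid :: "'a matroid \<Rightarrow> 'a set \<Rightarrow> 'a matroid" where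
  "restrict_matroid M C = \<lparr>ground = ground M \<inter> C, indep = (\<lambda>S. indep M S \<and> S \<subseteq> C)\<rparr>"

definition collinear_set :: "'a matroid \<Rightarrow> 'a set \<Rightarrow> bool" where
  "collinear_set M l \<longleftrightarrow>
     l \<subseteq> ground M \<and> card l \<ge> 3 \<and> (\<forall>T. T \<subseteq> l \<and> card T = 3 \<longrightarrow> dependent_set M T)"

definition lines :: "'a matroid \<Rightarrow> 'a set set" where
  "lines M = {l. collinear_set M l \<and> (\<forall>l'. collinear_set M l' \<and> l \<subseteq> l' \<longrightarrow> l' = l)}"

definition lines_through :: "'a matroid \<Rightarrow> 'a \<Rightarrow> 'a set set" where
  "lines_through M p = {l \<in> lines M. p \<in> l}"

definition points_of_degree_ge_3 :: "'a matroid \<Rightarrow> 'a set" where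
  "points_of_degree_ge_3 M = {p \<in> ground M. card (lines_through M p) \<ge> 3}"

text \<open>The points and lines are indexed by \<open>0, \<dots>, k - 1\<close>, cyclically.\<close>

definition contains_cycle :: "'a matroid \<Rightarrow> 'a set \<Rightarrow> bool" where
  "contains_cycle M Y \<longleftrightarrow>
     (\<exists>k\<ge>2. \<exists>(x :: nat \<Rightarrow> 'a) (l :: nat \<Rightarrow> 'a set).
        inj_on x {..<k} \<and> x ` {..<k} \<subseteq> Y \<and>
        inj_on l {..<k} \<and> l ` {..<k} \<subseteq> lines M \<and>
        (\<forall>i<k. {x i, x (Suc i mod k)} \<subseteq> l i))"


section \<open>Cactus configurations\<close>

text \<open>
  No lower bound on the number of points is imposed: with at most two points one gets a matroid
  without lines, so that a point lying on no line at all is a connected component of its own.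
\<close>

definition line_matroid :: "'a matroid \<Rightarrow> bool" where
  "line_matroid M \<longleftrightarrow>
     finite (ground M) \<and> (\<forall>S. indep M S \<longleftrightarrow> S \<subseteq> ground M \<and> card S \<le> 2)"

text \<open>
  For fewer than three lines the condition is degenerate but adds nothing new: it describes the
  empty matroid, a line matroid, or two lines meeting in a point, which is a free gluing of two
  line matroids.
\<close>

definition cycle_matroid :: "'a matroid \<Rightarrow> bool" where
  "cycle_matroid M \<longleftrightarrow>
     simple_matroid M \<and> matroid_rank M \<le> 3 \<and>
     (\<exists>n (p :: nat \<Rightarrow> 'a) (l :: nat \<Rightarrow> 'a set).
        bij_betw l {..<n} (lines M) \<and>
        (\<forall>i<n. p i \<in> ground M \<and> lines_through M (p i) = {l i, l (Suc i mod n)}) \<and>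
        (\<forall>x\<in>ground M - p ` {..<n}. card (lines_through M x) = 1))"

text \<open>
  \<open>K\<close> is (an isomorphic copy of) the free gluing of \<open>M\<close> and \<open>N\<close> at \<open>p\<close> and \<open>q\<close>. The relabellings
  \<open>f\<close> and \<open>g\<close> embed the two ground sets into that of \<open>K\<close> so that they overlap only in the new
  point \<open>f p = g q\<close>. A simple matroid of rank three is determined by its lines, hence the
  condition on \<open>lines K\<close> also says that there are no other dependencies.
\<close>

definition free_gluing :: "'a matroid \<Rightarrow> 'a \<Rightarrow> 'b matroid \<Rightarrow> 'b \<Rightarrow> 'c matroid \<Rightarrow> bool" where
  "free_gluing M p N q K \<longleftrightarrow>
     simple_matroid M \<and> simple_matroid N \<and> p \<in> ground M \<and> q \<in> ground N \<and>
     simple_matroid K \<and> matroid_rank K = 3 \<and>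
     (\<exists>f g. inj_on f (ground M) \<and> inj_on g (ground N) \<and>
        f p = g q \<and>
        f ` ground M \<inter> g ` ground N = {f p} \<and>
        ground K = f ` ground M \<union> g ` ground N \<and>
        lines K = (\<lambda>l. f ` l) ` lines M \<union> (\<lambda>l. g ` l) ` lines N)"

text \<open>
  The building blocks live on the same type of points as the result. This is no restriction even
  for a finite type, since the ground set of a gluing is at least as large as those of its two
  parts and all notions involved are invariant under relabelling.
\<close>

inductive connected_cactus :: "'a matroid \<Rightarrow> bool" where
  line: "line_matroid M \<Longrightarrow> connected_cactus M"
| cycle: "cycle_matroid M \<Longrightarrow> connected_cactus M"
| glue: "connected_cactus M \<Longrightarrow> line_matroid N \<or> cycle_matroid N \<Longrightarrow>
    free_gluing M p (N :: 'a matroid) q K \<Longrightarrow> connected_cactus K"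

definition on_common_line :: "'a matroid \<Rightarrow> ('a \<times> 'a) set" where
  "on_common_line M = {(x, y). \<exists>l\<in>lines M. x \<in> l \<and> y \<in> l}"

definition connected_components :: "'a matroid \<Rightarrow> 'a set set" where
  "connected_components M =
     ground M // {(x, y) \<in> ground M \<times> ground M. (x, y) \<in> (on_common_line M)\<^sup>*}"

definition cactus_configuration :: "'a matroid \<Rightarrow> bool" where
  "cactus_configuration M \<longleftrightarrow>
     simple_matroid M \<and> matroid_rank M = 3 \<and>
     (\<forall>C\<in>connected_components M. connected_cactus (restrict_matroid M C))"


section \<open>Polynomials in the entries of a matrix of indeterminates with three rows\<close>

text \<open>
  The ground set is the finite type \<open>'n\<close>, so \<open>'n cpoly\<close> is the polynomial ring over the complex
  numbers in the \<open>3 * CARD('n)\<close> indeterminates \<open>x\<^sub>i\<^sub>j\<close>; a monomial maps indeterminates to exponents.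
\<close>

type_synonym 'n cpoly = "((3 \<times> 'n) \<Rightarrow>\<^sub>0 nat) \<Rightarrow>\<^sub>0 complex"

definition const_poly :: "complex \<Rightarrow> 'n cpoly" where
  "const_poly c = Poly_Mapping.single 0 c"

definition var_poly :: "3 \<times> 'n \<Rightarrow> 'n cpoly" where
  "var_poly v = Poly_Mapping.single (Poly_Mapping.single v 1) 1"

text \<open>Apply \<open>h\<close> to the coefficients and replace each indeterminate \<open>v\<close> by \<open>s v\<close>.\<close>

definition poly_map_eval ::
    "(complex \<Rightarrow> 'r) \<Rightarrow> (3 \<times> 'n \<Rightarrow> 'r) \<Rightarrow> 'n cpoly \<Rightarrow> 'r::comm_ring_1" where
  "poly_map_eval h s P =
     (\<Sum>m\<in>Poly_Mapping.keys P. h (Poly_Mapping.lookup P m) *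
        (\<Prod>v\<in>Poly_Mapping.keys m. s v ^ Poly_Mapping.lookup m v))"

definition eval_poly :: "'n cpoly \<Rightarrow> complex^'n^3 \<Rightarrow> complex" where
  "eval_poly P A = poly_map_eval (\<lambda>c. c) (\<lambda>(i, j). A $ i $ j) P"

definition replace_columns :: "('n \<Rightarrow> 'n cpoly^3) \<Rightarrow> 'n cpoly \<Rightarrow> 'n cpoly" where
  "replace_columns s P = poly_map_eval const_poly (\<lambda>(i, j). s j $ i) P"

definition generic_matrix :: "'n::finite cpoly^'n^3" where
  "generic_matrix = (\<chi> i j. var_poly (i, j))"

abbreviation generic_column :: "'n::finite \<Rightarrow> 'n cpoly^3" where
  "generic_column j \<equiv> column j generic_matrix"

definition bracket :: "'n::finite \<Rightarrow> 'n \<Rightarrow> 'n \<Rightarrow> 'n cpoly" where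
  "bracket i j k =
     det (transpose (vector [generic_column i, generic_column j, generic_column k]))"

text \<open>
  Leibniz formula for the minor with row set \<open>A\<close> and column set \<open>f ` A\<close>, where the bijection \<open>f\<close>
  fixes the order of the columns relative to the rows; another choice changes at most the sign.
\<close>

definition minor :: "3 set \<Rightarrow> (3 \<Rightarrow> 'n) \<Rightarrow> 'n::finite cpoly" where
  "minor A f = (\<Sum>\<pi>\<in>{\<pi>. \<pi> permutes A}. of_int (sign \<pi>) * (\<Prod>i\<in>A. generic_matrix $ \<pi> i $ f i))"

definition ideal_generated :: "'r::comm_ring_1 set \<Rightarrow> 'r set" where
  "ideal_generated S = module.span (*) S"

definition ideal_radical :: "'r::comm_ring_1 set \<Rightarrow> 'r set" where
  "ideal_radical I = {P. \<exists>n>0. P ^ n \<in> I}"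

definition vanishing_ideal :: "(complex^'n^3) set \<Rightarrow> 'n::finite cpoly set" where
  "vanishing_ideal V = {P. \<forall>A\<in>V. eval_poly P A = 0}"

definition zero_locus :: "'n::finite cpoly set \<Rightarrow> (complex^'n^3) set" where
  "zero_locus F = {A. \<forall>P\<in>F. eval_poly P A = 0}"

definition zariski_closure :: "(complex^'n^3) set \<Rightarrow> (complex^'n::finite^3) set" where
  "zariski_closure S = \<Inter>{zero_locus F | F. S \<subseteq> zero_locus F}"


section \<open>The matroid variety and its ideals\<close>

text \<open>Linear dependence over the complex numbers of a family, i.e. repetitions count.\<close>

definition dependent_family :: "('n \<Rightarrow> complex^3) \<Rightarrow> 'n set \<Rightarrow> bool" where
  "dependent_family \<gamma> S \<longleftrightarrow> \<not> (inj_on \<gamma> S \<and> vec.independent (\<gamma> ` S))"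

definition realizations :: "'n::finite matroid \<Rightarrow> (complex^'n^3) set" where
  "realizations M =
     {A. \<forall>S. S \<subseteq> ground M \<longrightarrow> (dependent_set M S \<longleftrightarrow> dependent_family (\<lambda>i. column i A) S)}"

definition matroid_variety :: "'n::finite matroid \<Rightarrow> (complex^'n^3) set" where
  "matroid_variety M = zariski_closure (realizations M)"

definition matroid_ideal :: "'n::finite matroid \<Rightarrow> 'n cpoly set" where
  "matroid_ideal M = vanishing_ideal (matroid_variety M)"

definition circuit_ideal :: "'n::finite matroid \<Rightarrow> 'n cpoly set" where
  "circuit_ideal M = ideal_generated {minor A f | A B f. circuit M B \<and> bij_betw f A B}"

definition grassmann_cayley_vectors :: "'n::finite matroid \<Rightarrow> 'n \<Rightarrow> ('n cpoly^3) set" where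
  "grassmann_cayley_vectors M x =
     {bracket p1 p2 p3 *s generic_column p4 - bracket p1 p2 p4 *s generic_column p3
      | l1 l2 p1 p2 p3 p4.
        l1 \<in> lines_through M x \<and> l2 \<in> lines_through M x \<and> l1 \<noteq> l2 \<and>
        p1 \<in> l1 \<and> p2 \<in> l1 \<and> p1 \<noteq> p2 \<and> p3 \<in> l2 \<and> p4 \<in> l2 \<and> p3 \<noteq> p4}"

text \<open>
  In one step the columns of an arbitrary set of points are replaced simultaneously; the columns
  with \<open>s x = generic_column x\<close> are those left alone.
\<close>

fun grassmann_cayley_set :: "'n::finite matroid \<Rightarrow> nat \<Rightarrow> 'n cpoly set" where
  "grassmann_cayley_set M 0 = {bracket i j k | i j k. circuit M {i, j, k}}"
| "grassmann_cayley_set M (Suc m) =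
     {replace_columns s P | s P. P \<in> grassmann_cayley_set M m \<and>
        (\<forall>x. s x = generic_column x \<or> s x \<in> grassmann_cayley_vectors M x)}"

text \<open>The value at which an ascending chain of ideals becomes stationary is its union.\<close>

definition grassmann_cayley_ideal :: "'n::finite matroid \<Rightarrow> 'n cpoly set" where
  "grassmann_cayley_ideal M = (\<Union>m. ideal_generated (grassmann_cayley_set M m))"

end

theory Submission
  imports Defs "HOL-Computational_Algebra.Fundamental_Theorem_Algebra"
begin

text \<open>
  By the Nullstellensatz the claim is that every common zero \<open>\<gamma>\<close> of the circuit ideal and the
  Grassmann-Cayley ideal is a limit of realizations; conversely, a Grassmann-Cayley replacement in
  a realization only rescales the column that it replaces, so all generators vanish there.

  The common zeros are stable under replacements. Replacing vanishing columns of \<open>\<gamma>\<close> as long as this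
  makes them non-zero, one reaches a configuration in which all rank-two lines through a point with
  vanishing column span the same plane. The remaining vanishing columns are then filled in one by
  one so that all lines keep rank at most two. At a point of degree at least three this works as
  long as at most one of its lines has been altered before, and since these points contain no
  cycle, they can be ordered accordingly. Hence \<open>\<gamma>\<close> is obtained from a configuration without
  vanishing columns by multiplying some columns by zero.

  A configuration without vanishing columns, together with a covector for each line, is perturbed
  into general position by induction along the cactus: a new point (line) that is incident with at
  most one old line (point) can be chosen generically, and a line that closes a cycle is spanned by
  its two old points once these have been made distinct, which is possible because the cycle has
  length at least three.
\<close>

section \<open>Evaluation of polynomials\<close>

text \<open>Two dimension counts shape the argument. A vector of three-dimensional space can satisfy
  two linear conditions and still be nonzero. When a vanishing column is filled in, one condition is
  spent on the common plane of the untouched lines and the other on the one line altered before;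
  hence the bound of one altered line at a point of high degree, and hence points of degree at most
  two can always be filled in. Dually, two points determine a line, so a line that closes a cycle
  has no freedom of its own.

  The obstacle to perturbing is that the points of a line may be parallel, so that their vectors
  single out no plane. Carrying a covector for each line as extra data removes it: points and lines
  become objects of the same kind, and one perturbation lemma serves both.

  Euclidean limits are enough for the vanishing ideal because polynomials are continuous. The
  Nullstellensatz is obtained from the uncountability of the field, not from dimension
  theory.\<close>

definition monom_eval :: "(3 \<times> 'n \<Rightarrow> 'r) \<Rightarrow> ((3 \<times> 'n) \<Rightarrow>\<^sub>0 nat) \<Rightarrow> 'r::comm_ring_1" where
  "monom_eval s m = (\<Prod>v\<in>Poly_Mapping.keys m. s v ^ Poly_Mapping.lookup m v)"

text \<open>A range of multiplication that does not depend on the monomial lets exponents add factor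
  by factor.\<close>

lemma monom_eval_UNIV:
  fixes s :: "3 \<times> 'n::finite \<Rightarrow> 'r::comm_ring_1"
  shows "monom_eval s m = (\<Prod>v\<in>UNIV. s v ^ Poly_Mapping.lookup m v)"
  unfolding monom_eval_def
  by (rule prod.mono_neutral_left) (auto simp: in_keys_iff)

lemma monom_eval_0 [simp]: "monom_eval s 0 = 1"
  by (simp add: monom_eval_def)

lemma monom_eval_add:
  fixes s :: "3 \<times> 'n::finite \<Rightarrow> 'r::comm_ring_1"
  shows "monom_eval s (m + m') = monom_eval s m * monom_eval s m'"
  by (simp add: monom_eval_UNIV lookup_add power_add prod.distrib)

lemma poly_mapping_sum_singles:
  "P = (\<Sum>m\<in>Poly_Mapping.keys P. Poly_Mapping.single m (Poly_Mapping.lookup P m))"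
proof (rule poly_mapping_eqI)
  fix k
  have "(\<Sum>m\<in>Poly_Mapping.keys P. Poly_Mapping.lookup (Poly_Mapping.single m (Poly_Mapping.lookup P m)) k)
     = (\<Sum>m\<in>Poly_Mapping.keys P. if k = m then Poly_Mapping.lookup P m else 0)"
    by (rule sum.cong) (auto simp: lookup_single)
  also have "\<dots> = Poly_Mapping.lookup P k"
    by (auto simp: in_keys_iff)
  finally show "Poly_Mapping.lookup P k = Poly_Mapping.lookup
      (\<Sum>m\<in>Poly_Mapping.keys P. Poly_Mapping.single m (Poly_Mapping.lookup P m)) k"
    by (simp add: lookup_sum)
qed

lemma eval_poly_monoms:
  "eval_poly P A = (\<Sum>m\<in>Poly_Mapping.keys P. Poly_Mapping.lookup P m * monom_eval (\<lambda>(i, j). A $ i $ j) m)"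
  by (simp add: eval_poly_def poly_map_eval_def monom_eval_def)

lemma eval_poly_superset:
  assumes "finite F" "Poly_Mapping.keys P \<subseteq> F"
  shows "eval_poly P A = (\<Sum>m\<in>F. Poly_Mapping.lookup P m * monom_eval (\<lambda>(i, j). A $ i $ j) m)"
  unfolding eval_poly_monoms
  by (rule sum.mono_neutral_left) (use assms in \<open>auto simp: in_keys_iff\<close>)

lemma eval_poly_single:
  "eval_poly (Poly_Mapping.single m c) A = c * monom_eval (\<lambda>(i, j). A $ i $ j) m"
  by (simp add: eval_poly_superset[of "{m}"] )

lemma eval_poly_0 [simp]: "eval_poly 0 A = 0"
  by (simp add: eval_poly_monoms)

lemma eval_poly_1 [simp]: "eval_poly 1 A = 1"
  using eval_poly_single[of 0 1 A] by simp

lemma eval_poly_const [simp]: "eval_poly (const_poly c) A = c"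
  by (simp add: const_poly_def eval_poly_single)

lemma eval_poly_var [simp]: "eval_poly (var_poly (i, j)) A = A $ i $ j"
  by (simp add: var_poly_def eval_poly_single monom_eval_def)

lemma eval_poly_add [simp]: "eval_poly (P + Q) A = eval_poly P A + eval_poly Q A"
proof -
  let ?F = "Poly_Mapping.keys P \<union> Poly_Mapping.keys Q"
  have "Poly_Mapping.keys (P + Q) \<subseteq> ?F"
    by (rule keys_add)
  then show ?thesis
    by (simp add: eval_poly_superset[of ?F] lookup_add sum.distrib algebra_simps)
qed

lemma eval_poly_uminus [simp]: "eval_poly (- P) A = - eval_poly P A"
  using eval_poly_add[of P "- P" A] by (simp add: eq_neg_iff_add_eq_0 add.commute)

lemma eval_poly_diff [simp]: "eval_poly (P - Q) A = eval_poly P A - eval_poly Q A"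
  using eval_poly_add[of P "- Q" A] by simp

lemma eval_poly_sum: "eval_poly (\<Sum>x\<in>X. f x) A = (\<Sum>x\<in>X. eval_poly (f x) A)"
  by (induction X rule: infinite_finite_induct) auto

lemma eval_poly_mult [simp]:
  fixes P Q :: "'n::finite cpoly"
  shows "eval_poly (P * Q) A = eval_poly P A * eval_poly Q A"
proof -
  let ?e = "monom_eval (\<lambda>(i, j). A $ i $ j)"
  have "P * Q = (\<Sum>m\<in>Poly_Mapping.keys P. \<Sum>m'\<in>Poly_Mapping.keys Q.
      Poly_Mapping.single m (Poly_Mapping.lookup P m) * Poly_Mapping.single m' (Poly_Mapping.lookup Q m'))"
    by (subst poly_mapping_sum_singles[of P], subst poly_mapping_sum_singles[of Q])
       (simp add: sum_product)
  then have "eval_poly (P * Q) A = (\<Sum>m\<in>Poly_Mapping.keys P. \<Sum>m'\<in>Poly_Mapping.keys Q.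
      (Poly_Mapping.lookup P m * ?e m) * (Poly_Mapping.lookup Q m' * ?e m'))"
    by (simp add: eval_poly_sum mult_single eval_poly_single monom_eval_add algebra_simps)
  also have "\<dots> = eval_poly P A * eval_poly Q A"
    by (simp add: eval_poly_monoms sum_product)
  finally show ?thesis .
qed

lemma eval_poly_power [simp]:
  fixes P :: "'n::finite cpoly"
  shows "eval_poly (P ^ k) A = eval_poly P A ^ k"
  by (induction k) auto

lemma eval_poly_prod:
  fixes f :: "'a \<Rightarrow> 'n::finite cpoly"
  shows "eval_poly (\<Prod>x\<in>X. f x) A = (\<Prod>x\<in>X. eval_poly (f x) A)"
  by (induction X rule: infinite_finite_induct) auto

lemma eval_poly_of_int [simp]:
  fixes A :: "complex^'n::finite^3"
  shows "eval_poly (of_int k) A = of_int k"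
proof -
  have nat: "eval_poly (of_nat n) A = of_nat n" for n
    by (induction n) auto
  show ?thesis
    by (cases k rule: int_cases2) (auto simp: nat)
qed

text \<open>This moves the Grassmann-Cayley construction from polynomials to points: replacing
  columns of variables amounts to evaluating at a matrix with moved columns.\<close>

lemma eval_poly_replace_columns:
  fixes P :: "'n::finite cpoly"
  shows "eval_poly (replace_columns s P) A = eval_poly P (\<chi> i j. eval_poly (s j $ i) A)"
proof -
  have "eval_poly (replace_columns s P) A = (\<Sum>m\<in>Poly_Mapping.keys P.
      Poly_Mapping.lookup P m * monom_eval (\<lambda>(i, j). eval_poly (s j $ i) A) m)"
    by (simp add: replace_columns_def poly_map_eval_def eval_poly_sum eval_poly_prod
        monom_eval_def case_prod_unfold)
  then show ?thesis
    by (simp add: eval_poly_monoms)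
qed

lemma continuous_on_eval_poly: "continuous_on UNIV (eval_poly P)"
  unfolding eval_poly_monoms[abs_def] monom_eval_def case_prod_unfold
  by (intro continuous_intros)

lemma var_poly_power: "var_poly v ^ k = Poly_Mapping.single (Poly_Mapping.single v k) 1"
  by (induction k) (auto simp: var_poly_def mult_single single_add[symmetric])

lemma single_eq_prod_vars:
  fixes m :: "(3 \<times> 'n) \<Rightarrow>\<^sub>0 nat"
  shows "(Poly_Mapping.single m 1 :: 'n cpoly) = (\<Prod>v\<in>Poly_Mapping.keys m. var_poly v ^ Poly_Mapping.lookup m v)"
proof -
  have "(\<Prod>v\<in>X. var_poly v ^ Poly_Mapping.lookup m v) =
    (Poly_Mapping.single (\<Sum>v\<in>X. Poly_Mapping.single v (Poly_Mapping.lookup m v)) 1 :: 'n cpoly)"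
    if "finite X" for X
    using that by induction (auto simp: var_poly_power mult_single)
  then show ?thesis
    using poly_mapping_sum_singles[of m] by simp
qed

lemma single_eq_const_mult: "Poly_Mapping.single m c = const_poly c * (Poly_Mapping.single m 1 :: 'n cpoly)"
  by (simp add: const_poly_def mult_single)

text \<open>The trivial replacement; it makes the Grassmann-Cayley sets an ascending chain.\<close>

lemma replace_columns_generic: "replace_columns generic_column P = P"
  unfolding replace_columns_def poly_map_eval_def
  by (subst (4) poly_mapping_sum_singles)
     (auto simp: single_eq_const_mult[symmetric] generic_matrix_def column_def single_eq_prod_vars[symmetric]
        case_prod_unfold)

section \<open>Ideals\<close>

text \<open>
  A global interpretation would turn \<open>module.scale_scale\<close> into the simp rule \<open>a * (b * x) = a * b * x\<close>,
  which loops together with \<open>ac_simps\<close>.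
\<close>

lemma module_mult: "module ((*) :: 'r::comm_ring_1 \<Rightarrow> 'r \<Rightarrow> 'r)"
  by standard (auto simp: algebra_simps)

definition is_ideal :: "'r::comm_ring_1 set \<Rightarrow> bool" where
  "is_ideal I \<longleftrightarrow> 0 \<in> I \<and> (\<forall>a\<in>I. \<forall>b\<in>I. a + b \<in> I) \<and> (\<forall>r. \<forall>a\<in>I. r * a \<in> I)"

lemma is_ideal_iff_subspace: "is_ideal I \<longleftrightarrow> module.subspace (*) I"
  by (auto simp: is_ideal_def module.subspace_def[OF module_mult])

lemma is_idealD:
  assumes "is_ideal I"
  shows "0 \<in> I" "a \<in> I \<Longrightarrow> b \<in> I \<Longrightarrow> a + b \<in> I" "a \<in> I \<Longrightarrow> r * a \<in> I" "a \<in> I \<Longrightarrow> a * r \<in> I"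
    "a \<in> I \<Longrightarrow> b \<in> I \<Longrightarrow> a - b \<in> I"
  using assms module.subspace_diff[OF module_mult, of I a b]
  by (auto simp: is_ideal_def is_ideal_iff_subspace[symmetric] mult.commute[of _ r])

lemma is_ideal_generated: "is_ideal (ideal_generated S)"
  by (simp add: is_ideal_iff_subspace ideal_generated_def module.subspace_span[OF module_mult])

lemma ideal_generated_superset: "S \<subseteq> ideal_generated S"
  by (simp add: ideal_generated_def module.span_superset[OF module_mult])

lemma ideal_generated_mono: "S \<subseteq> T \<Longrightarrow> ideal_generated S \<subseteq> ideal_generated T"
  by (simp add: ideal_generated_def module.span_mono[OF module_mult])

lemma is_ideal_sum:
  assumes "is_ideal I" "is_ideal J"
  shows "is_ideal (I + J)"
  unfolding is_ideal_def
proof (intro conjI ballI allI)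
  show "0 \<in> I + J"
    using set_plus_intro[OF is_idealD(1)[OF assms(1)] is_idealD(1)[OF assms(2)]] by simp
next
  fix a b assume "a \<in> I + J" "b \<in> I + J"
  then obtain x y x' y' where "a = x + y" "b = x' + y'" "x \<in> I" "y \<in> J" "x' \<in> I" "y' \<in> J"
    by (auto elim!: set_plus_elim)
  then have "a + b = (x + x') + (y + y')" "x + x' \<in> I" "y + y' \<in> J"
    using assms by (auto simp: is_idealD)
  then show "a + b \<in> I + J" by (auto intro: set_plus_intro)
next
  fix r a assume "a \<in> I + J"
  then obtain x y where "a = x + y" "x \<in> I" "y \<in> J"
    by (auto elim!: set_plus_elim)
  then have "r * a = r * x + r * y" "r * x \<in> I" "r * y \<in> J"
    using assms by (auto simp: is_idealD algebra_simps)
  then show "r * a \<in> I + J" by (auto intro: set_plus_intro)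
qed

lemma is_ideal_Union_chain:
  assumes "C \<noteq> {}" "\<And>I. I \<in> C \<Longrightarrow> is_ideal I" "\<And>I J. I \<in> C \<Longrightarrow> J \<in> C \<Longrightarrow> I \<subseteq> J \<or> J \<subseteq> I"
  shows "is_ideal (\<Union>C)"
  unfolding is_ideal_def
proof (intro conjI ballI allI)
  show "0 \<in> \<Union>C"
    using assms by (auto simp: is_ideal_def)
next
  fix a b assume "a \<in> \<Union>C" "b \<in> \<Union>C"
  then obtain I J where "I \<in> C" "J \<in> C" "a \<in> I" "b \<in> J" by auto
  then show "a + b \<in> \<Union>C"
    using assms(3)[of I J] assms(2) by (meson UnionI is_idealD(2) subsetD)
next
  fix r a assume "a \<in> \<Union>C"
  then obtain I where "I \<in> C" "a \<in> I" by auto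
  then have "r * a \<in> I"
    using assms(2) is_idealD(3) by blast
  then show "r * a \<in> \<Union>C"
    using \<open>I \<in> C\<close> by blast
qed

lemma eval_poly_ideal_generated:
  fixes A :: "complex^'n::finite^3"
  assumes "P \<in> ideal_generated S" "\<And>Q. Q \<in> S \<Longrightarrow> eval_poly Q A = 0"
  shows "eval_poly P A = 0"
  using assms(1) unfolding ideal_generated_def
  by (induction rule: module.span_induct_alt[OF module_mult, consumes 1]) (auto simp: assms(2))

lemma grassmann_cayley_set_Suc: "grassmann_cayley_set M m \<subseteq> grassmann_cayley_set M (Suc m)"
proof
  fix P assume "P \<in> grassmann_cayley_set M m"
  then show "P \<in> grassmann_cayley_set M (Suc m)"
    using replace_columns_generic[of P, symmetric] by auto
qed

lemma is_ideal_grassmann_cayley_ideal: "is_ideal (grassmann_cayley_ideal M)"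
proof -
  have "mono (\<lambda>m. ideal_generated (grassmann_cayley_set M m))"
    by (intro mono_iff_le_Suc[THEN iffD2] allI ideal_generated_mono grassmann_cayley_set_Suc)
  then show ?thesis
    unfolding grassmann_cayley_ideal_def
    by (intro is_ideal_Union_chain) (auto simp: is_ideal_generated, meson monoD nle_le subsetD)
qed

section \<open>The Nullstellensatz over the complex numbers\<close>

text \<open>Zorn's lemma. Avoiding all powers of \<open>P\<close>, and not only 1, amounts to
  working in the localization at \<open>P\<close> and replaces the Rabinowitsch trick.\<close>

lemma exists_maximal_avoiding_ideal:
  fixes J :: "'r::comm_ring_1 set"
  assumes "is_ideal J" "P \<notin> ideal_radical J"
  obtains I where "is_ideal I" "J \<subseteq> I" "\<And>n. P ^ n \<notin> I"
    "\<And>K. is_ideal K \<Longrightarrow> I \<subseteq> K \<Longrightarrow> K \<noteq> I \<Longrightarrow> \<exists>n. P ^ n \<in> K"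
proof -
  define F where "F = {I. is_ideal I \<and> J \<subseteq> I \<and> (\<forall>n. P ^ n \<notin> I)}"
  have "P ^ n \<notin> J" for n
  proof (cases n)
    \<comment> \<open>The radical asks for a positive exponent, so 1 in \<open>J\<close> is first
      turned into \<open>P\<close> in \<open>J\<close>.\<close>
    case 0
    show ?thesis
    proof
      assume "P ^ n \<in> J"
      then have "P ^ 1 \<in> J"
        using is_idealD(3)[OF assms(1), of 1 P] 0 by simp
      then show False
        using assms(2) unfolding ideal_radical_def by blast
    qed
  qed (use assms(2) in \<open>auto simp: ideal_radical_def\<close>)
  then have "J \<in> F"
    using assms(1) by (auto simp: F_def)
  have "\<exists>I\<in>F. \<forall>K\<in>F. I \<subseteq> K \<longrightarrow> K = I"
  proof (rule Zorn_Lemma2, rule ballI)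
    fix C assume C: "C \<in> chains F"
    show "\<exists>U\<in>F. \<forall>X\<in>C. X \<subseteq> U"
    proof (cases "C = {}")
      case False
      have sub: "C \<subseteq> F"
        using C by (rule chainsD2)
      have "is_ideal (\<Union>C)"
        by (rule is_ideal_Union_chain) (use False sub chainsD[OF C] in \<open>auto simp: F_def\<close>)
      then have "\<Union>C \<in> F"
        using False sub by (fastforce simp: F_def)
      then show ?thesis by blast
    qed (use \<open>J \<in> F\<close> in auto)
  qed
  then obtain I where I: "I \<in> F" "\<forall>K\<in>F. I \<subseteq> K \<longrightarrow> K = I" by blast
  show ?thesis
  proof (rule that[of I])
    show "\<exists>n. P ^ n \<in> K" if "is_ideal K" "I \<subseteq> K" "K \<noteq> I" for K
    proof (rule ccontr)
      assume "\<nexists>n. P ^ n \<in> K"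
      moreover have "J \<subseteq> K"
        using I(1) that(2) by (auto simp: F_def)
      ultimately have "K \<in> F"
        using that(1) by (simp add: F_def)
      then show False
        using I(2) that(2,3) by blast
    qed
  qed (use I(1) in \<open>simp_all add: F_def\<close>)
qed

lemma is_ideal_add_principal:
  fixes I :: "'r::comm_ring_1 set"
  assumes "is_ideal I"
  shows "is_ideal {a + b * q | a b. a \<in> I}"
  unfolding is_ideal_def
proof (intro conjI ballI allI)
  show "0 \<in> {a + b * q | a b. a \<in> I}"
    using is_idealD(1)[OF assms] by (auto intro!: exI[of _ 0])
next
  fix x y assume "x \<in> {a + b * q | a b. a \<in> I}" "y \<in> {a + b * q | a b. a \<in> I}"
  then obtain a b a' b' where "x = a + b * q" "y = a' + b' * q" "a \<in> I" "a' \<in> I" by auto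
  then have "x + y = (a + a') + (b + b') * q" "a + a' \<in> I"
    using assms by (auto simp: algebra_simps is_idealD)
  then show "x + y \<in> {a + b * q | a b. a \<in> I}" by blast
next
  fix r x assume "x \<in> {a + b * q | a b. a \<in> I}"
  then obtain a b where "x = a + b * q" "a \<in> I" by auto
  then have "r * x = r * a + (r * b) * q" "r * a \<in> I"
    using assms by (auto simp: algebra_simps is_idealD)
  then show "r * x \<in> {a + b * q | a b. a \<in> I}" by blast
qed

text \<open>In the localization at \<open>P\<close>, everything outside \<open>I\<close> is
  invertible modulo \<open>I\<close>: enlarging \<open>I\<close> by \<open>q\<close> must capture a
  power of \<open>P\<close>. The element \<open>b\<close> is the inverse of \<open>q\<close> up to
  that power.\<close>

lemma maximal_avoiding_add_principal:
  fixes I :: "'r::comm_ring_1 set"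
  assumes I: "is_ideal I" and max: "\<And>K. is_ideal K \<Longrightarrow> I \<subseteq> K \<Longrightarrow> K \<noteq> I \<Longrightarrow> \<exists>n. P ^ n \<in> K"
    and q: "q \<notin> I"
  obtains n b where "P ^ n - b * q \<in> I"
proof -
  let ?K = "{a + b * q | a b. a \<in> I}"
  have "q = 0 + 1 * q" by simp
  then have "q \<in> ?K"
    using is_idealD(1)[OF I] by blast
  have "I \<subseteq> ?K"
  proof
    fix a assume "a \<in> I"
    moreover have "a = a + 0 * q" by simp
    ultimately show "a \<in> ?K" by blast
  qed
  then obtain n where "P ^ n \<in> ?K"
    using max[OF is_ideal_add_principal[OF I, of q]] q \<open>q \<in> ?K\<close> by auto
  then obtain a b where "P ^ n = a + b * q" "a \<in> I" by auto
  then show ?thesis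
    by (intro that[of n b]) auto
qed

lemma maximal_avoiding_prime:
  fixes I :: "'r::comm_ring_1 set"
  assumes I: "is_ideal I" and avoid: "\<And>n. P ^ n \<notin> I"
    and max: "\<And>K. is_ideal K \<Longrightarrow> I \<subseteq> K \<Longrightarrow> K \<noteq> I \<Longrightarrow> \<exists>n. P ^ n \<in> K"
    and "x * y \<in> I"
  shows "x \<in> I \<or> y \<in> I"
proof (rule ccontr)
  assume *: "\<not> (x \<in> I \<or> y \<in> I)"
  obtain n b where n: "P ^ n - b * x \<in> I"
    using maximal_avoiding_add_principal[OF I max, of x] * by auto
  obtain m c where m: "P ^ m - c * y \<in> I"
    using maximal_avoiding_add_principal[OF I max, of y] * by auto
  \<comment> \<open>Multiplying the two congruences expresses a power of \<open>P\<close> through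
    \<open>x * y\<close> modulo \<open>I\<close>.\<close>
  have "P ^ (n + m) = (P ^ n - b * x) * P ^ m + (P ^ m - c * y) * (b * x) + (b * c) * (x * y)"
    unfolding power_add by (simp only: left_diff_distrib right_diff_distrib ac_simps) simp
  moreover have "\<dots> \<in> I"
    using is_idealD(2)[OF I is_idealD(2)[OF I is_idealD(4)[OF I n] is_idealD(4)[OF I m]] is_idealD(3)[OF I assms(4)]] .
  ultimately show False
    using avoid[of "n + m"] by auto
qed

section \<open>Univariate polynomials in a single indeterminate\<close>

lemma const_poly_simps:
  "const_poly 0 = 0" "const_poly 1 = 1" "const_poly (a + b) = const_poly a + const_poly b"
  "const_poly (a - b) = const_poly a - const_poly b"
  "const_poly (a * b) = const_poly a * const_poly b"
  "const_poly (- a) = - const_poly a"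
  by (simp_all add: const_poly_def single_add single_diff single_uminus mult_single)

lemma vector_space_cpoly: "vector_space (\<lambda>c P. const_poly c * P :: 'n cpoly)"
  by standard (auto simp: const_poly_simps algebra_simps)

text \<open>A ring homomorphism from \<open>complex poly\<close>; through it the fundamental theorem
  of algebra applies to polynomials in one indeterminate.\<close>

definition poly_in_var :: "3 \<times> 'n \<Rightarrow> complex poly \<Rightarrow> 'n cpoly" where
  "poly_in_var v p = poly (map_poly const_poly p) (var_poly v)"

lemma poly_in_var_0 [simp]: "poly_in_var v 0 = 0"
  by (simp add: poly_in_var_def)

lemma poly_in_var_pCons: "poly_in_var v (pCons a p) = const_poly a + var_poly v * poly_in_var v p"
  by (cases "a = 0 \<and> p = 0") (auto simp: poly_in_var_def map_poly_pCons const_poly_simps)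

lemma poly_in_var_1 [simp]: "poly_in_var v 1 = 1"
  by (simp add: one_pCons poly_in_var_pCons const_poly_simps)

lemma poly_in_var_const: "poly_in_var v [:a:] = const_poly a"
  by (simp add: poly_in_var_pCons)

lemma poly_in_var_add: "poly_in_var v (p + q) = poly_in_var v p + poly_in_var v q"
  by (induction p q rule: poly_induct2) (simp_all add: poly_in_var_pCons const_poly_simps distrib_left ac_simps)

lemma poly_in_var_smult: "poly_in_var v (smult a p) = const_poly a * poly_in_var v p"
  by (induction p) (simp_all add: poly_in_var_pCons const_poly_simps distrib_left ac_simps)

lemma poly_in_var_mult: "poly_in_var v (p * q) = poly_in_var v p * poly_in_var v q"
  by (induction p) (simp_all add: poly_in_var_add poly_in_var_smult poly_in_var_pCons const_poly_simps
      distrib_left distrib_right ac_simps)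

lemma poly_in_var_sum: "poly_in_var v (\<Sum>x\<in>X. f x) = (\<Sum>x\<in>X. poly_in_var v (f x))"
  by (induction X rule: infinite_finite_induct) (simp_all add: poly_in_var_add)

lemma poly_in_var_prod: "poly_in_var v (\<Prod>x\<in>X. f x) = (\<Prod>x\<in>X. poly_in_var v (f x))"
  by (induction X rule: infinite_finite_induct) (simp_all add: poly_in_var_mult)

lemma poly_in_var_linear: "poly_in_var v [:- d, 1:] = var_poly v - const_poly d"
  by (simp add: poly_in_var_pCons const_poly_simps)

lemma module_cpoly: "module (\<lambda>c P. const_poly c * P :: 'n cpoly)"
  by standard (auto simp: const_poly_simps algebra_simps)

text \<open>Countably many monomials have only countably many finite sets of monomials, to be played
  off against an uncountable field.\<close>

lemma countable_poly_mapping: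
  "countable (UNIV :: (('a::finite) \<Rightarrow>\<^sub>0 nat) set)"
proof -
  have "countable (UNIV :: ('a \<Rightarrow> nat) set)"
    using countableI_type by blast
  then show ?thesis
    using countable_image_inj_on[of Poly_Mapping.lookup UNIV]
    by (metis countable_subset inj_onI poly_mapping_eqI subset_UNIV)
qed

text \<open>
  If no \<open>v - c\<close> belonged to \<open>I\<close>, every \<open>c\<close> would have an inverse \<open>b c\<close> of \<open>v - c\<close> up to a power
  of \<open>P\<close> modulo \<open>I\<close>. As \<open>\<complex>\<close> is uncountable, infinitely many of the \<open>b c\<close> lie in one
  finite-dimensional space of polynomials and are dependent; clearing denominators in the relation
  yields a non-zero polynomial in \<open>v\<close> alone, a product of factors \<open>v - c\<close>, in the prime \<open>I\<close>.
\<close>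

lemma maximal_avoiding_var:
  fixes I :: "'n::finite cpoly set"
  assumes I: "is_ideal I" and avoid: "\<And>n. P ^ n \<notin> I"
    and max: "\<And>K. is_ideal K \<Longrightarrow> I \<subseteq> K \<Longrightarrow> K \<noteq> I \<Longrightarrow> \<exists>n. P ^ n \<in> K"
  shows "\<exists>c. var_poly v - const_poly c \<in> I"
proof (rule ccontr)
  assume "\<not> ?thesis"
  then have nonmem: "var_poly v - const_poly c \<notin> I" for c by blast
  note prime = maximal_avoiding_prime[OF I avoid max]
  let ?x = "\<lambda>c. var_poly v - const_poly c :: 'n cpoly"
  have "\<forall>c. \<exists>n b. P ^ n - b * ?x c \<in> I"
    using maximal_avoiding_add_principal[OF I max nonmem] by metis
  then obtain n b where nb: "\<And>c. P ^ n c - b c * ?x c \<in> I" by metis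
  \<comment> \<open>On one fibre of \<open>key\<close> the exponent of \<open>P\<close> is the same
    for all \<open>c\<close>, and all \<open>b c\<close> lie in the space spanned by one finite set
    of monomials.\<close>
  define key where "key c = (n c, Poly_Mapping.keys (b c))" for c
  have "countable ((UNIV :: nat set) \<times> {K :: ((3 \<times> 'n) \<Rightarrow>\<^sub>0 nat) set. finite K})"
    using countable_Collect_finite_subset[OF countable_poly_mapping[where 'a = "3 \<times> 'n"]]
    by (intro countable_SIGMA) simp_all
  then have "countable (range key)"
    by (rule countable_subset[rotated]) (auto simp: key_def)
  have "\<exists>k. infinite (key -` {k})"
  proof (rule ccontr)
    assume "\<nexists>k. infinite (key -` {k})"
    then have "countable (key -` {k})" for k
      using countable_finite by metis
    with \<open>countable (range key)\<close> have "countable (\<Union>k\<in>range key. key -` {k})"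
      by (rule countable_UN)
    moreover have "(\<Union>k\<in>range key. key -` {k}) = UNIV" by auto
    ultimately show False
      using uncountable_UNIV_complex by simp
  qed
  then obtain N K where inf: "infinite (key -` {(N, K)})" by auto
  define C where "C = key -` {(N, K)}"
  have C: "n c = N" "Poly_Mapping.keys (b c) = K" if "c \<in> C" for c
    using that by (auto simp: C_def key_def)
  have "finite K"
    using inf C(2) by (metis C_def finite.emptyI finite_keys ex_in_conv)
  have rel: "P ^ N - b c * ?x c \<in> I" if "c \<in> C" for c
    using nb[of c] C(1)[OF that] by simp
  \<comment> \<open>Injectivity makes infinitely many constants yield infinitely many vectors
    \<open>b c\<close>; subtracting the relations of \<open>c\<close> and \<open>d\<close> would
    otherwise leave a nonzero multiple of \<open>b c\<close> in \<open>I\<close>.\<close>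
  have "inj_on b C"
  proof (rule inj_onI, rule ccontr)
    fix c d assume cd: "c \<in> C" "d \<in> C" "b c = b d" "c \<noteq> d"
    have "(P ^ N - b c * ?x c) - (P ^ N - b d * ?x d) = b c * const_poly (c - d)"
      using cd(3) by (simp add: algebra_simps const_poly_simps)
    moreover have "(P ^ N - b c * ?x c) - (P ^ N - b d * ?x d) \<in> I"
      using is_idealD(5)[OF I rel[OF cd(1)] rel[OF cd(2)]] .
    ultimately have "b c * const_poly (c - d) \<in> I" by simp
    then have "b c * const_poly (c - d) * const_poly (1 / (c - d)) \<in> I"
      by (rule is_idealD(4)[OF I])
    then have "b c \<in> I"
      using cd(4) by (simp add: mult.assoc const_poly_simps(5)[symmetric] const_poly_simps(2))
    then have "(P ^ N - b c * ?x c) + b c * ?x c \<in> I"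
      using is_idealD(2)[OF I rel[OF cd(1)] is_idealD(4)[OF I]] by blast
    then show False
      using avoid[of N] by simp
  qed
  have "b ` C \<subseteq> module.span (\<lambda>c P. const_poly c * P) ((\<lambda>m. Poly_Mapping.single m 1) ` K)"
  proof (rule image_subsetI)
    fix c assume "c \<in> C"
    have "b c = (\<Sum>m\<in>K. const_poly (Poly_Mapping.lookup (b c) m) * Poly_Mapping.single m 1)"
      using poly_mapping_sum_singles[of "b c"] C(2)[OF \<open>c \<in> C\<close>] by (simp add: single_eq_const_mult[symmetric])
    also have "\<dots> \<in> module.span (\<lambda>c P. const_poly c * P) ((\<lambda>m. Poly_Mapping.single m 1) ` K)"
      by (intro module.span_sum[OF module_cpoly] module.span_scale[OF module_cpoly] module.span_base[OF module_cpoly]) auto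
    finally show "b c \<in> module.span (\<lambda>c P. const_poly c * P) ((\<lambda>m. Poly_Mapping.single m 1) ` K)" .
  qed
  then have "module.dependent (\<lambda>c P. const_poly c * P) (b ` C)"
    using vector_space.independent_span_bound[OF vector_space_cpoly, of "(\<lambda>m. Poly_Mapping.single m 1) ` K" "b ` C"] \<open>finite K\<close>
      finite_imageD[OF _ \<open>inj_on b C\<close>] inf by (auto simp: C_def)
  then obtain T u where T: "finite T" "T \<subseteq> b ` C" "(\<Sum>q\<in>T. const_poly (u q) * q) = 0" "\<exists>q\<in>T. u q \<noteq> 0"
    unfolding module.dependent_explicit[OF module_cpoly] by blast
  define D where "D = {c \<in> C. b c \<in> T}"
  have bij: "bij_betw b D T"
    using T(2) \<open>inj_on b C\<close> by (auto simp: bij_betw_def D_def inj_on_def)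
  then have "finite D"
    using T(1) bij_betw_finite by blast
  define w where "w c = u (b c)" for c
  have sum0: "(\<Sum>c\<in>D. const_poly (w c) * b c) = 0"
    using T(3) sum.reindex_bij_betw[OF bij, of "\<lambda>q. const_poly (u q) * q"] by (simp add: w_def)
  obtain c0 where c0: "c0 \<in> D" "w c0 \<noteq> 0"
    using T(4) bij by (auto simp: bij_betw_def w_def)
  \<comment> \<open>Multiply the linear relation among the \<open>b c\<close> by all factors
    \<open>v - d\<close> and trade each \<open>b c * (v - c)\<close> for \<open>P ^ N\<close>: what
    is left is \<open>P ^ N * R\<close>, which is therefore zero modulo \<open>I\<close>.\<close>
  define R where "R = (\<Sum>c\<in>D. const_poly (w c) * (\<Prod>d\<in>D - {c}. ?x d))"
  have "P ^ N * R \<in> I"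
  proof -
    have split: "p * (u * r) = (p - q * x) * (u * r) + u * q * (x * r)" for p u r q x :: "'n cpoly"
      by (simp only: left_diff_distrib right_diff_distrib ac_simps) simp
    have "P ^ N * R = (\<Sum>c\<in>D. (P ^ N - b c * ?x c) * (const_poly (w c) * (\<Prod>d\<in>D - {c}. ?x d)))
        + (\<Sum>c\<in>D. const_poly (w c) * b c * (?x c * (\<Prod>d\<in>D - {c}. ?x d)))"
      unfolding R_def sum_distrib_left sum.distrib[symmetric] by (intro sum.cong refl split)
    also have "(\<Sum>c\<in>D. const_poly (w c) * b c * (?x c * (\<Prod>d\<in>D - {c}. ?x d)))
        = (\<Sum>c\<in>D. const_poly (w c) * b c * (\<Prod>d\<in>D. ?x d))"
      by (intro sum.cong refl arg_cong2[where f = times] prod.remove[symmetric] \<open>finite D\<close>)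
    also have "\<dots> = 0"
      using sum0 by (simp add: sum_distrib_right[symmetric])
    also have "(\<Sum>c\<in>D. (P ^ N - b c * ?x c) * (const_poly (w c) * (\<Prod>d\<in>D - {c}. ?x d))) + 0 \<in> I"
      unfolding add_0_right
      by (rule module.subspace_sum[OF module_mult])
         (use I rel in \<open>auto simp: is_ideal_iff_subspace[symmetric] D_def intro!: is_idealD(4)[OF I]\<close>)
    finally show ?thesis .
  qed
  then have "R \<in> I"
    using prime avoid by blast
  define r where "r = (\<Sum>c\<in>D. smult (w c) (\<Prod>d\<in>D - {c}. [:- d, 1:]))"
  have "poly_in_var v r = R"
    by (simp add: r_def R_def poly_in_var_sum poly_in_var_prod poly_in_var_smult poly_in_var_linear)
  \<comment> \<open>As in Lagrange interpolation, every summand but the one of \<open>c0\<close>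
    vanishes at \<open>c0\<close>.\<close>
  have "poly r c0 = w c0 * (\<Prod>d\<in>D - {c0}. c0 - d)"
  proof -
    have "poly r c0 = (\<Sum>c\<in>D. w c * (\<Prod>d\<in>D - {c}. c0 - d))"
      by (simp add: r_def poly_sum poly_prod)
    also have "\<dots> = (\<Sum>c\<in>{c0}. w c * (\<Prod>d\<in>D - {c}. c0 - d))"
      by (rule sum.mono_neutral_right) (use \<open>finite D\<close> c0 in auto)
    finally show ?thesis by simp
  qed
  then have "r \<noteq> 0"
    using c0 \<open>finite D\<close> by auto
  \<comment> \<open>Over the complex numbers \<open>p\<close> splits into linear factors. None of
    them lies in \<open>I\<close>, and neither does a nonzero constant, so primality excludes the
    product.\<close>
  have "poly_in_var v p \<notin> I" if "p \<noteq> 0" for p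
    using that
  proof (induction "degree p" arbitrary: p)
    case 0
    then obtain a where p: "p = [:a:]" "a \<noteq> 0"
      by (metis degree_eq_zeroE pCons_0_0)
    show ?case
    proof
      assume "poly_in_var v p \<in> I"
      then have "const_poly a * const_poly (1 / a) \<in> I"
        unfolding p poly_in_var_const by (rule is_idealD(4)[OF I])
      then show False
        using p(2) avoid[of 0] by (simp add: const_poly_simps(5)[symmetric] const_poly_simps(2))
    qed
  next
    case (Suc k)
    then have "\<not> constant (poly p)"
      by (metis constant_degree nat.distinct(1))
    then obtain c where "poly p c = 0"
      using fundamental_theorem_of_algebra by blast
    then obtain q where q: "p = [:- c, 1:] * q"
      by (metis dvdE poly_eq_0_iff_dvd)
    with Suc.prems have "q \<noteq> 0" by auto
    moreover have "k = degree q"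
      using Suc.hyps(2) \<open>q \<noteq> 0\<close> unfolding q by (subst (asm) degree_mult_eq) auto
    ultimately have "poly_in_var v q \<notin> I"
      using Suc.hyps(1) by blast
    then show ?case
      using prime nonmem unfolding q poly_in_var_mult poly_in_var_linear by blast
  qed
  then show False
    using \<open>r \<noteq> 0\<close> \<open>poly_in_var v r = R\<close> \<open>R \<in> I\<close> by blast
qed

text \<open>Congruence modulo an ideal respects sums and products, so it passes from the
  indeterminates to all polynomials.\<close>

lemma var_poly_congruent_imp_eval:
  fixes I :: "'n::finite cpoly set"
  assumes I: "is_ideal I" and A: "\<And>i j. var_poly (i, j) - const_poly (A $ i $ j) \<in> I"
  shows "Q - const_poly (eval_poly Q A) \<in> I"
proof -
  define cong where "cong p q \<longleftrightarrow> p - q \<in> I" for p q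
  have refl: "cong p p" for p
    using is_idealD(1)[OF I] by (simp add: cong_def)
  have add: "cong (p + q) (p' + q')" if "cong p p'" "cong q q'" for p q p' q'
    using is_idealD(2)[OF I that[unfolded cong_def]] by (simp add: cong_def algebra_simps)
  have mult: "cong (p * q) (p' * q')" if "cong p p'" "cong q q'" for p q p' q'
  proof -
    have "(p - p') * q + p' * (q - q') \<in> I"
      using is_idealD(2)[OF I is_idealD(4)[OF I that(1)[unfolded cong_def]]
          is_idealD(3)[OF I that(2)[unfolded cong_def]]] .
    then show ?thesis by (simp add: cong_def algebra_simps)
  qed
  have power: "cong (p ^ k) (p' ^ k)" if "cong p p'" for p p' k
    by (induction k) (use that in \<open>auto intro: refl mult\<close>)
  have prod: "cong (\<Prod>x\<in>X. f x) (\<Prod>x\<in>X. g x)" if "\<And>x. x \<in> X \<Longrightarrow> cong (f x) (g x)" for X :: "'b set" and f g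
    using that by (induction X rule: infinite_finite_induct) (auto intro: refl mult)
  have sum: "cong (\<Sum>x\<in>X. f x) (\<Sum>x\<in>X. g x)" if "\<And>x. x \<in> X \<Longrightarrow> cong (f x) (g x)" for X :: "'b set" and f g
    using that by (induction X rule: infinite_finite_induct) (auto intro: refl add)
  have const_sum: "const_poly (\<Sum>x\<in>X. f x) = (\<Sum>x\<in>X. const_poly (f x) :: 'n cpoly)" for X :: "'b set" and f
    by (induction X rule: infinite_finite_induct) (auto simp: const_poly_simps)
  have const_power: "const_poly (x ^ k) = (const_poly x ^ k :: 'n cpoly)" for x k
    by (induction k) (auto simp: const_poly_simps)
  have const_prod: "const_poly (\<Prod>x\<in>X. f x) = (\<Prod>x\<in>X. const_poly (f x) :: 'n cpoly)" for X :: "'b set" and f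
    by (induction X rule: infinite_finite_induct) (auto simp: const_poly_simps)
  have "Q = (\<Sum>m\<in>Poly_Mapping.keys Q. const_poly (Poly_Mapping.lookup Q m) *
      (\<Prod>v\<in>Poly_Mapping.keys m. var_poly v ^ Poly_Mapping.lookup m v))"
    using poly_mapping_sum_singles[of Q]
    by (simp add: single_eq_const_mult[symmetric] single_eq_prod_vars[symmetric])
  moreover have "cong \<dots> (const_poly (eval_poly Q A))"
    unfolding eval_poly_monoms monom_eval_def const_sum const_prod const_power const_poly_simps
    by (intro sum mult refl prod power) (auto simp: cong_def A)
  ultimately show ?thesis by (simp add: cong_def)
qed

text \<open>Modulo an ideal maximal among those avoiding the powers of \<open>P\<close>, every
  indeterminate is congruent to a constant. These constants are a common zero of \<open>J\<close>;
  if \<open>P\<close> vanished there, \<open>P\<close> itself would lie in the ideal.\<close>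

theorem nullstellensatz:
  fixes J :: "'n::finite cpoly set"
  assumes "is_ideal J" "\<And>A. (\<forall>Q\<in>J. eval_poly Q A = 0) \<Longrightarrow> eval_poly P A = 0"
  shows "P \<in> ideal_radical J"
proof (rule ccontr)
  assume "P \<notin> ideal_radical J"
  then obtain I where I: "is_ideal I" "J \<subseteq> I" "\<And>n. P ^ n \<notin> I"
    "\<And>K. is_ideal K \<Longrightarrow> I \<subseteq> K \<Longrightarrow> K \<noteq> I \<Longrightarrow> \<exists>n. P ^ n \<in> K"
    using exists_maximal_avoiding_ideal[OF assms(1)] by metis
  obtain c where c: "\<And>v. var_poly v - const_poly (c v) \<in> I"
    using maximal_avoiding_var[OF I(1,3,4)] by metis
  define A :: "complex^'n^3" where "A = (\<chi> i j. c (i, j))"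
  have cong: "Q - const_poly (eval_poly Q A) \<in> I" for Q
    by (rule var_poly_congruent_imp_eval[OF I(1)]) (simp add: A_def c)
  have "eval_poly Q A = 0" if "Q \<in> I" for Q
  proof (rule ccontr)
    assume *: "eval_poly Q A \<noteq> 0"
    have "Q - (Q - const_poly (eval_poly Q A)) \<in> I"
      using is_idealD(5)[OF I(1) that cong] .
    then have "const_poly (eval_poly Q A) * const_poly (1 / eval_poly Q A) \<in> I"
      using is_idealD(4)[OF I(1)] by simp
    then show False
      using * I(3)[of 0] by (simp add: const_poly_simps(5)[symmetric] const_poly_simps(2))
  qed
  then have "eval_poly P A = 0"
    using assms(2) I(2) by blast
  then show False
    using cong[of P] I(3)[of 1] by (simp add: const_poly_simps)
qed

section \<open>Points and lines as vectors and covectors\<close>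

text \<open>Bilinear and not Hermitian: this is the pairing of a covector with a vector, polynomial
  in both.\<close>

definition dot :: "complex^3 \<Rightarrow> complex^3 \<Rightarrow> complex" where
  "dot a b = a $ 1 * b $ 1 + a $ 2 * b $ 2 + a $ 3 * b $ 3"

text \<open>The cross product serves as the join of two points and, dually, as the meet of two
  lines. It vanishes exactly on parallel vectors, and \<open>dot (crs a b) c\<close> is the bracket
  of \<open>a\<close>, \<open>b\<close>, \<open>c\<close>.\<close>

definition crs :: "complex^3 \<Rightarrow> complex^3 \<Rightarrow> complex^3" where
  "crs a b = vector [a $ 2 * b $ 3 - a $ 3 * b $ 2, a $ 3 * b $ 1 - a $ 1 * b $ 3, a $ 1 * b $ 2 - a $ 2 * b $ 1]"

lemma vec3_eq_iff: "(a :: 'a^3) = b \<longleftrightarrow> a $ 1 = b $ 1 \<and> a $ 2 = b $ 2 \<and> a $ 3 = b $ 3"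
  by (simp add: vec_eq_iff forall_3)

lemma crs_nth [simp]:
  "crs a b $ 1 = a $ 2 * b $ 3 - a $ 3 * b $ 2"
  "crs a b $ 2 = a $ 3 * b $ 1 - a $ 1 * b $ 3"
  "crs a b $ 3 = a $ 1 * b $ 2 - a $ 2 * b $ 1"
  by (simp_all add: crs_def)

lemma dot_commute: "dot a b = dot b a"
  by (simp add: dot_def)

lemma dot_linear [simp]:
  "dot a (b + c) = dot a b + dot a c" "dot (a + b) c = dot a c + dot b c"
  "dot a (b - c) = dot a b - dot a c" "dot (a - b) c = dot a c - dot b c"
  "dot a (k *s b) = k * dot a b" "dot (k *s a) b = k * dot a b" "dot a 0 = 0" "dot 0 a = 0"
  by (simp_all add: dot_def algebra_simps)

lemma crs_linear:
  "crs a (b + c) = crs a b + crs a c" "crs (a + b) c = crs a c + crs b c"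
  "crs a (k *s b) = k *s crs a b" "crs (k *s a) b = k *s crs a b"
  by (simp_all add: vec3_eq_iff algebra_simps)

lemma crs_self [simp]: "crs a a = 0" and crs_zero [simp]: "crs a 0 = 0" "crs 0 a = 0"
  by (simp_all add: vec3_eq_iff)

lemma crs_swap: "crs a b = - crs b a"
  by (simp add: vec3_eq_iff)

lemma crs_swap_eq_0: "crs a b = 0 \<longleftrightarrow> crs b a = 0"
  by (subst crs_swap) simp

lemma dot_crs [simp]: "dot (crs a b) a = 0" "dot (crs a b) b = 0" "dot a (crs a b) = 0" "dot b (crs a b) = 0"
  by (simp_all add: dot_def algebra_simps)

lemma dot_crs_rotate: "dot (crs a b) c = dot (crs b c) a"
  by (simp add: dot_def algebra_simps)

lemma exists_dot_eq_1:
  assumes "v \<noteq> 0"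
  obtains e where "dot v e = 1"
proof -
  obtain i where i: "v $ i \<noteq> 0"
    using assms by (auto simp: vec_eq_iff)
  have "dot v (axis i (1 / v $ i)) = 1"
    using i exhaust_3[of i] by (auto simp: dot_def axis_def)
  then show ?thesis by (rule that)
qed

lemma crs_eq_0_iff:
  assumes "b \<noteq> 0"
  shows "crs a b = 0 \<longleftrightarrow> (\<exists>k. a = k *s b)"
proof
  assume "crs a b = 0"
  then have *: "a $ 2 * b $ 3 = a $ 3 * b $ 2" "a $ 3 * b $ 1 = a $ 1 * b $ 3" "a $ 1 * b $ 2 = a $ 2 * b $ 1"
    by (auto simp: vec3_eq_iff)
  \<comment> \<open>A functional with value 1 on \<open>b\<close> reads off the factor, which must
    be \<open>dot a e\<close>.\<close>
  obtain e where e: "dot b e = 1"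
    using exists_dot_eq_1[OF assms] .
  have "a $ 1 = dot a e * b $ 1" "a $ 2 = dot a e * b $ 2" "a $ 3 = dot a e * b $ 3"
    using e * unfolding dot_def by algebra+
  then show "\<exists>k. a = k *s b"
    by (intro exI[of _ "dot a e"]) (simp add: vec3_eq_iff)
qed (auto simp: crs_linear)

text \<open>Cramer's rule in the basis \<open>b\<close>, \<open>c\<close>, \<open>e\<close>: the
  coefficients are brackets with \<open>e\<close>, and the coefficient of \<open>e\<close> is the
  bracket that vanishes.\<close>

lemma span_pair_if_dot_crs_eq_0:
  assumes "crs b c \<noteq> 0" "dot (crs b c) a = 0"
  obtains s t where "a = s *s b + t *s c"
proof -
  obtain e where e: "dot (crs b c) e = 1"
    using exists_dot_eq_1[OF assms(1)] .
  have "a = dot (crs a c) e *s b + dot (crs b a) e *s c"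
    using e assms(2) unfolding vec3_eq_iff dot_def crs_nth vector_add_component vector_smult_component
    by (intro conjI; algebra)
  then show ?thesis by (rule that)
qed

lemma orthogonal_parallel_crs:
  assumes "crs a b \<noteq> 0" "dot a w = 0" "dot b w = 0"
  obtains k where "w = k *s crs a b"
proof -
  obtain e where e: "dot (crs a b) e = 1"
    using exists_dot_eq_1[OF assms(1)] .
  have "w = dot w e *s crs a b"
    using e assms(2,3) unfolding vec3_eq_iff dot_def crs_nth vector_smult_component
    by (intro conjI; algebra)
  then show ?thesis by (rule that)
qed

lemma parallel_if_both_orthogonal:
  assumes "crs a b \<noteq> 0" "dot a w = 0" "dot b w = 0" "dot a w' = 0" "dot b w' = 0"
  shows "crs w w' = 0"
proof -
  obtain k k' where "w = k *s crs a b" "w' = k' *s crs a b"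
    using orthogonal_parallel_crs assms by metis
  then show ?thesis by (simp add: crs_linear)
qed

lemma exists_not_parallel:
  assumes "a \<noteq> 0"
  obtains c where "crs a c \<noteq> 0"
proof -
  have "crs a (axis 1 1) \<noteq> 0 \<or> crs a (axis 2 1) \<noteq> 0"
    using assms by (auto simp: vec3_eq_iff axis_def)
  then show ?thesis using that by blast
qed

text \<open>Two linear conditions in three-dimensional space always leave a nonzero
  solution.\<close>

lemma exists_orthogonal_nonzero:
  obtains h where "h \<noteq> 0" "dot h a = 0" "dot h b = 0"
proof (cases "crs a b = 0")
  case False
  then show ?thesis by (intro that[of "crs a b"]) auto
next
  case True
  obtain c s t where ab: "a = s *s c" "b = t *s c"
  proof (cases "a = 0")
    case True
    then show ?thesis using that[of 0 b 1] by simp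
  next
    case False
    then obtain k where "b = k *s a"
      using \<open>crs a b = 0\<close> crs_eq_0_iff crs_swap_eq_0 by blast
    then show ?thesis using that[of 1 a k] by simp
  qed
  show ?thesis
  proof (cases "c = 0")
    case True
    have "axis 1 1 \<noteq> (0 :: complex^3)"
      by (simp add: vec_eq_iff axis_def)
    then show ?thesis using that[of "axis 1 1"] ab True by simp
  next
    case False
    then obtain d where "crs c d \<noteq> 0"
      using exists_not_parallel by blast
    then show ?thesis using that[of "crs c d"] ab by simp
  qed
qed

text \<open>The space orthogonal to \<open>a\<close> has dimension at least two, so it is not
  contained in the multiples of \<open>v\<close>.\<close>

lemma exists_orthogonal_not_parallel:
  assumes "v \<noteq> 0"
  obtains k where "dot k a = 0" "crs k v \<noteq> 0"
proof (cases "a = 0")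
  case True
  obtain c where "crs v c \<noteq> 0"
    using exists_not_parallel[OF assms] .
  then show ?thesis using True that[of c] crs_swap_eq_0[of v c] by simp
next
  case False
  show ?thesis
  proof (cases "\<exists>w. crs (crs a w) v \<noteq> 0")
    case True
    then obtain w where "crs (crs a w) v \<noteq> 0" by blast
    then show ?thesis using that[of "crs a w"] by simp
  next
    case no: False
    \<comment> \<open>The expansion of the triple product; if it vanished for every
      \<open>w\<close>, then \<open>a\<close> would be zero.\<close>
    have "crs (crs a w) v = dot a v *s w - dot w v *s a" for w
      by (simp add: vec3_eq_iff dot_def algebra_simps)
    then have eq: "dot a v *s w = dot w v *s a" for w
      using no by simp
    obtain u where u: "crs a u \<noteq> 0"
      using exists_not_parallel[OF False] .
    have "dot a v *s crs a u = crs a (dot a v *s u)"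
      by (simp add: crs_linear)
    also have "\<dots> = 0" unfolding eq by (simp add: crs_linear)
    finally have "dot a v = 0" using u by simp
    moreover obtain e where "dot v e = 1"
      using exists_dot_eq_1[OF assms] .
    ultimately have "a = 0" using eq[of e] dot_commute[of e v] by simp
    then show ?thesis using False by simp
  qed
qed

text \<open>Vectors of rank at most two lie in a plane. In rank at most one that plane is a choice,
  so covectors of lines are genuine extra data.\<close>

lemma exists_common_covector:
  assumes "\<And>a b c. a \<in> S \<Longrightarrow> b \<in> S \<Longrightarrow> c \<in> S \<Longrightarrow> dot (crs a b) c = 0"
  obtains h where "h \<noteq> 0" "\<And>a. a \<in> S \<Longrightarrow> dot h a = 0"
proof (cases "\<exists>a\<in>S. \<exists>b\<in>S. crs a b \<noteq> 0")
  case True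
  then obtain a b where "a \<in> S" "b \<in> S" "crs a b \<noteq> 0" by blast
  then show ?thesis using assms by (intro that[of "crs a b"]) auto
next
  case False
  obtain a where a: "a \<in> S \<and> a \<noteq> 0 \<or> S \<subseteq> {0} \<and> a = 0" by blast
  obtain h where h: "h \<noteq> 0" "dot h a = 0"
    using exists_orthogonal_nonzero[of a a] by blast
  have "dot h b = 0" if "b \<in> S" for b
  proof (cases "a = 0")
    case False
    then have "\<exists>k. b = k *s a"
      using a that \<open>\<not> (\<exists>a\<in>S. \<exists>b\<in>S. crs a b \<noteq> 0)\<close> crs_eq_0_iff[of a b] by blast
    then show ?thesis using h by auto
  qed (use a that in auto)
  then show ?thesis using h that by blast
qed

lemma dot_crs_eq_0_if_common_covector:
  assumes "h \<noteq> 0" "dot h a = 0" "dot h b = 0" "dot h c = 0"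
  shows "dot (crs a b) c = 0"
proof (cases "crs a b = 0")
  case False
  then obtain k where "h = k *s crs a b"
    using orthogonal_parallel_crs[of a b h] assms by (auto simp: dot_commute)
  then show ?thesis
    using assms by auto
qed auto

section \<open>Limits and small displacements\<close>

lemma continuous_crs [continuous_intros]:
  assumes "(f \<longlongrightarrow> a) F" "(g \<longlongrightarrow> b) F"
  shows "((\<lambda>x. crs (f x) (g x)) \<longlongrightarrow> crs a b) F"
  unfolding crs_def
  by (rule vec_tendstoI) (use exhaust_3 in \<open>auto intro!: tendsto_intros assms simp: vector_def\<close>)

lemma tendsto_dot [tendsto_intros]:
  assumes "(f \<longlongrightarrow> a) F" "(g \<longlongrightarrow> b) F"
  shows "((\<lambda>x. dot (f x) (g x)) \<longlongrightarrow> dot a b) F"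
  unfolding dot_def by (intro tendsto_intros assms)

lemma tendsto_vector_smult [tendsto_intros]:
  fixes f :: "'a \<Rightarrow> complex" and g :: "'a \<Rightarrow> complex^'n"
  assumes "(f \<longlongrightarrow> a) F" "(g \<longlongrightarrow> b) F"
  shows "((\<lambda>x. f x *s g x) \<longlongrightarrow> a *s b) F"
  by (rule vec_tendstoI) (auto intro!: tendsto_intros assms)

text \<open>Genericity within the affine space \<open>w + D\<close>. Forms are treated one at a
  time: a nonzero step along a direction of \<open>D\<close> not killed by \<open>h\<close> settles
  the new form, and a sufficiently small one preserves the inequalities already won.\<close>

lemma exists_small_avoiding:
  assumes "finite H" "\<And>h. h \<in> H \<Longrightarrow> \<exists>d\<in>D. dot h d \<noteq> 0"
    and D: "0 \<in> D" "\<And>a b. a \<in> D \<Longrightarrow> b \<in> D \<Longrightarrow> a + b \<in> D" "\<And>k a. a \<in> D \<Longrightarrow> k *s a \<in> D"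
  shows "\<epsilon> > 0 \<Longrightarrow> \<exists>d\<in>D. norm d < \<epsilon> \<and> (\<forall>h\<in>H. dot h (w + d) \<noteq> 0)"
  using assms(1,2)
proof (induction arbitrary: \<epsilon> rule: finite_induct)
  case empty
  then show ?case using D(1) by (intro bexI[of _ 0]) auto
next
  case (insert h H)
  obtain d where d: "d \<in> D" "norm d < \<epsilon> / 2" "\<forall>h\<in>H. dot h (w + d) \<noteq> 0"
    using insert.IH[of "\<epsilon> / 2"] insert.prems by auto
  obtain e where e: "e \<in> D" "dot h e \<noteq> 0"
    using insert.prems by blast
  let ?f = "\<lambda>g (t :: complex). dot g (w + d + t *s e)"
  have lim: "(?f g \<longlongrightarrow> ?f g 0) (at 0)" for g
    by (intro tendsto_intros)
  have "\<forall>\<^sub>F t in at 0. \<forall>g\<in>H. ?f g t \<noteq> 0"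
    using insert.hyps(1) d(3) lim[THEN tendsto_imp_eventually_ne]
    by (intro eventually_ball_finite) auto
  moreover have "\<forall>\<^sub>F t in at 0. ?f h t \<noteq> 0"
  proof (cases "dot h (w + d) = 0")
    case True
    then show ?thesis
      using e(2) eventually_at_topological by (auto simp: eventually_at_filter)
  qed (use lim[THEN tendsto_imp_eventually_ne, of h 0] in auto)
  moreover have "((\<lambda>t :: complex. norm (t *s e)) \<longlongrightarrow> norm (0 *s e)) (at 0)"
    by (intro tendsto_intros)
  then have "\<forall>\<^sub>F t :: complex in at 0. norm (t *s e) < \<epsilon> / 2"
    using insert.prems(1) by (intro order_tendstoD(2)[where a = "\<epsilon> / 2"]) auto
  ultimately have "\<forall>\<^sub>F t :: complex in at 0. (\<forall>g\<in>H. ?f g t \<noteq> 0) \<and> ?f h t \<noteq> 0 \<and> norm (t *s e) < \<epsilon> / 2"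
    by eventually_elim auto
  then obtain t where t: "\<forall>g\<in>H. ?f g t \<noteq> 0" "?f h t \<noteq> 0" "norm (t *s e) < \<epsilon> / 2"
    using eventually_happens[of _ "at (0 :: complex)"] by auto
  show ?case
  proof (intro bexI conjI)
    show "d + t *s e \<in> D"
      using d e D by blast
    show "norm (d + t *s e) < \<epsilon>"
      using norm_triangle_ineq[of d "t *s e"] d(2) t(3) by linarith
  qed (use t in \<open>auto simp: add.assoc\<close>)
qed

section \<open>Perturbing points and lines into general position\<close>

lemma exists_small_multiple:
  fixes w :: "complex^3"
  assumes "\<epsilon> > 0"
  obtains t where "t \<noteq> 0" "norm (t *s w) < \<epsilon>"
proof -
  have "((\<lambda>t :: complex. norm (t *s w)) \<longlongrightarrow> norm (0 *s w)) (at 0)"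
    by (intro tendsto_intros)
  then have "\<forall>\<^sub>F t :: complex in at 0. norm (t *s w) < \<epsilon>"
    using assms by (intro order_tendstoD(2)[where a = \<epsilon>]) auto
  then have "\<forall>\<^sub>F t :: complex in at 0. norm (t *s w) < \<epsilon> \<and> t \<noteq> 0"
    by (auto simp: eventually_at_filter)
  then show ?thesis
    using eventually_happens[of _ "at (0 :: complex)"] that by auto
qed

text \<open>Here \<open>w\<close> is a new point with at most one line through it, or dually a new
  line with at most one point on it. The bound on the neighbour is fixed before its new position and
  the forms to avoid are known, since these come out of the induction hypothesis applied with that
  bound.\<close>

lemma perturb_leaf:
  assumes N: "\<And>a b. a \<in> N \<Longrightarrow> b \<in> N \<Longrightarrow> a = b"
    and u: "\<And>a. a \<in> N \<Longrightarrow> u a \<noteq> 0" "\<And>a. a \<in> N \<Longrightarrow> dot (u a) w = 0" and "\<epsilon> > 0"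
  obtains \<delta> where "\<delta> > 0"
    "\<And>u' H. (\<And>a. a \<in> N \<Longrightarrow> norm (u' a - u a) < \<delta>) \<Longrightarrow> finite H \<Longrightarrow>
       (\<And>h. h \<in> H \<Longrightarrow> h \<noteq> 0) \<Longrightarrow> (\<And>h a. h \<in> H \<Longrightarrow> a \<in> N \<Longrightarrow> crs h (u' a) \<noteq> 0) \<Longrightarrow>
       \<exists>w'. norm (w' - w) < \<epsilon> \<and> (\<forall>a\<in>N. dot (u' a) w' = 0) \<and> (\<forall>h\<in>H. dot h w' \<noteq> 0)"
proof (cases "N = {}")
  case True
  show ?thesis
  proof (rule that[of 1])
    fix u' :: "'a \<Rightarrow> complex^3" and H :: "(complex^3) set"
    assume H: "finite H" "\<And>h. h \<in> H \<Longrightarrow> h \<noteq> 0"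
    have "\<exists>d\<in>UNIV. norm d < \<epsilon> \<and> (\<forall>h\<in>H. dot h (w + d) \<noteq> 0)"
      by (rule exists_small_avoiding[OF H(1) _ _ _ _ \<open>\<epsilon> > 0\<close>])
         (use H(2) exists_dot_eq_1 in \<open>auto, metis zero_neq_one\<close>)
    then obtain d where "norm d < \<epsilon>" "\<forall>h\<in>H. dot h (w + d) \<noteq> 0" by blast
    then show "\<exists>w'. norm (w' - w) < \<epsilon> \<and> (\<forall>a\<in>N. dot (u' a) w' = 0) \<and> (\<forall>h\<in>H. dot h w' \<noteq> 0)"
      using True by (intro exI[of _ "w + d"]) auto
  qed simp
next
  case False
  then obtain a where a: "N = {a}"
    using N by blast
  define v where "v = u a"
  have v: "v \<noteq> 0" "dot v w = 0"
    using u a by (auto simp: v_def)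
  obtain e where e: "dot v e = 1"
    using exists_dot_eq_1[OF v(1)] .
  \<comment> \<open>The correction of \<open>w\<close> along the fixed direction \<open>e\<close>
    that restores orthogonality to the moved neighbour; it is continuous and trivial at
    \<open>v\<close>.\<close>
  let ?t = "\<lambda>v'. w - (dot v' w / dot v' e) *s e"
  have "((\<lambda>v'. ?t v') \<longlongrightarrow> ?t v) (nhds v)"
    by (intro tendsto_intros filterlim_ident) (auto simp: e)
  then have "\<forall>\<^sub>F v' in nhds v. dist (?t v') (?t v) < \<epsilon> / 2"
    by (rule tendstoD) (use \<open>\<epsilon> > 0\<close> in auto)
  moreover have "((\<lambda>v'. dot v' e) \<longlongrightarrow> dot v e) (nhds v)"
    by (intro tendsto_intros filterlim_ident)
  then have "\<forall>\<^sub>F v' in nhds v. dot v' e \<noteq> 0"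
    by (rule tendsto_imp_eventually_ne) (simp add: e)
  ultimately have "\<forall>\<^sub>F v' in nhds v. norm (?t v' - w) < \<epsilon> / 2 \<and> dot v' e \<noteq> 0"
    by eventually_elim (use v(2) in \<open>auto simp: dist_norm\<close>)
  then obtain \<delta> where \<delta>: "\<delta> > 0"
    "\<And>v'. norm (v' - v) < \<delta> \<Longrightarrow> norm (?t v' - w) < \<epsilon> / 2 \<and> dot v' e \<noteq> 0"
    unfolding eventually_nhds_metric dist_norm by blast
  show ?thesis
  proof (rule that[OF \<delta>(1)])
    fix u' :: "'a \<Rightarrow> complex^3" and H :: "(complex^3) set"
    assume near: "\<And>a. a \<in> N \<Longrightarrow> norm (u' a - u a) < \<delta>"
      and H: "finite H" "\<And>h a. h \<in> H \<Longrightarrow> a \<in> N \<Longrightarrow> crs h (u' a) \<noteq> 0"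
    define v' where "v' = u' a"
    have t: "norm (?t v' - w) < \<epsilon> / 2" "dot v' e \<noteq> 0"
      using \<delta>(2)[of v'] near[of a] a by (auto simp: v_def v'_def)
    have "\<exists>d\<in>{d. dot v' d = 0}. norm d < \<epsilon> / 2 \<and> (\<forall>h\<in>H. dot h (?t v' + d) \<noteq> 0)"
    proof (rule exists_small_avoiding[OF H(1)])
      fix h assume "h \<in> H"
      then have "crs h v' \<noteq> 0"
        using H(2) a by (auto simp: v'_def)
      then obtain e' where "dot (crs h v') e' = 1"
        using exists_dot_eq_1 by blast
      \<comment> \<open>So \<open>crs v' e'\<close> is an allowed direction, orthogonal to
        \<open>v'\<close>, on which \<open>h\<close> does not vanish.\<close>
      moreover have "dot (crs h v') e' = dot h (crs v' e')"
        by (simp add: dot_def algebra_simps)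
      ultimately show "\<exists>d\<in>{d. dot v' d = 0}. dot h d \<noteq> 0"
        by (intro bexI[of _ "crs v' e'"]) auto
    qed (use \<open>\<epsilon> > 0\<close> in auto)
    then obtain d where d: "dot v' d = 0" "norm d < \<epsilon> / 2" "\<forall>h\<in>H. dot h (?t v' + d) \<noteq> 0"
      by blast
    have "norm (?t v' + d - w) < \<epsilon>"
      using norm_triangle_ineq[of "?t v' - w" d] t(1) d(2) by (simp add: algebra_simps)
    moreover have "dot v' (?t v' + d) = 0"
      using d(1) t(2) by simp
    ultimately show "\<exists>w'. norm (w' - w) < \<epsilon> \<and> (\<forall>a\<in>N. dot (u' a) w' = 0) \<and> (\<forall>h\<in>H. dot h w' \<noteq> 0)"
      using d(3) a by (intro exI[of _ "?t v' + d"]) (auto simp: v'_def)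
  qed
qed

text \<open>The line \<open>A\<close> is to be tilted off \<open>b\<close>. If \<open>c\<close> and
  \<open>b\<close> are different points, \<open>A\<close> turns about \<open>c\<close>. If they
  coincide and \<open>A\<close>, \<open>B\<close> are different lines, \<open>A\<close> is tilted
  freely and \<open>c\<close> follows as their meet. If both pairs coincide, \<open>c\<close> first
  slides along the common line away from \<open>b\<close>.\<close>

lemma perturb_path_middle:
  assumes nz: "A \<noteq> 0" "B \<noteq> 0" "b \<noteq> 0" "c \<noteq> 0"
    and inc: "dot B c = 0" "dot A c = 0" "dot A b = 0" and "\<epsilon> > 0"
  obtains c' A' where "norm (c' - c) < \<epsilon>" "norm (A' - A) < \<epsilon>"
    "dot B c' = 0" "dot A' c' = 0" "dot A' b \<noteq> 0"
proof (cases "crs c b = 0 \<and> crs A B \<noteq> 0")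
  case True
  then obtain \<mu> where \<mu>: "c = \<mu> *s crs A B"
    using orthogonal_parallel_crs[of A B c] inc by blast
  obtain k where k: "dot b k = 1"
    using exists_dot_eq_1[OF nz(3)] .
  have "((\<lambda>t. \<mu> *s crs (A + t *s k) B) \<longlongrightarrow> \<mu> *s crs (A + 0 *s k) B) (at 0)"
    by (intro tendsto_intros continuous_crs)
  then have "\<forall>\<^sub>F t in at 0. dist (\<mu> *s crs (A + t *s k) B) (\<mu> *s crs (A + 0 *s k) B) < \<epsilon>"
    using \<open>\<epsilon> > 0\<close> by (rule tendstoD)
  moreover have "((\<lambda>t. A + t *s k) \<longlongrightarrow> A + 0 *s k) (at 0)"
    by (intro tendsto_intros)
  then have "\<forall>\<^sub>F t in at 0. dist (A + t *s k) (A + 0 *s k) < \<epsilon>"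
    using \<open>\<epsilon> > 0\<close> by (rule tendstoD)
  moreover have "\<forall>\<^sub>F t :: complex in at 0. t \<noteq> 0"
    by (simp add: eventually_at_filter)
  ultimately have "\<forall>\<^sub>F t in at 0. norm (\<mu> *s crs (A + t *s k) B - c) < \<epsilon> \<and>
      norm (A + t *s k - A) < \<epsilon> \<and> t \<noteq> 0"
    by eventually_elim (use \<mu> in \<open>auto simp: dist_norm\<close>)
  then obtain t where t: "norm (\<mu> *s crs (A + t *s k) B - c) < \<epsilon>" "norm (A + t *s k - A) < \<epsilon>" "t \<noteq> 0"
    using eventually_happens[of _ "at (0 :: complex)"] by auto
  have "dot (A + t *s k) (\<mu> *s crs (A + t *s k) B) = 0"
    by (simp only: dot_linear(5) dot_crs mult_zero_right)
  moreover have "dot (A + t *s k) b \<noteq> 0"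
    using inc(3) k t(3) by (simp add: dot_commute[of k])
  moreover have "dot B (\<mu> *s crs (A + t *s k) B) = 0"
    by (simp only: dot_linear(5) dot_crs mult_zero_right)
  ultimately show ?thesis
    using t that by blast
next
  case False
  obtain c' where c': "norm (c' - c) < \<epsilon>" "dot B c' = 0" "dot A c' = 0" "crs c' b \<noteq> 0"
  proof (cases "crs c b = 0")
    case True
    obtain w where w: "dot w A = 0" "crs w b \<noteq> 0"
      using exists_orthogonal_not_parallel[OF nz(3)] by blast
    have "crs B A = 0"
      using False True by (simp add: crs_swap_eq_0)
    then obtain k where "B = k *s A"
      using crs_eq_0_iff[OF nz(1)] by blast
    then have "dot B w = 0" "dot A w = 0"
      using w(1) by (auto simp: dot_commute)
    obtain t where t: "t \<noteq> 0" "norm (t *s w) < \<epsilon>"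
      using exists_small_multiple[OF \<open>\<epsilon> > 0\<close>] .
    have "crs (c + t *s w) b \<noteq> 0"
      using True w(2) t(1) by (simp add: crs_linear)
    then show ?thesis
      using t(2) inc \<open>dot B w = 0\<close> \<open>dot A w = 0\<close> by (intro that[of "c + t *s w"]) auto
  qed (use that[of c] inc \<open>\<epsilon> > 0\<close> in auto)
  obtain e where e: "dot (crs c' b) e = 1"
    using exists_dot_eq_1[OF c'(4)] .
  \<comment> \<open>Adding a multiple of \<open>k\<close> turns \<open>A\<close> about
    \<open>c'\<close> and moves it off \<open>b\<close>.\<close>
  define k where "k = crs e c'"
  have k: "dot k c' = 0" "dot k b = 1"
    using e by (simp_all add: k_def dot_def algebra_simps)
  obtain t where t: "t \<noteq> 0" "norm (t *s k) < \<epsilon>"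
    using exists_small_multiple[OF \<open>\<epsilon> > 0\<close>] .
  show ?thesis
    using c' t k inc by (intro that[of c' "A + t *s k"]) auto
qed

text \<open>
  The incidence path \<open>B, c, A, a, H, b\<close> is the part of a cycle that closes up at \<open>H\<close>. When \<open>a\<close> and
  \<open>b\<close> are parallel, \<open>H\<close> is not determined by them; moving the inner part of the path separates them.
\<close>

lemma perturb_path:
  assumes nz: "A \<noteq> 0" "B \<noteq> 0" "H \<noteq> 0" "a \<noteq> 0" "b \<noteq> 0" "c \<noteq> 0"
    and inc: "dot B c = 0" "dot A c = 0" "dot A a = 0" "dot H a = 0" "dot H b = 0" and "\<epsilon> > 0"
  obtains c' A' a' where "norm (c' - c) < \<epsilon>" "norm (A' - A) < \<epsilon>" "norm (a' - a) < \<epsilon>"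
    "dot B c' = 0" "dot A' c' = 0" "dot A' a' = 0" "dot H a' = 0" "crs a' b \<noteq> 0"
proof (cases "crs a b = 0")
  case False
  then show ?thesis
    using that[of c A a] inc \<open>\<epsilon> > 0\<close> by auto
next
  case ab: True
  show ?thesis
  \<comment> \<open>If \<open>A\<close> and \<open>H\<close> are the same line, \<open>a\<close>
    slides along it away from \<open>b\<close>. Otherwise \<open>a\<close> is their meet and follows
    when \<open>A\<close> is tilted off \<open>b\<close>; then it cannot be parallel to
    \<open>b\<close>, which is no longer on \<open>A\<close>.\<close>
  proof (cases "crs A H = 0")
    case True
    then obtain k where k: "A = k *s H"
      using crs_eq_0_iff[OF nz(3)] by blast
    obtain w where w: "dot w H = 0" "crs w b \<noteq> 0"
      using exists_orthogonal_not_parallel[OF nz(5)] by blast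
    have "dot H w = 0" "dot A w = 0"
      using w(1) k by (auto simp: dot_commute)
    obtain t where t: "t \<noteq> 0" "norm (t *s w) < \<epsilon>"
      using exists_small_multiple[OF \<open>\<epsilon> > 0\<close>] .
    have "crs (a + t *s w) b \<noteq> 0"
      using ab w(2) t(1) by (simp add: crs_linear)
    then show ?thesis
      using t(2) inc \<open>dot H w = 0\<close> \<open>dot A w = 0\<close> \<open>\<epsilon> > 0\<close> by (intro that[of c A "a + t *s w"]) auto
  next
    case False
    then obtain r where r: "a = r *s crs A H"
      using orthogonal_parallel_crs[of A H a] inc by blast
    have "r \<noteq> 0"
      using r nz(4) by auto
    obtain k where "b = k *s a"
      using ab nz(4) crs_eq_0_iff crs_swap_eq_0 by metis
    then have "dot A b = 0"
      using inc(3) by simp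
    have "((\<lambda>X. r *s crs X H) \<longlongrightarrow> r *s crs A H) (nhds A)"
      by (intro tendsto_intros continuous_crs filterlim_ident)
    then have "\<forall>\<^sub>F X in nhds A. dist (r *s crs X H) (r *s crs A H) < \<epsilon>"
      using \<open>\<epsilon> > 0\<close> by (rule tendstoD)
    then obtain \<delta> where \<delta>: "\<delta> > 0" "\<And>X. norm (X - A) < \<delta> \<Longrightarrow> norm (r *s crs X H - a) < \<epsilon>"
      unfolding eventually_nhds_metric dist_norm r[symmetric] by blast
    obtain c' A' where *: "norm (c' - c) < min \<epsilon> \<delta>" "norm (A' - A) < min \<epsilon> \<delta>"
      "dot B c' = 0" "dot A' c' = 0" "dot A' b \<noteq> 0"
      using perturb_path_middle[OF nz(1,2,5,6) inc(1,2) \<open>dot A b = 0\<close>, of "min \<epsilon> \<delta>"] \<delta>(1) \<open>\<epsilon> > 0\<close>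
      by auto
    define a' where "a' = r *s crs A' H"
    have "crs A' H \<noteq> 0"
    proof
      assume "crs A' H = 0"
      then obtain k where "A' = k *s H"
        using crs_eq_0_iff[OF nz(3)] by blast
      then show False
        using *(5) inc(5) by simp
    qed
    then have "a' \<noteq> 0"
      using \<open>r \<noteq> 0\<close> by (simp add: a'_def)
    have inc': "dot A' a' = 0" "dot H a' = 0"
      unfolding a'_def by (simp_all only: dot_linear(5) dot_crs mult_zero_right)
    have "crs a' b \<noteq> 0"
    proof
      assume "crs a' b = 0"
      then obtain k where "b = k *s a'"
        using \<open>a' \<noteq> 0\<close> crs_eq_0_iff crs_swap_eq_0 by metis
      then show False
        using *(5) inc'(1) by simp
    qed
    then show ?thesis
      using * inc' \<delta>(2)[of A'] by (intro that[of c' A' a']) (auto simp: a'_def)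
  qed
qed

text \<open>Every line has a nonzero covector, even where its points span no plane. A line of
  \<open>L\<close> may contain points outside \<open>P\<close>; its incidences with these are
  imposed only when they are added.\<close>

definition flagged :: "'a set \<Rightarrow> 'a set set \<Rightarrow> ('a \<Rightarrow> complex^3) \<Rightarrow> ('a set \<Rightarrow> complex^3) \<Rightarrow> bool" where
  "flagged P L y h \<longleftrightarrow> (\<forall>p\<in>P. y p \<noteq> 0) \<and> (\<forall>l\<in>L. h l \<noteq> 0) \<and>
     (\<forall>p\<in>P. \<forall>l\<in>L. p \<in> l \<longrightarrow> dot (h l) (y p) = 0)"

text \<open>The last clause is a condition of its own, since three points can be collinear without
  sharing a line of \<open>L\<close>.\<close>

definition in_general_position ::
    "'a set \<Rightarrow> 'a set set \<Rightarrow> ('a \<Rightarrow> complex^3) \<Rightarrow> ('a set \<Rightarrow> complex^3) \<Rightarrow> bool" where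
  "in_general_position P L y h \<longleftrightarrow> flagged P L y h \<and>
     (\<forall>p\<in>P. \<forall>l\<in>L. p \<notin> l \<longrightarrow> dot (h l) (y p) \<noteq> 0) \<and>
     (\<forall>p\<in>P. \<forall>q\<in>P. p \<noteq> q \<longrightarrow> crs (y p) (y q) \<noteq> 0) \<and>
     (\<forall>l\<in>L. \<forall>m\<in>L. l \<noteq> m \<longrightarrow> crs (h l) (h m) \<noteq> 0) \<and>
     (\<forall>p\<in>P. \<forall>q\<in>P. \<forall>r\<in>P. p \<noteq> q \<and> q \<noteq> r \<and> p \<noteq> r \<and> \<not> (\<exists>l\<in>L. {p, q, r} \<subseteq> l) \<longrightarrow>
        dot (crs (y p) (y q)) (y r) \<noteq> 0)"

lemma in_general_positionI:
  assumes "flagged P L y h"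
    and "\<And>p l. p \<in> P \<Longrightarrow> l \<in> L \<Longrightarrow> p \<notin> l \<Longrightarrow> dot (h l) (y p) \<noteq> 0"
    and "\<And>p q. p \<in> P \<Longrightarrow> q \<in> P \<Longrightarrow> p \<noteq> q \<Longrightarrow> crs (y p) (y q) \<noteq> 0"
    and "\<And>l m. l \<in> L \<Longrightarrow> m \<in> L \<Longrightarrow> l \<noteq> m \<Longrightarrow> crs (h l) (h m) \<noteq> 0"
    and "\<And>p q r. p \<in> P \<Longrightarrow> q \<in> P \<Longrightarrow> r \<in> P \<Longrightarrow> p \<noteq> q \<Longrightarrow> q \<noteq> r \<Longrightarrow> p \<noteq> r \<Longrightarrow>
       \<not> (\<exists>l\<in>L. {p, q, r} \<subseteq> l) \<Longrightarrow> dot (crs (y p) (y q)) (y r) \<noteq> 0"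
  shows "in_general_position P L y h"
  unfolding in_general_position_def
  by (intro conjI ballI impI; (elim conjE)?; (rule assms; assumption))

lemma in_general_positionD:
  assumes "in_general_position P L y h"
  shows "flagged P L y h"
    "p \<in> P \<Longrightarrow> l \<in> L \<Longrightarrow> p \<notin> l \<Longrightarrow> dot (h l) (y p) \<noteq> 0"
    "p \<in> P \<Longrightarrow> q \<in> P \<Longrightarrow> p \<noteq> q \<Longrightarrow> crs (y p) (y q) \<noteq> 0"
    "l \<in> L \<Longrightarrow> m \<in> L \<Longrightarrow> l \<noteq> m \<Longrightarrow> crs (h l) (h m) \<noteq> 0"
    "p \<in> P \<Longrightarrow> q \<in> P \<Longrightarrow> r \<in> P \<Longrightarrow> p \<noteq> q \<Longrightarrow> q \<noteq> r \<Longrightarrow> p \<noteq> r \<Longrightarrow>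
       \<not> (\<exists>l\<in>L. {p, q, r} \<subseteq> l) \<Longrightarrow> dot (crs (y p) (y q)) (y r) \<noteq> 0"
  using assms by (simp_all add: in_general_position_def)

lemma flaggedD:
  assumes "flagged P L y h"
  shows "p \<in> P \<Longrightarrow> y p \<noteq> 0" "l \<in> L \<Longrightarrow> h l \<noteq> 0"
    "p \<in> P \<Longrightarrow> l \<in> L \<Longrightarrow> p \<in> l \<Longrightarrow> dot (h l) (y p) = 0"
  using assms by (simp_all add: flagged_def)

definition approximable :: "'a set \<Rightarrow> 'a set set \<Rightarrow> bool" where
  "approximable P L \<longleftrightarrow> (\<forall>y h. flagged P L y h \<longrightarrow> (\<forall>\<epsilon>>0. \<exists>y' h'. in_general_position P L y' h' \<and>
     (\<forall>p\<in>P. norm (y' p - y p) < \<epsilon>) \<and> (\<forall>l\<in>L. norm (h' l - h l) < \<epsilon>)))"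

lemma approximableD:
  assumes "approximable P L" "flagged P L y h" "\<epsilon> > 0"
  obtains y' h' where "in_general_position P L y' h'" "\<And>p. p \<in> P \<Longrightarrow> norm (y' p - y p) < \<epsilon>"
    "\<And>l. l \<in> L \<Longrightarrow> norm (h' l - h l) < \<epsilon>"
  using assms unfolding approximable_def by blast

section \<open>Adding one point or one line\<close>

lemma in_general_position_insert_point:
  assumes gen: "in_general_position P L y h" and "p \<notin> P" and w: "w \<noteq> 0"
    "\<And>l. l \<in> L \<Longrightarrow> p \<in> l \<Longrightarrow> dot (h l) w = 0"
    "\<And>l. l \<in> L \<Longrightarrow> p \<notin> l \<Longrightarrow> dot (h l) w \<noteq> 0"
    "\<And>q. q \<in> P \<Longrightarrow> crs w (y q) \<noteq> 0"
    "\<And>q r. q \<in> P \<Longrightarrow> r \<in> P \<Longrightarrow> q \<noteq> r \<Longrightarrow> \<not> (\<exists>l\<in>L. {p, q, r} \<subseteq> l) \<Longrightarrow>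
       dot (crs (y q) (y r)) w \<noteq> 0"
  shows "in_general_position (insert p P) L (y(p := w)) h"
proof -
  let ?y = "y(p := w)"
  note g = in_general_positionD[OF gen]
  note f = flaggedD[OF g(1)]
  have y: "?y q = y q" if "q \<in> P" for q
    using that \<open>p \<notin> P\<close> by auto
  have 1: "flagged (insert p P) L ?y h"
    unfolding flagged_def using f w(1,2) y by (metis fun_upd_same insertE)
  have 2: "dot (h l) (?y q) \<noteq> 0" if "q \<in> insert p P" "l \<in> L" "q \<notin> l" for q l
    using that g(2) w(3) y by (metis fun_upd_same insertE)
  have 3: "crs (?y q) (?y r) \<noteq> 0" if "q \<in> insert p P" "r \<in> insert p P" "q \<noteq> r" for q r
    using that g(3) w(4) y crs_swap_eq_0 by (metis fun_upd_same insertE)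
  have 5: "dot (crs (?y q) (?y r)) (?y s) \<noteq> 0"
    if qrs: "q \<in> insert p P" "r \<in> insert p P" "s \<in> insert p P" "q \<noteq> r" "r \<noteq> s" "q \<noteq> s"
      "\<not> (\<exists>l\<in>L. {q, r, s} \<subseteq> l)" for q r s
  proof -
    consider "q = p" "r \<in> P" "s \<in> P" | "r = p" "q \<in> P" "s \<in> P" | "s = p" "q \<in> P" "r \<in> P"
      | "q \<in> P" "r \<in> P" "s \<in> P"
      using qrs by blast
    then show ?thesis
    proof cases
      case 1
      then have "dot (crs (y r) (y s)) w \<noteq> 0"
        using w(5)[of r s] qrs by blast
      then show ?thesis
        using 1 y by (simp add: dot_crs_rotate[of w])
    next
      case 2
      then have "dot (crs (y s) (y q)) w \<noteq> 0"
        using w(5)[of s q] qrs by blast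
      then show ?thesis
        using 2 y by (simp add: dot_crs_rotate[of "y q" w] dot_crs_rotate[of w "y s"])
    next
      case 3
      then have "dot (crs (y q) (y r)) w \<noteq> 0"
        using w(5)[of q r] qrs by blast
      then show ?thesis
        using 3 y by simp
    next
      case 4
      then show ?thesis
        using g(5)[of q r s] qrs y by simp
    qed
  qed
  show ?thesis
    by (rule in_general_positionI[OF 1 2 3 g(4) 5])
qed

lemma in_general_position_insert_line:
  assumes gen: "in_general_position P L y h" and "l \<notin> L" and w: "w \<noteq> 0"
    "\<And>p. p \<in> P \<Longrightarrow> p \<in> l \<Longrightarrow> dot w (y p) = 0"
    "\<And>p. p \<in> P \<Longrightarrow> p \<notin> l \<Longrightarrow> dot w (y p) \<noteq> 0"
    "\<And>m. m \<in> L \<Longrightarrow> crs w (h m) \<noteq> 0"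
  shows "in_general_position P (insert l L) y (h(l := w))"
proof -
  let ?h = "h(l := w)"
  note g = in_general_positionD[OF gen]
  note f = flaggedD[OF g(1)]
  have h: "?h m = h m" if "m \<in> L" for m
    using that \<open>l \<notin> L\<close> by auto
  have 1: "flagged P (insert l L) y ?h"
    unfolding flagged_def using f w(1,2) h by (metis fun_upd_same insertE)
  have 2: "dot (?h m) (y q) \<noteq> 0" if "q \<in> P" "m \<in> insert l L" "q \<notin> m" for q m
    using that g(2) w(3) h by (metis fun_upd_same insertE)
  have 4: "crs (?h k) (?h m) \<noteq> 0" if "k \<in> insert l L" "m \<in> insert l L" "k \<noteq> m" for k m
    using that g(4) w(4) h crs_swap_eq_0 by (metis fun_upd_same insertE)
  have 5: "dot (crs (y p) (y q)) (y r) \<noteq> 0"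
    if "p \<in> P" "q \<in> P" "r \<in> P" "p \<noteq> q" "q \<noteq> r" "p \<noteq> r" "\<not> (\<exists>m\<in>insert l L. {p, q, r} \<subseteq> m)" for p q r
    using that by (intro g(5)) simp_all
  show ?thesis
    by (rule in_general_positionI[OF 1 2 g(3) 4 5])
qed

text \<open>\<open>perturb_leaf\<close> can only avoid zeros of linear forms. A form that kills
  \<open>a\<close> but not \<open>w\<close> turns non-parallelism into such a condition.\<close>

lemma not_parallel_if_separated:
  assumes "dot k a = 0" "dot k w \<noteq> 0" "a \<noteq> 0"
  shows "crs w a \<noteq> 0"
proof
  assume "crs w a = 0"
  then obtain c where "w = c *s a"
    using crs_eq_0_iff[OF assms(3)] by blast
  then show False
    using assms by simp
qed

text \<open>Supplies the separating forms; they must not be multiples of the neighbour, because on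
  its orthogonal plane such a form would vanish identically.\<close>

lemma exists_orthogonal_not_parallel_unless_two:
  assumes "\<And>a b. a \<in> N \<Longrightarrow> b \<in> N \<Longrightarrow> a = b" "\<And>a. a \<in> N \<Longrightarrow> u a \<noteq> 0"
  shows "\<exists>k. k \<noteq> 0 \<and> dot k x = 0 \<and> (\<forall>a\<in>N. crs k (u a) \<noteq> 0)"
proof (cases "N = {}")
  case True
  then show ?thesis
    using exists_orthogonal_nonzero[of x x] by auto
next
  case False
  then obtain a where "N = {a}"
    using assms(1) by blast
  moreover obtain k where "dot k x = 0" "crs k (u a) \<noteq> 0"
    using exists_orthogonal_not_parallel[of "u a" x] assms(2) \<open>N = {a}\<close> by blast
  moreover from this have "k \<noteq> 0" by auto
  ultimately show ?thesis by auto
qed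

lemma approximable_insert_point:
  assumes appr: "approximable P L" and fin: "finite P" "finite L" and "p \<notin> P"
    and one: "\<And>l m. l \<in> L \<Longrightarrow> m \<in> L \<Longrightarrow> p \<in> l \<Longrightarrow> p \<in> m \<Longrightarrow> l = m"
  shows "approximable (insert p P) L"
  unfolding approximable_def
proof (intro allI impI)
  fix y h and \<epsilon> :: real assume flag: "flagged (insert p P) L y h" and "\<epsilon> > 0"
  let ?N = "{l \<in> L. p \<in> l}"
  obtain \<delta> where "\<delta> > 0" and \<delta>: "\<And>h' H. (\<And>l. l \<in> ?N \<Longrightarrow> norm (h' l - h l) < \<delta>) \<Longrightarrow> finite H \<Longrightarrow>
       (\<And>k. k \<in> H \<Longrightarrow> k \<noteq> 0) \<Longrightarrow> (\<And>k l. k \<in> H \<Longrightarrow> l \<in> ?N \<Longrightarrow> crs k (h' l) \<noteq> 0) \<Longrightarrow>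
       \<exists>w'. norm (w' - y p) < \<epsilon> \<and> (\<forall>l\<in>?N. dot (h' l) w' = 0) \<and> (\<forall>k\<in>H. dot k w' \<noteq> 0)"
    by (rule perturb_leaf[of ?N h "y p" \<epsilon>]) (use one flaggedD[OF flag] \<open>\<epsilon> > 0\<close> in auto)
  have "flagged P L y h"
    using flag by (auto simp: flagged_def)
  then obtain y' h' where gen: "in_general_position P L y' h'"
    and near: "\<And>q. q \<in> P \<Longrightarrow> norm (y' q - y q) < min \<epsilon> \<delta>" "\<And>l. l \<in> L \<Longrightarrow> norm (h' l - h l) < min \<epsilon> \<delta>"
    using approximableD[OF appr, of y h "min \<epsilon> \<delta>"] \<open>\<epsilon> > 0\<close> \<open>\<delta> > 0\<close> by auto
  note g = in_general_positionD[OF gen]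
  note f = flaggedD[OF g(1)]
  have "\<exists>k. k \<noteq> 0 \<and> dot k x = 0 \<and> (\<forall>l\<in>?N. crs k (h' l) \<noteq> 0)" for x
    by (rule exists_orthogonal_not_parallel_unless_two) (use one f in auto)
  then obtain k where k: "\<And>x. k x \<noteq> 0" "\<And>x. dot (k x) x = 0" "\<And>x l. l \<in> ?N \<Longrightarrow> crs (k x) (h' l) \<noteq> 0"
    by metis
  define T where "T = {(q, r). q \<in> P \<and> r \<in> P \<and> q \<noteq> r \<and> \<not> (\<exists>l\<in>L. {p, q, r} \<subseteq> l)}"
  \<comment> \<open>The new point has to avoid the lines not through it and the joins of pairs with
    which it must not be collinear. The forms \<open>k (y' q)\<close> keep it from being parallel to
    \<open>y' q\<close>, and \<open>k 0\<close> keeps it nonzero.\<close>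
  define H where "H = h' ` {l \<in> L. p \<notin> l} \<union> (\<lambda>(q, r). crs (y' q) (y' r)) ` T \<union> k ` insert 0 (y' ` P)"
  have "finite T"
    by (rule finite_subset[of _ "P \<times> P"]) (use fin in \<open>auto simp: T_def\<close>)
  then have "finite H"
    using fin by (auto simp: H_def)
  have "x \<noteq> 0" if "x \<in> H" for x
    using that f g(3) k(1) by (auto simp: H_def T_def)
  moreover have "crs x (h' l) \<noteq> 0" if xl: "x \<in> H" "l \<in> ?N" for x l
  proof -
    have l: "l \<in> L" "p \<in> l" using xl by auto
    consider m where "m \<in> L" "p \<notin> m" "x = h' m" | q r where "(q, r) \<in> T" "x = crs (y' q) (y' r)" | z where "x = k z"
      using xl(1) unfolding H_def by (elim UnE imageE) auto
    then show ?thesis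
    proof cases
      case 1
      then show ?thesis using g(4) l by blast
    next
      \<comment> \<open>If the join of \<open>q\<close> and \<open>r\<close> were the line
        \<open>l\<close> through \<open>p\<close>, general position would put both on
        \<open>l\<close>, contrary to the choice of \<open>T\<close>.\<close>
      case 2
      show ?thesis
      proof
        assume "crs x (h' l) = 0"
        then obtain c where c: "crs (y' q) (y' r) = c *s h' l"
          using crs_eq_0_iff f(2)[OF l(1)] 2(2) by blast
        have qr: "q \<in> P" "r \<in> P" "q \<noteq> r" "\<not> {p, q, r} \<subseteq> l"
          using 2(1) l by (auto simp: T_def)
        then have "c \<noteq> 0"
          using g(3) c by fastforce
        moreover have "c * dot (h' l) (y' q) = 0" "c * dot (h' l) (y' r) = 0"
          using dot_crs(1,2)[of "y' q" "y' r"] unfolding c by simp_all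
        ultimately have "q \<in> l" "r \<in> l"
          using g(2) l qr by auto
        then show False using qr l by simp
      qed
    next
      case 3
      then show ?thesis using k(3) xl(2) by blast
    qed
  qed
  ultimately obtain w where w: "norm (w - y p) < \<epsilon>" "\<forall>l\<in>?N. dot (h' l) w = 0" "\<forall>x\<in>H. dot x w \<noteq> 0"
    using \<delta>[of h' H] near(2) \<open>finite H\<close> by auto
  have "in_general_position (insert p P) L (y'(p := w)) h'"
  proof (rule in_general_position_insert_point[OF gen \<open>p \<notin> P\<close>])
    have "k 0 \<in> H" by (simp add: H_def)
    then show "w \<noteq> 0" using w(3) by auto
  next
    fix q assume "q \<in> P"
    then have "k (y' q) \<in> H" by (simp add: H_def)
    then show "crs w (y' q) \<noteq> 0"
      using not_parallel_if_separated[of "k (y' q)" "y' q" w] w(3) k(2) f(1)[OF \<open>q \<in> P\<close>] by blast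
  next
    fix q r assume "q \<in> P" "r \<in> P" "q \<noteq> r" "\<not> (\<exists>l\<in>L. {p, q, r} \<subseteq> l)"
    then have "(q, r) \<in> T" by (auto simp: T_def)
    then have "crs (y' q) (y' r) \<in> H" unfolding H_def by force
    then show "dot (crs (y' q) (y' r)) w \<noteq> 0" using w(3) by blast
  qed (use w in \<open>auto simp: H_def\<close>)
  then show "\<exists>y' h'. in_general_position (insert p P) L y' h' \<and>
      (\<forall>q\<in>insert p P. norm (y' q - y q) < \<epsilon>) \<and> (\<forall>l\<in>L. norm (h' l - h l) < \<epsilon>)"
    using w(1) near \<open>p \<notin> P\<close> by (intro exI[of _ "y'(p := w)"] exI[of _ h']) auto
qed

text \<open>The dual of inserting a point, except that a new line creates no new triples of points
  to be kept independent.\<close>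

lemma approximable_insert_line:
  assumes appr: "approximable P L" and fin: "finite P" "finite L" and "l \<notin> L"
    and one: "\<And>p q. p \<in> P \<Longrightarrow> q \<in> P \<Longrightarrow> p \<in> l \<Longrightarrow> q \<in> l \<Longrightarrow> p = q"
  shows "approximable P (insert l L)"
  unfolding approximable_def
proof (intro allI impI)
  fix y h and \<epsilon> :: real assume flag: "flagged P (insert l L) y h" and "\<epsilon> > 0"
  let ?N = "{p \<in> P. p \<in> l}"
  obtain \<delta> where "\<delta> > 0" and \<delta>: "\<And>y' H. (\<And>p. p \<in> ?N \<Longrightarrow> norm (y' p - y p) < \<delta>) \<Longrightarrow> finite H \<Longrightarrow>
       (\<And>k. k \<in> H \<Longrightarrow> k \<noteq> 0) \<Longrightarrow> (\<And>k p. k \<in> H \<Longrightarrow> p \<in> ?N \<Longrightarrow> crs k (y' p) \<noteq> 0) \<Longrightarrow>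
       \<exists>w'. norm (w' - h l) < \<epsilon> \<and> (\<forall>p\<in>?N. dot (y' p) w' = 0) \<and> (\<forall>k\<in>H. dot k w' \<noteq> 0)"
    by (rule perturb_leaf[of ?N y "h l" \<epsilon>])
       (use one flaggedD[OF flag] \<open>\<epsilon> > 0\<close> in \<open>auto simp: dot_commute[of "y _"]\<close>)
  have "flagged P L y h"
    using flag by (auto simp: flagged_def)
  then obtain y' h' where gen: "in_general_position P L y' h'"
    and near: "\<And>q. q \<in> P \<Longrightarrow> norm (y' q - y q) < min \<epsilon> \<delta>" "\<And>l. l \<in> L \<Longrightarrow> norm (h' l - h l) < min \<epsilon> \<delta>"
    using approximableD[OF appr, of y h "min \<epsilon> \<delta>"] \<open>\<epsilon> > 0\<close> \<open>\<delta> > 0\<close> by auto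
  note g = in_general_positionD[OF gen]
  note f = flaggedD[OF g(1)]
  have "\<exists>k. k \<noteq> 0 \<and> dot k x = 0 \<and> (\<forall>p\<in>?N. crs k (y' p) \<noteq> 0)" for x
    by (rule exists_orthogonal_not_parallel_unless_two) (use one f in auto)
  then obtain k where k: "\<And>x. k x \<noteq> 0" "\<And>x. dot (k x) x = 0" "\<And>x p. p \<in> ?N \<Longrightarrow> crs (k x) (y' p) \<noteq> 0"
    by metis
  define H where "H = y' ` {p \<in> P. p \<notin> l} \<union> k ` insert 0 (h' ` L)"
  have "finite H"
    using fin by (auto simp: H_def)
  moreover have "x \<noteq> 0" if "x \<in> H" for x
    using that f k(1) by (auto simp: H_def)
  moreover have "crs x (y' p) \<noteq> 0" if "x \<in> H" "p \<in> ?N" for x p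
    using that g(3) k(3) unfolding H_def by blast
  ultimately obtain w where w: "norm (w - h l) < \<epsilon>" "\<forall>p\<in>?N. dot (y' p) w = 0" "\<forall>x\<in>H. dot x w \<noteq> 0"
    using \<delta>[of y' H] near(1) by auto
  have "in_general_position P (insert l L) y' (h'(l := w))"
  proof (rule in_general_position_insert_line[OF gen \<open>l \<notin> L\<close>])
    have "k 0 \<in> H" by (simp add: H_def)
    then show "w \<noteq> 0" using w(3) by auto
  next
    fix m assume "m \<in> L"
    then have "k (h' m) \<in> H" by (simp add: H_def)
    then show "crs w (h' m) \<noteq> 0"
      using not_parallel_if_separated[of "k (h' m)" "h' m" w] w(3) k(2) f(2)[OF \<open>m \<in> L\<close>] by blast
  qed (use w in \<open>auto simp: H_def dot_commute[of w]\<close>)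
  then show "\<exists>y' h'. in_general_position P (insert l L) y' h' \<and>
      (\<forall>q\<in>P. norm (y' q - y q) < \<epsilon>) \<and> (\<forall>l\<in>insert l L. norm (h' l - h l) < \<epsilon>)"
    using w(1) near \<open>l \<notin> L\<close> by (intro exI[of _ y'] exI[of _ "h'(l := w)"]) auto
qed

text \<open>The covector of \<open>l\<close> must become a multiple of the join of \<open>a\<close>
  and \<open>b\<close>, and this join is near \<open>h l\<close> only if \<open>a\<close> and
  \<open>b\<close> are not parallel to begin with. So \<open>c\<close>, \<open>A\<close>,
  \<open>a\<close> are moved first; the hypotheses say that their only incidences in
  \<open>P\<close> and \<open>L\<close> are those of the path \<open>B, c, A, a\<close>. Then the
  induction hypothesis is applied near the moved configuration.\<close>

lemma approximable_close_cycle: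
  assumes appr: "approximable P L" and "l \<notin> L"
    and l: "l \<inter> P = {a, b}" and A: "{m \<in> L. a \<in> m} = {A}" "A \<inter> P = {a, c}"
    and B: "{m \<in> L. c \<in> m} = {A, B}" "A \<noteq> B" and abc: "a \<noteq> b" "c \<noteq> a" "c \<noteq> b"
  shows "approximable P (insert l L)"
  unfolding approximable_def
proof (intro allI impI)
  fix y h and \<epsilon> :: real assume flag: "flagged P (insert l L) y h" and "\<epsilon> > 0"
  note f = flaggedD[OF flag]
  have mem: "a \<in> P" "b \<in> P" "c \<in> P" "A \<in> L" "B \<in> L" "a \<in> l" "b \<in> l" "a \<in> A" "c \<in> A" "c \<in> B"
  proof -
    have "a \<in> l \<inter> P" "b \<in> l \<inter> P"
      by (simp_all only: l insert_iff simp_thms)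
    then show "a \<in> P" "b \<in> P" "a \<in> l" "b \<in> l"
      by simp_all
    have "A \<in> {m \<in> L. a \<in> m}"
      by (simp only: A(1) insert_iff simp_thms)
    then show "A \<in> L" "a \<in> A"
      by simp_all
    have "c \<in> A \<inter> P"
      by (simp only: A(2) insert_iff simp_thms)
    then show "c \<in> P" "c \<in> A"
      by simp_all
    have "B \<in> {m \<in> L. c \<in> m}"
      by (simp only: B(1) insert_iff simp_thms)
    then show "B \<in> L" "c \<in> B"
      by simp_all
  qed
  have on_a: "m = A" if "m \<in> L" "a \<in> m" for m
    using A(1) that by blast
  have on_A: "p = a \<or> p = c" if "p \<in> A" "p \<in> P" for p
    using A(2) that by blast
  have on_c: "m = A \<or> m = B" if "m \<in> L" "c \<in> m" for m
    using B(1) that by blast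
  have inc: "dot (h B) (y c) = 0" "dot (h A) (y c) = 0" "dot (h A) (y a) = 0"
    "dot (h l) (y a) = 0" "dot (h l) (y b) = 0"
    using mem by (auto intro: f(3))
  \<comment> \<open>Half of \<open>\<epsilon>\<close> is left for the second perturbation; the two
    norms keep \<open>c'\<close> and \<open>A'\<close> nonzero.\<close>
  define \<eta> where "\<eta> = min (\<epsilon> / 2) (min (norm (y c)) (norm (h A)))"
  have "\<eta> > 0"
    using \<open>\<epsilon> > 0\<close> f mem by (auto simp: \<eta>_def)
  obtain c' A' a' where *: "norm (c' - y c) < \<eta>" "norm (A' - h A) < \<eta>" "norm (a' - y a) < \<eta>"
    "dot (h B) c' = 0" "dot A' c' = 0" "dot A' a' = 0" "dot (h l) a' = 0" "crs a' (y b) \<noteq> 0"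
    by (rule perturb_path[of "h A" "h B" "h l" "y a" "y b" "y c" \<eta>])
       (use f inc mem \<open>\<eta> > 0\<close> in auto)
  have nz: "c' \<noteq> 0" "A' \<noteq> 0" "a' \<noteq> 0"
    using * by (auto simp: \<eta>_def)
  define y1 where "y1 = y(c := c', a := a')"
  define h1 where "h1 = h(A := A')"
  have y1: "y1 a = a'" "y1 c = c'" "y1 b = y b"
    using abc by (auto simp: y1_def)
  have flag1: "flagged P L y1 h1"
    unfolding flagged_def
  proof (intro conjI ballI impI)
    fix p assume "p \<in> P"
    then show "y1 p \<noteq> 0" using f(1) nz by (auto simp: y1_def)
  next
    fix m assume "m \<in> L"
    then show "h1 m \<noteq> 0" using f(2) nz by (auto simp: h1_def)
  next
    fix p m assume pm: "p \<in> P" "m \<in> L" "p \<in> m"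
    show "dot (h1 m) (y1 p) = 0"
    proof (cases "m = A")
      case True
      then have "p = a \<or> p = c" using on_A pm by blast
      then show ?thesis using True * y1 by (auto simp: h1_def)
    next
      case False
      then have "p \<noteq> a" using on_a pm by blast
      show ?thesis
      proof (cases "p = c")
        case True
        then have "m = B" using False on_c pm by blast
        then show ?thesis using True * False y1 by (auto simp: h1_def)
      next
        case c: False
        then show ?thesis
          using \<open>p \<noteq> a\<close> False pm f(3)[of p m] by (auto simp: h1_def y1_def)
      qed
    qed
  qed
  \<comment> \<open>The same factor \<open>r\<close> is kept for the final covector, so continuity
    of the join keeps that covector near \<open>h l\<close>.\<close>
  obtain r where r: "h l = r *s crs (y1 a) (y1 b)"
    using orthogonal_parallel_crs[of a' "y b" "h l"] * inc(5) y1 by (metis dot_commute)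
  have "r \<noteq> 0"
    using r f(2)[of l] by auto
  have "((\<lambda>z. r *s crs (fst z) (snd z)) \<longlongrightarrow> r *s crs (y1 a) (y1 b)) (nhds (y1 a, y1 b))"
    using tendsto_fst[OF filterlim_ident, of "(y1 a, y1 b)"] tendsto_snd[OF filterlim_ident, of "(y1 a, y1 b)"]
    by (intro tendsto_intros continuous_crs) simp_all
  then have "\<forall>\<^sub>F z in nhds (y1 a, y1 b). dist (r *s crs (fst z) (snd z)) (h l) < \<epsilon>"
    unfolding r using \<open>\<epsilon> > 0\<close> by (rule tendstoD)
  then obtain \<delta> where \<delta>: "\<delta> > 0"
    "\<And>z. dist z (y1 a, y1 b) < \<delta> \<Longrightarrow> norm (r *s crs (fst z) (snd z) - h l) < \<epsilon>"
    unfolding eventually_nhds_metric by (auto simp: dist_norm)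
  obtain y2 h2 where gen: "in_general_position P L y2 h2"
    and near: "\<And>q. q \<in> P \<Longrightarrow> norm (y2 q - y1 q) < min (\<epsilon> / 2) (\<delta> / 2)"
      "\<And>l. l \<in> L \<Longrightarrow> norm (h2 l - h1 l) < min (\<epsilon> / 2) (\<delta> / 2)"
    using approximableD[OF appr flag1, of "min (\<epsilon> / 2) (\<delta> / 2)"] \<open>\<epsilon> > 0\<close> \<open>\<delta> > 0\<close> by auto
  note g = in_general_positionD[OF gen]
  have "dist (y2 a, y2 b) (y1 a, y1 b) < \<delta>"
    using dist_Pair_Pair[of "y2 a" "y2 b" "y1 a" "y1 b"] near(1)[OF mem(1)] near(1)[OF mem(2)]
      sqrt_sum_squares_le_sum[of "dist (y2 a) (y1 a)" "dist (y2 b) (y1 b)"]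
    by (auto simp: dist_norm)
  then have l_near: "norm (r *s crs (y2 a) (y2 b) - h l) < \<epsilon>"
    using \<delta>(2) by force
  \<comment> \<open>In \<open>L\<close> only \<open>A\<close> passes through \<open>a\<close>, and
    \<open>A\<close> misses \<open>b\<close>. Thus a point off \<open>l\<close> forms with
    \<open>a\<close> and \<open>b\<close> a triple on no line of \<open>L\<close>, and the join of
    \<open>a\<close> and \<open>b\<close> avoids it.\<close>
  have no_line: "\<not> (\<exists>m\<in>L. a \<in> m \<and> b \<in> m)"
    using on_a on_A abc mem by blast
  have ab: "crs (y2 a) (y2 b) \<noteq> 0"
    using g(3) mem abc by blast
  have "in_general_position P (insert l L) y2 (h2(l := r *s crs (y2 a) (y2 b)))"
  proof (rule in_general_position_insert_line[OF gen \<open>l \<notin> L\<close>])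
    show "r *s crs (y2 a) (y2 b) \<noteq> 0"
      using \<open>r \<noteq> 0\<close> ab by simp
  next
    fix p assume "p \<in> P" "p \<in> l"
    then have "p = a \<or> p = b" using l by blast
    then show "dot (r *s crs (y2 a) (y2 b)) (y2 p) = 0" by auto
  next
    fix p assume p: "p \<in> P" "p \<notin> l"
    then have "dot (crs (y2 a) (y2 b)) (y2 p) \<noteq> 0"
      using mem abc no_line by (intro g(5)) auto
    then show "dot (r *s crs (y2 a) (y2 b)) (y2 p) \<noteq> 0"
      using \<open>r \<noteq> 0\<close> by simp
  next
    fix m assume m: "m \<in> L"
    show "crs (r *s crs (y2 a) (y2 b)) (h2 m) \<noteq> 0"
    proof
      assume "crs (r *s crs (y2 a) (y2 b)) (h2 m) = 0"
      then have "crs (crs (y2 a) (y2 b)) (h2 m) = 0"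
        using \<open>r \<noteq> 0\<close> by (simp add: crs_linear)
      then obtain k where "h2 m = k *s crs (y2 a) (y2 b)"
        using ab crs_eq_0_iff crs_swap_eq_0 by metis
      then have "dot (h2 m) (y2 a) = 0" "dot (h2 m) (y2 b) = 0" by auto
      then show False
        using g(2) m mem no_line by blast
    qed
  qed
  moreover have "norm (y2 q - y q) < \<epsilon>" if "q \<in> P" for q
  proof -
    have "norm (y1 q - y q) < \<epsilon> / 2"
      using * \<open>\<epsilon> > 0\<close> by (auto simp: y1_def \<eta>_def)
    then show ?thesis
      using near(1)[OF that] norm_triangle_ineq[of "y2 q - y1 q" "y1 q - y q"] by auto
  qed
  moreover have "norm (h2 m - h m) < \<epsilon>" if "m \<in> L" for m
  proof -
    have "norm (h1 m - h m) < \<epsilon> / 2"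
      using * \<open>\<epsilon> > 0\<close> by (auto simp: h1_def \<eta>_def)
    then show ?thesis
      using near(2)[OF that] norm_triangle_ineq[of "h2 m - h1 m" "h1 m - h m"] by auto
  qed
  ultimately show "\<exists>y' h'. in_general_position P (insert l L) y' h' \<and>
      (\<forall>q\<in>P. norm (y' q - y q) < \<epsilon>) \<and> (\<forall>l\<in>insert l L. norm (h' l - h l) < \<epsilon>)"
    using l_near \<open>l \<notin> L\<close>
    by (intro exI[of _ y2] exI[of _ "h2(l := r *s crs (y2 a) (y2 b))"]) auto
qed

text \<open>
  In the rule \<open>close\<close> the line \<open>l\<close> closes a cycle; the end \<open>B, c, A, a\<close> of the chain that it closes has
  no further incidences with \<open>P\<close> and \<open>L\<close> and can therefore be moved independently of the rest.
\<close>

inductive buildable :: "'a set \<Rightarrow> 'a set set \<Rightarrow> bool" where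
  empty: "buildable {} {}"
| point: "buildable P L \<Longrightarrow> p \<notin> P \<Longrightarrow> (\<And>l m. l \<in> L \<Longrightarrow> m \<in> L \<Longrightarrow> p \<in> l \<Longrightarrow> p \<in> m \<Longrightarrow> l = m) \<Longrightarrow>
    buildable (insert p P) L"
| line: "buildable P L \<Longrightarrow> l \<notin> L \<Longrightarrow> (\<And>p q. p \<in> P \<Longrightarrow> q \<in> P \<Longrightarrow> p \<in> l \<Longrightarrow> q \<in> l \<Longrightarrow> p = q) \<Longrightarrow>
    buildable P (insert l L)"
| close: "buildable P L \<Longrightarrow> l \<notin> L \<Longrightarrow> l \<inter> P = {a, b} \<Longrightarrow> {m \<in> L. a \<in> m} = {A} \<Longrightarrow> A \<inter> P = {a, c} \<Longrightarrow>
    {m \<in> L. c \<in> m} = {A, B} \<Longrightarrow> A \<noteq> B \<Longrightarrow> a \<noteq> b \<Longrightarrow> c \<noteq> a \<Longrightarrow> c \<noteq> b \<Longrightarrow> buildable P (insert l L)"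

lemma buildable_finite: "buildable P L \<Longrightarrow> finite P \<and> finite L"
  by (induction rule: buildable.induct) (simp_all only: finite.emptyI finite_insert simp_thms)

theorem buildable_approximable: "buildable P L \<Longrightarrow> approximable P L"
proof (induction rule: buildable.induct)
  case empty
  show ?case
    by (simp add: approximable_def in_general_position_def flagged_def)
next
  case (point P L p)
  show ?case
    by (rule approximable_insert_point) (use point buildable_finite in blast)+
next
  case (line P L l)
  show ?case
    by (rule approximable_insert_line) (use line buildable_finite in blast)+
next
  case (close P L l a b A c B)
  show ?case
    by (rule approximable_close_cycle) (fact close)+
qed

section \<open>Cactus configurations can be built step by step\<close>

lemma buildable_add_points:
  assumes "finite Q" "buildable P L"
    and "\<And>p l m. p \<in> Q - P \<Longrightarrow> l \<in> L \<Longrightarrow> m \<in> L \<Longrightarrow> p \<in> l \<Longrightarrow> p \<in> m \<Longrightarrow> l = m"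
  shows "buildable (P \<union> Q) L"
  using assms(1,3)
proof (induction rule: finite_induct)
  case empty
  then show ?case using assms(2) by simp
next
  case (insert q Q)
  have IH: "buildable (P \<union> Q) L"
    by (rule insert.IH) (use insert.prems in blast)
  show ?case
  proof (cases "q \<in> P")
    case True
    then show ?thesis using IH by (simp add: insert_absorb)
  next
    case False
    then have "buildable (insert q (P \<union> Q)) L"
      by (intro buildable.point IH) (use insert.hyps insert.prems in auto)
    then show ?thesis by simp
  qed
qed

text \<open>The line goes in before its remaining points; as old lines stay within \<open>P\<close>,
  each of these points is then on one line only.\<close>

lemma buildable_add_line:
  assumes "buildable P L" "finite l" "\<And>m. m \<in> L \<Longrightarrow> m \<subseteq> P"
    and "\<And>p q. p \<in> P \<Longrightarrow> q \<in> P \<Longrightarrow> p \<in> l \<Longrightarrow> q \<in> l \<Longrightarrow> p = q"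
  shows "buildable (P \<union> l) (insert l L)"
proof (cases "l \<in> L")
  case True
  then show ?thesis
    using assms(1,3) by (simp add: insert_absorb Un_absorb2)
next
  case False
  show ?thesis
  proof (rule buildable_add_points[OF assms(2)])
    show "buildable P (insert l L)"
      by (rule buildable.line[OF assms(1) False assms(4)])
  next
    fix p k m assume "p \<in> l - P" "k \<in> insert l L" "m \<in> insert l L" "p \<in> k" "p \<in> m"
    then show "k = m" using assms(3) by blast
  qed
qed

text \<open>A cycle with two lines is only a pair of lines. The one through the attaching point goes
  first, so that the other meets what is present at most in their common point.\<close>

lemma buildable_add_two_lines:
  assumes "buildable P L" "finite l" "finite k" "\<And>m. m \<in> L \<Longrightarrow> m \<subseteq> P"
    and "(l \<union> k) \<inter> P \<subseteq> {q}" "q \<in> l"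
    and one: "\<And>x y. x \<in> l \<Longrightarrow> x \<in> k \<Longrightarrow> y \<in> l \<Longrightarrow> y \<in> k \<Longrightarrow> x = y"
  shows "buildable (P \<union> (l \<union> k)) (L \<union> {l, k})"
proof -
  have "buildable (P \<union> l) (insert l L)"
    by (rule buildable_add_line[OF assms(1,2,4)]) (use assms(5) in auto)
  then have "buildable (P \<union> l \<union> k) (insert k (insert l L))"
  proof (rule buildable_add_line[OF _ assms(3)])
    show "m \<subseteq> P \<union> l" if "m \<in> insert l L" for m
      using that assms(4) by blast
    have "x \<in> l" if "x \<in> P \<union> l" "x \<in> k" for x
      using that assms(5,6) by blast
    then show "x = y" if "x \<in> P \<union> l" "y \<in> P \<union> l" "x \<in> k" "y \<in> k" for x y
      using that one by blast
  qed
  moreover have "P \<union> l \<union> k = P \<union> (l \<union> k)" "insert k (insert l L) = L \<union> {l, k}" by auto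
  ultimately show ?thesis by simp
qed

text \<open>The vertex \<open>p j\<close> lies between \<open>l j\<close> and
  \<open>l (Suc j mod n)\<close>. The lines may carry further points, but two different lines share
  only vertices.\<close>

definition cyclic_lines :: "nat \<Rightarrow> (nat \<Rightarrow> 'a) \<Rightarrow> (nat \<Rightarrow> 'a set) \<Rightarrow> bool" where
  "cyclic_lines n p l \<longleftrightarrow> n \<ge> 3 \<and> inj_on l {..<n} \<and> (\<forall>i<n. finite (l i)) \<and>
     (\<forall>i<n. \<forall>j<n. p j \<in> l i \<longleftrightarrow> i = j \<or> i = Suc j mod n) \<and>
     (\<forall>i<n. \<forall>j<n. \<forall>z. z \<in> l i \<and> z \<in> l j \<and> i \<noteq> j \<longrightarrow> (\<exists>k<n. z = p k))"

lemma cyclic_linesI: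
  assumes "n \<ge> 3" "inj_on l {..<n}" "\<And>i. i < n \<Longrightarrow> finite (l i)"
    "\<And>i j. i < n \<Longrightarrow> j < n \<Longrightarrow> p j \<in> l i \<longleftrightarrow> i = j \<or> i = Suc j mod n"
    "\<And>i j z. i < n \<Longrightarrow> j < n \<Longrightarrow> z \<in> l i \<Longrightarrow> z \<in> l j \<Longrightarrow> i \<noteq> j \<Longrightarrow> \<exists>k<n. z = p k"
  shows "cyclic_lines n p l"
  unfolding cyclic_lines_def using assms by (intro conjI allI impI) (simp_all only: simp_thms)

lemma cyclic_linesD:
  assumes "cyclic_lines n p l"
  shows "n \<ge> 3" "inj_on l {..<n}" "i < n \<Longrightarrow> finite (l i)"
    "i < n \<Longrightarrow> j < n \<Longrightarrow> p j \<in> l i \<longleftrightarrow> i = j \<or> i = (if Suc j = n then 0 else Suc j)"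
    "i < n \<Longrightarrow> j < n \<Longrightarrow> z \<in> l i \<Longrightarrow> z \<in> l j \<Longrightarrow> i \<noteq> j \<Longrightarrow> \<exists>k<n. z = p k"
  using assms by (simp_all add: cyclic_lines_def mod_Suc)

text \<open>Two different indices with the same vertex would each succeed the other modulo
  \<open>n\<close>, which is impossible for \<open>n\<close> at least 3.\<close>

lemma cyclic_lines_inj:
  assumes "cyclic_lines n p l" "i < n" "j < n" "p i = p j"
  shows "i = j"
proof -
  note c = cyclic_linesD[OF assms(1)]
  have "p i \<in> l i" "p j \<in> l j"
    using c(4) assms(2,3) by auto
  then have "p j \<in> l i" "p i \<in> l j"
    using assms(4) by auto
  then show ?thesis
    using c(1) c(4)[of i j] c(4)[of j i] assms(2,3) by (auto split: if_splits)
qed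

text \<open>
  The line \<open>l 1\<close> contains the attaching point; the lines \<open>l 1, l 2, \<dots>\<close> and the points joining them
  are added one after the other, and \<open>l 0\<close> closes the cycle.
\<close>

lemma buildable_add_cycle:
  assumes cyc: "cyclic_lines n p l" and bld: "buildable P L" and sub: "\<And>m. m \<in> L \<Longrightarrow> m \<subseteq> P"
    and att: "\<And>i z. i < n \<Longrightarrow> z \<in> l i \<Longrightarrow> z \<in> P \<Longrightarrow> z = x" and x: "x \<in> l 1" "x \<noteq> p 1"
  shows "buildable (P \<union> (\<Union>i<n. l i)) (L \<union> l ` {..<n})"
proof -
  note c = cyclic_linesD[OF cyc]
  note inj = cyclic_lines_inj[OF cyc]
  have n: "0 < n" "1 < n" "2 < n" "n - 1 < n" "n - 2 < n" "n - 2 \<ge> 1" "Suc (n - 1) = n" "Suc (n - 2) = n - 1"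
    using c(1) by auto
  have l_inj: "i = j" if "l i = l j" "i < n" "j < n" for i j
    using inj_onD[OF c(2) that(1)] that by simp
  have pl: "p j \<in> l i \<longleftrightarrow> i = j \<or> i = Suc j" if "i < n" "j < n" "i > 0" for i j
    using c(4)[OF that(1,2)] that by (auto split: if_splits)
  have pl0: "p j \<in> l 0 \<longleftrightarrow> j = 0 \<or> j = n - 1" if "j < n" for j
    using c(4)[OF n(1) that] that by (auto split: if_splits)
  \<comment> \<open>The attaching point is on \<open>l 1\<close>. It can be on another line only as
    a vertex of \<open>l 1\<close> other than \<open>p 1\<close>, that is as \<open>p 0\<close>, and
    then this line is \<open>l 0\<close>.\<close>
  have in_P: "i = 1 \<or> (i = 0 \<and> z = p 0)" if z: "i < n" "z \<in> l i" "z \<in> P" for i z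
  proof (rule ccontr)
    assume neg: "\<not> (i = 1 \<or> (i = 0 \<and> z = p 0))"
    have zx: "z = x" using att z by blast
    then obtain k where k: "k < n" "z = p k"
      using c(5)[of i 1 z] z x neg n by auto
    have "k = 0 \<or> k = 1"
      using pl[of 1 k] k zx x(1) n by auto
    then have "k = 0" using k zx x(2) by auto
    then show False
      using c(4)[of i 0] k z neg n by (auto split: if_splits)
  qed
  have p_notin: "p j \<notin> P" if "j < n" "j \<noteq> 0" for j
  proof
    assume "p j \<in> P"
    moreover have "p j \<in> l j" using c(4) that by auto
    ultimately have "j = 1" using in_P[of j "p j"] that by blast
    then show False
      using att[of 1 "p 1"] \<open>p j \<in> P\<close> \<open>p j \<in> l j\<close> x n by auto
  qed
  have l_notin: "l i \<notin> L" if "i < n" for i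
  proof
    assume "l i \<in> L"
    then have "l i \<subseteq> P" using sub by blast
    moreover have "p i \<in> l i" "p (if i = 0 then n - 1 else i - 1) \<in> l i"
      using c(4)[of i i] c(4)[of i "i - 1"] pl0[of "n - 1"] that n by auto
    ultimately have "p i \<in> P" "p (if i = 0 then n - 1 else i - 1) \<in> P" by blast+
    then show False
      using p_notin[of i] p_notin[of "n - 1"] that n by (auto split: if_splits)
  qed
  \<comment> \<open>Both vertices of \<open>l 1\<close> enter at the start, because
    \<open>l 0\<close> will later need \<open>p 0\<close>.\<close>
  have chain: "buildable (P \<union> p ` {..k}) (L \<union> l ` {1..k})" if "1 \<le> k" "k < n" for k
    using that
  proof (induction k rule: dec_induct)
    case base
    have "buildable P (insert (l 1) L)"
      by (rule buildable.line[OF bld l_notin]) (use att n in blast)+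
    then have "buildable (P \<union> {p 0, p 1}) (insert (l 1) L)"
      by (intro buildable_add_points) (use sub in auto)
    moreover have "{..Suc 0} = {0, 1}" by auto
    ultimately show ?case by simp
  next
    case (step k)
    have k: "1 \<le> k" "k < n" "Suc k < n" using step by auto
    have "buildable (P \<union> p ` {..k}) (insert (l (Suc k)) (L \<union> l ` {1..k}))"
    proof (rule buildable.line)
      show "buildable (P \<union> p ` {..k}) (L \<union> l ` {1..k})"
        using step k by simp
      show "l (Suc k) \<notin> L \<union> l ` {1..k}"
        using l_notin[OF k(3)] l_inj[of "Suc k"] k by fastforce
      have "z = p k" if "z \<in> P \<union> p ` {..k}" "z \<in> l (Suc k)" for z
        using that(1)
      proof
        assume "z \<in> P"
        then show ?thesis using in_P[of "Suc k" z] that k by auto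
      next
        assume "z \<in> p ` {..k}"
        then obtain j where j: "j \<le> k" "z = p j" by auto
        then have "Suc k = j \<or> Suc k = Suc j"
          using pl[of "Suc k" j] that k by auto
        then show ?thesis using j by auto
      qed
      then show "z = z'" if "z \<in> P \<union> p ` {..k}" "z' \<in> P \<union> p ` {..k}" "z \<in> l (Suc k)" "z' \<in> l (Suc k)" for z z'
        using that by metis
    qed
    then have "buildable (insert (p (Suc k)) (P \<union> p ` {..k})) (insert (l (Suc k)) (L \<union> l ` {1..k}))"
    proof (rule buildable.point)
      show "p (Suc k) \<notin> P \<union> p ` {..k}"
      proof
        assume "p (Suc k) \<in> P \<union> p ` {..k}"
        then obtain j where "j \<le> k" "p (Suc k) = p j"
          using p_notin[of "Suc k"] k by auto
        then show False using inj[of "Suc k" j] k by simp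
      qed
      have "m = l (Suc k)" if "m \<in> insert (l (Suc k)) (L \<union> l ` {1..k})" "p (Suc k) \<in> m" for m
      proof -
        have "m \<notin> L" using sub p_notin[of "Suc k"] that(2) k by blast
        moreover have False if "j \<in> {1..k}" "m = l j" for j
          using pl[of j "Suc k"] that k \<open>p (Suc k) \<in> m\<close> by auto
        ultimately show ?thesis using that by blast
      qed
      then show "m = m'" if "m \<in> insert (l (Suc k)) (L \<union> l ` {1..k})" "m' \<in> insert (l (Suc k)) (L \<union> l ` {1..k})"
        "p (Suc k) \<in> m" "p (Suc k) \<in> m'" for m m'
        using that by metis
    qed
    moreover have "insert (p (Suc k)) (P \<union> p ` {..k}) = P \<union> p ` {..Suc k}"
      by (simp add: atMost_Suc)
    moreover have "insert (l (Suc k)) (L \<union> l ` {1..k}) = L \<union> l ` {1..Suc k}"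
      using k by (simp add: atLeastAtMostSuc_conv)
    ultimately show ?case by simp
  qed
  define P' where "P' = P \<union> p ` {..n - 1}"
  define L' where "L' = L \<union> l ` {1..n - 1}"
  have bld': "buildable P' L'"
    unfolding P'_def L'_def using chain[of "n - 1"] n by simp
  have pP': "p j \<in> P'" if "j < n" for j
    using that by (auto simp: P'_def)
  have P'E: "z \<in> P \<or> (\<exists>j<n. z = p j)" if "z \<in> P'" for z
  proof -
    have "z \<in> P \<or> (\<exists>j\<in>{..n - 1}. z = p j)" using that by (auto simp: P'_def)
    moreover have "j < n" if "j \<in> {..n - 1}" for j using that n(1) by auto
    ultimately show ?thesis by blast
  qed
  have L'E: "m \<in> L \<or> (\<exists>j<n. j > 0 \<and> m = l j)" if "m \<in> L'" for m
  proof -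
    have "m \<in> L \<or> (\<exists>j\<in>{1..n - 1}. m = l j)" using that by (auto simp: L'_def)
    moreover have "j < n \<and> j > 0" if "j \<in> {1..n - 1}" for j using that n(1) by auto
    ultimately show ?thesis by blast
  qed
  have lL': "l j \<in> L'" if "j < n" "j > 0" for j
    using that by (auto simp: L'_def)
  have "buildable P' (insert (l 0) L')"
  \<comment> \<open>For \<open>n = 3\<close> the inner vertex \<open>c\<close> is \<open>p 1\<close>
    itself; that \<open>x\<close> differs from \<open>p 1\<close> keeps it clear of the lines
    already built.\<close>
  proof (rule buildable.close[OF bld', where a = "p (n - 1)" and b = "p 0" and c = "p (n - 2)"
        and A = "l (n - 1)" and B = "l (n - 2)"])
    show "l 0 \<notin> L'"
    proof
      assume "l 0 \<in> L'"
      then obtain j where "j < n" "j > 0" "l 0 = l j" using L'E l_notin n by blast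
      then show False using l_inj[of 0 j] n by simp
    qed
    show "l 0 \<inter> P' = {p (n - 1), p 0}"
    proof (intro equalityI subsetI)
      fix z assume z: "z \<in> l 0 \<inter> P'"
      then have "z \<in> P \<or> (\<exists>j<n. z = p j)" using P'E by blast
      then show "z \<in> {p (n - 1), p 0}"
      proof
        assume "z \<in> P"
        then show ?thesis using in_P[of 0 z] z n by auto
      next
        assume "\<exists>j<n. z = p j"
        then show ?thesis using pl0 z by auto
      qed
    next
      fix z assume "z \<in> {p (n - 1), p 0}"
      then show "z \<in> l 0 \<inter> P'" using pl0 pP' n by auto
    qed
    show "{m \<in> L'. p (n - 1) \<in> m} = {l (n - 1)}"
    proof (intro equalityI subsetI)
      fix m assume m: "m \<in> {m \<in> L'. p (n - 1) \<in> m}"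
      then have "m \<notin> L" using sub p_notin[of "n - 1"] n by fastforce
      then obtain j where "j < n" "j > 0" "m = l j" using m L'E by blast
      then show "m \<in> {l (n - 1)}" using pl[of j "n - 1"] m n by auto
    qed (use lL' pl[of "n - 1" "n - 1"] n in auto)
    show "l (n - 1) \<inter> P' = {p (n - 1), p (n - 2)}"
    proof (intro equalityI subsetI)
      fix z assume z: "z \<in> l (n - 1) \<inter> P'"
      then have "z \<in> P \<or> (\<exists>j<n. z = p j)" using P'E by blast
      then show "z \<in> {p (n - 1), p (n - 2)}"
      proof
        assume "z \<in> P"
        then show ?thesis using in_P[of "n - 1" z] z n by auto
      next
        assume "\<exists>j<n. z = p j"
        then obtain j where j: "j < n" "z = p j" by blast
        then have "n - 1 = j \<or> n - 1 = Suc j" using pl[of "n - 1" j] z n by auto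
        then show ?thesis
        proof
          assume "n - 1 = Suc j"
          then have "j = n - 2" by linarith
          then show ?thesis using j by simp
        qed (use j in simp)
      qed
    next
      fix z assume "z \<in> {p (n - 1), p (n - 2)}"
      then show "z \<in> l (n - 1) \<inter> P'"
        using pl[of "n - 1" "n - 1"] pl[of "n - 1" "n - 2"] pP' n by auto
    qed
    show "{m \<in> L'. p (n - 2) \<in> m} = {l (n - 1), l (n - 2)}"
    proof (intro equalityI subsetI)
      fix m assume m: "m \<in> {m \<in> L'. p (n - 2) \<in> m}"
      have "p (n - 2) \<notin> P" using p_notin[of "n - 2"] n by simp
      then have "m \<notin> L" using sub m by blast
      then obtain j where j: "j < n" "j > 0" "m = l j" using m L'E by blast
      then have "j = n - 2 \<or> j = Suc (n - 2)" using pl[of j "n - 2"] m n by auto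
      then show "m \<in> {l (n - 1), l (n - 2)}" using j n(8) by auto
    next
      fix m assume "m \<in> {l (n - 1), l (n - 2)}"
      then show "m \<in> {m \<in> L'. p (n - 2) \<in> m}"
        using lL'[of "n - 1"] lL'[of "n - 2"] pl[of "n - 1" "n - 2"] pl[of "n - 2" "n - 2"] n by auto
    qed
    show "l (n - 1) \<noteq> l (n - 2)"
    proof
      assume "l (n - 1) = l (n - 2)"
      then have "n - 1 = n - 2" using l_inj n by blast
      then show False using n by simp
    qed
    show "p (n - 1) \<noteq> p 0" "p (n - 2) \<noteq> p (n - 1)" "p (n - 2) \<noteq> p 0"
      using inj[of "n - 1" 0] inj[of "n - 2" "n - 1"] inj[of "n - 2" 0] n by auto
  qed
  then have "buildable (P' \<union> (\<Union>i<n. l i)) (insert (l 0) L')"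
  proof (rule buildable_add_points[rotated])
    fix z m m' assume z: "z \<in> (\<Union>i<n. l i) - P'" and m: "m \<in> insert (l 0) L'" "m' \<in> insert (l 0) L'" "z \<in> m" "z \<in> m'"
    have "\<exists>j<n. k = l j" if "k \<in> insert (l 0) L'" "z \<in> k" for k
    proof -
      have "k \<notin> L" using sub that(2) z by (auto simp: P'_def)
      then show ?thesis using L'E that(1) n by blast
    qed
    then obtain i j where ij: "i < n" "j < n" "m = l i" "m' = l j" using m by metis
    have "i = j"
    proof (rule ccontr)
      assume "i \<noteq> j"
      then obtain k where "k < n" "z = p k" using c(5)[of i j z] ij m by blast
      then show False using pP' z by blast
    qed
    then show "m = m'" using ij by simp
  qed (use c(3) in auto)
  moreover have "P' \<union> (\<Union>i<n. l i) = P \<union> (\<Union>i<n. l i)"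
  proof -
    have "p j \<in> (\<Union>i<n. l i)" if "j < n" for j using c(4)[of j j] that by auto
    then have "P' \<subseteq> P \<union> (\<Union>i<n. l i)" using P'E by blast
    moreover have "P \<subseteq> P'" by (simp add: P'_def)
    ultimately show ?thesis by blast
  qed
  moreover have "insert (l 0) L' = L \<union> l ` {..<n}"
  proof -
    have "{..<n} = insert 0 {1..n - 1}" using n by auto
    then show ?thesis by (simp add: L'_def)
  qed
  ultimately show ?thesis by simp
qed

lemma cyclic_lines_image:
  assumes cyc: "cyclic_lines n p l" and g: "inj_on g U" "\<And>i. i < n \<Longrightarrow> l i \<subseteq> U"
  shows "cyclic_lines n (\<lambda>i. g (p i)) (\<lambda>i. g ` l i)"
proof -
  note c = cyclic_linesD[OF cyc]
  have pU: "p j \<in> U" if "j < n" for j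
    using c(4)[of j j] g(2)[of j] that by auto
  have mem: "g z \<in> g ` l i \<longleftrightarrow> z \<in> l i" if "z \<in> U" "i < n" for z i
    using inj_on_image_mem_iff[OF g(1) that(1) g(2)[OF that(2)]] .
  have "inj_on (\<lambda>i. g ` l i) {..<n}"
  proof (rule inj_onI)
    fix i j assume "i \<in> {..<n}" "j \<in> {..<n}" "g ` l i = g ` l j"
    then have "l i = l j" using inj_on_image_eq_iff[OF g(1)] g(2) by auto
    then show "i = j" using c(2) \<open>i \<in> {..<n}\<close> \<open>j \<in> {..<n}\<close> by (meson inj_onD)
  qed
  moreover have "\<exists>k<n. z = g (p k)" if ij: "i < n" "j < n" "z \<in> g ` l i" "z \<in> g ` l j" "i \<noteq> j" for i j z
  proof -
    obtain w where w: "w \<in> l i" "z = g w" using ij by auto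
    then have "w \<in> l j" using mem[of w j] g(2)[of i] ij by auto
    then show ?thesis using c(5)[of i j w] w ij by auto
  qed
  ultimately show ?thesis
    unfolding cyclic_lines_def using c(1,3) mem[OF pU] cyc by (auto simp: cyclic_lines_def)
qed

lemma cyclic_lines_rotate:
  assumes "cyclic_lines n p l"
  shows "cyclic_lines n (\<lambda>i. p ((i + r) mod n)) (\<lambda>i. l ((i + r) mod n))"
proof -
  note c = cyclic_linesD[OF assms]
  have n: "n > 0" using c(1) by auto
  have rot_inj: "i = j" if "i < n" "j < n" "(i + r) mod n = (j + r) mod n" for i j
  proof -
    have "i mod n = j mod n"
      using that(3) unfolding nat_mod_eq_iff by auto
    then show ?thesis using that by simp
  qed
  have 1: "inj_on (\<lambda>i. l ((i + r) mod n)) {..<n}"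
  proof (rule inj_onI)
    fix i j assume "i \<in> {..<n}" "j \<in> {..<n}" "l ((i + r) mod n) = l ((j + r) mod n)"
    then have "(i + r) mod n = (j + r) mod n" "i < n" "j < n"
      using inj_onD[OF c(2), of "(i + r) mod n" "(j + r) mod n"] n by simp_all
    then show "i = j" using rot_inj by blast
  qed
  have 2: "p ((j + r) mod n) \<in> l ((i + r) mod n) \<longleftrightarrow> i = j \<or> i = Suc j mod n" if "i < n" "j < n" for i j
  proof -
    have "p ((j + r) mod n) \<in> l ((i + r) mod n) \<longleftrightarrow>
        (i + r) mod n = (j + r) mod n \<or> (i + r) mod n = Suc ((j + r) mod n) mod n"
      using assms n by (simp add: cyclic_lines_def)
    also have "Suc ((j + r) mod n) mod n = (Suc j mod n + r) mod n"
      by (simp add: mod_simps)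
    finally show ?thesis
      using rot_inj[OF that] rot_inj[OF that(1) mod_less_divisor[OF n, of "Suc j"]] by blast
  qed
  have 3: "\<exists>k<n. z = p ((k + r) mod n)"
    if ij: "i < n" "j < n" "z \<in> l ((i + r) mod n)" "z \<in> l ((j + r) mod n)" "i \<noteq> j" for i j z
  proof -
    obtain k where k: "k < n" "z = p k"
      using c(5)[OF _ _ ij(3,4)] rot_inj[OF ij(1,2)] ij(5) mod_less_divisor[OF n] by blast
    \<comment> \<open>The index of \<open>k\<close> minus \<open>r\<close> modulo \<open>n\<close>,
      written so that subtraction does not truncate.\<close>
    have "((k + (n - r mod n)) mod n + r) mod n = (k + (n - r mod n) + r mod n) mod n"
      by (simp add: mod_simps)
    also have "k + (n - r mod n) + r mod n = k + n"
      using mod_less_divisor[OF n, of r] by linarith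
    also have "(k + n) mod n = k"
      using k(1) by simp
    finally show ?thesis
      using k n by (intro exI[of _ "(k + (n - r mod n)) mod n"]) auto
  qed
  show ?thesis
    by (rule cyclic_linesI[OF c(1) 1 c(3)[OF mod_less_divisor[OF n]] 2 3])
qed


section \<open>Lines of matroids\<close>

lemma lines_subset_ground: "l \<in> lines M \<Longrightarrow> l \<subseteq> ground M"
  by (simp add: lines_def collinear_set_def)

lemma collinear_imp_subset_line:
  assumes "finite (ground M)" "collinear_set M l"
  obtains l' where "l' \<in> lines M" "l \<subseteq> l'"
proof -
  have "finite {l'. collinear_set M l'}"
    by (rule finite_subset[of _ "Pow (ground M)"]) (use assms(1) in \<open>auto simp: collinear_set_def\<close>)
  then obtain l' where "l' \<in> {l'. collinear_set M l'}" "l \<subseteq> l'"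
    "\<And>k. k \<in> {l'. collinear_set M l'} \<Longrightarrow> l' \<subseteq> k \<Longrightarrow> l' = k"
    using finite_has_maximal2[of "{l'. collinear_set M l'}" l] assms(2) by blast
  then show ?thesis
    by (intro that[of l']) (auto simp: lines_def)
qed

lemma lines_line_matroid:
  assumes "line_matroid M"
  shows "lines M = (if card (ground M) \<ge> 3 then {ground M} else {})"
proof -
  have fin: "finite (ground M)" and indep: "\<And>S. indep M S \<longleftrightarrow> S \<subseteq> ground M \<and> card S \<le> 2"
    using assms by (auto simp: line_matroid_def)
  have coll: "collinear_set M l \<longleftrightarrow> l \<subseteq> ground M \<and> card l \<ge> 3" for l
    by (auto simp: collinear_set_def dependent_set_def indep)
  show ?thesis
  proof (cases "card (ground M) \<ge> 3")
    case True
    have "l \<in> lines M \<longleftrightarrow> l = ground M" for l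
      using True unfolding lines_def coll by auto
    then show ?thesis using True by auto
  next
    case False
    have "l \<notin> lines M" for l
    proof
      assume "l \<in> lines M"
      then have "l \<subseteq> ground M" "card l \<ge> 3" by (simp_all add: lines_def coll)
      then show False using card_mono[OF fin, of l] False by simp
    qed
    then show ?thesis using False by auto
  qed
qed

text \<open>An independent triple inside the union would extend \<open>{x, y}\<close> by a point of one of the lines.\<close>

lemma two_lines_meet_once:
  assumes simple: "simple_matroid M" and "l \<in> lines M" "m \<in> lines M" "l \<noteq> m"
    and xy: "x \<in> l" "x \<in> m" "y \<in> l" "y \<in> m"
  shows "x = y"
proof (rule ccontr)
  assume "x \<noteq> y"
  have coll: "collinear_set M l" "collinear_set M m"
    using assms(2,3) by (auto simp: lines_def)
  have grd: "l \<union> m \<subseteq> ground M"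
    using coll by (auto simp: collinear_set_def)
  have fin: "finite (ground M)"
    using simple by (simp add: simple_matroid_def is_matroid_def)
  have triple: False if "indep M T" "T \<subseteq> k" "card T = 3" "k = l \<or> k = m" for T k
    using coll that by (auto simp: collinear_set_def dependent_set_def)
  have "dependent_set M T" if T: "T \<subseteq> l \<union> m" "card T = 3" for T
  proof (rule ccontr)
    assume "\<not> dependent_set M T"
    then have "indep M T" using T grd by (auto simp: dependent_set_def)
    moreover have "x \<in> ground M" "y \<in> ground M" using grd xy by blast+
    then have "indep M {x, y}"
      using simple by (simp add: simple_matroid_def)
    moreover have "card {x, y} < card T"
      using T \<open>x \<noteq> y\<close> by simp
    ultimately obtain z where z: "z \<in> T - {x, y}" "indep M (insert z {x, y})"
      using simple unfolding simple_matroid_def is_matroid_def by blast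
    have "card (insert z {x, y}) = 3"
      using z(1) \<open>x \<noteq> y\<close> by simp
    then show False
      using triple[OF z(2), of l] triple[OF z(2), of m] z(1) T(1) xy by blast
  qed
  moreover have "3 \<le> card (l \<union> m)"
    using coll card_mono[of "l \<union> m" l] finite_subset[OF grd fin] by (auto simp: collinear_set_def)
  ultimately have "collinear_set M (l \<union> m)"
    using grd by (simp add: collinear_set_def)
  then have "l \<union> m = l" "l \<union> m = m"
    using assms(2,3) by (auto simp: lines_def)
  then show False using assms(4) by auto
qed

lemma cycle_matroid_cyclic_lines:
  assumes "bij_betw l {..<n} (lines M)" "finite (ground M)" "n \<ge> 3"
    and p: "\<And>i. i < n \<Longrightarrow> lines_through M (p i) = {l i, l (Suc i mod n)}"
    and other: "\<And>x. x \<in> ground M - p ` {..<n} \<Longrightarrow> card (lines_through M x) = 1"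
  shows "cyclic_lines n p l"
proof (rule cyclic_linesI[OF assms(3)])
  have n: "n > 0" using assms(3) by simp
  show inj: "inj_on l {..<n}"
    using assms(1) by (rule bij_betw_imp_inj_on)
  have l: "l i \<in> lines M" if "i < n" for i
    using assms(1) that by (auto simp: bij_betw_def)
  show "finite (l i)" if "i < n" for i
    using finite_subset[OF lines_subset_ground[OF l[OF that]] assms(2)] .
  have l_eq: "l i = l j \<longleftrightarrow> i = j" if "i < n" "j < n" for i j
    using inj that by (simp add: inj_on_eq_iff)
  show "p j \<in> l i \<longleftrightarrow> i = j \<or> i = Suc j mod n" if "i < n" "j < n" for i j
  proof -
    have "p j \<in> l i \<longleftrightarrow> l i \<in> lines_through M (p j)"
      using l[OF that(1)] by (simp add: lines_through_def)
    then show ?thesis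
      using p[OF that(2)] l_eq[OF that] l_eq[OF that(1) mod_less_divisor[OF n]] by simp
  qed
  show "\<exists>k<n. z = p k" if ij: "i < n" "j < n" "z \<in> l i" "z \<in> l j" "i \<noteq> j" for i j z
  proof (rule ccontr)
    assume "\<not> (\<exists>k<n. z = p k)"
    then have "card (lines_through M z) = 1"
      using lines_subset_ground[OF l[OF ij(1)]] ij(3) by (intro other) auto
    moreover have "l i \<in> lines_through M z" "l j \<in> lines_through M z"
      using l ij by (auto simp: lines_through_def)
    ultimately have "l i = l j"
      by (metis card_1_singletonE singletonD)
    then show False using l_eq ij by blast
  qed
qed

text \<open>Finds the rotation under which \<open>x\<close> can serve as attaching point: a vertex
  \<open>p k\<close> is placed on the line after it, of which it is the first vertex and not the
  last; any other point is no vertex at all.\<close>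

lemma cyclic_lines_through:
  assumes cyc: "cyclic_lines n p l" and "j < n" "x \<in> l j"
  obtains r where "x \<in> l ((1 + r) mod n)" "x \<noteq> p ((1 + r) mod n)"
proof -
  note c = cyclic_linesD[OF cyc]
  have n: "n > 0" "1 < n" using c(1) by auto
  show ?thesis
  proof (cases "\<exists>k<n. x = p k")
    case True
    then obtain k where k: "k < n" "x = p k" by blast
    have "Suc k mod n \<noteq> k"
      using k(1) n by (auto simp: mod_Suc)
    then have "p k \<noteq> p (Suc k mod n)"
      using cyclic_lines_inj[OF cyc k(1) mod_less_divisor[OF n(1), of "Suc k"]] by auto
    moreover have "p k \<in> l (Suc k mod n)"
      using cyc k(1) n by (simp add: cyclic_lines_def)
    ultimately show ?thesis
      using k(2) by (intro that[of k]) auto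
  next
    case False
    have "(1 + (j + n - 1)) mod n = j"
      using n assms(2) by simp
    then show ?thesis
      using that[of "j + n - 1"] assms False by simp
  qed
qed

text \<open>As in a free gluing, the block shares exactly one point with what is already
  built.\<close>

lemma buildable_add_block:
  assumes N: "line_matroid N \<or> cycle_matroid N" and q: "q \<in> ground N" and g: "inj_on g (ground N)"
    and bld: "buildable P L" and sub: "\<And>l. l \<in> L \<Longrightarrow> l \<subseteq> P" and meet: "g ` ground N \<inter> P = {g q}"
  shows "buildable (P \<union> g ` ground N) (L \<union> (`) g ` lines N)"
proof -
  have meet': "z = g q" if "z \<in> g ` ground N" "z \<in> P" for z
    using that meet by (metis IntI singletonD)
  show ?thesis
    using N
  proof
    assume line: "line_matroid N"
    then have fin: "finite (g ` ground N)"
      by (simp add: line_matroid_def)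
    show ?thesis
    proof (cases "card (ground N) \<ge> 3")
      case True
      have "buildable (P \<union> g ` ground N) (insert (g ` ground N) L)"
      proof (rule buildable_add_line[OF bld fin sub])
        show "x = y" if "x \<in> P" "y \<in> P" "x \<in> g ` ground N" "y \<in> g ` ground N" for x y
          using meet' that by metis
      qed
      then show ?thesis
        using lines_line_matroid[OF line] True by simp
    next
      case False
      have "buildable (P \<union> g ` ground N) L"
        by (rule buildable_add_points[OF fin bld]) (use sub in blast)
      then show ?thesis
        using lines_line_matroid[OF line] False by simp
    qed
  next
    assume cycle: "cycle_matroid N"
    then have simple: "simple_matroid N"
      by (simp add: cycle_matroid_def)
    then have fin: "finite (ground N)"
      by (simp add: simple_matroid_def is_matroid_def)
    obtain n p l where bij: "bij_betw l {..<n} (lines N)"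
      and p: "\<And>i. i < n \<Longrightarrow> p i \<in> ground N" "\<And>i. i < n \<Longrightarrow> lines_through N (p i) = {l i, l (Suc i mod n)}"
      and other: "\<And>x. x \<in> ground N - p ` {..<n} \<Longrightarrow> card (lines_through N x) = 1"
      using cycle unfolding cycle_matroid_def by (elim conjE exE) blast
    have lines_eq: "lines N = l ` {..<n}"
      using bij by (simp add: bij_betw_def)
    have on_line: "\<exists>i<n. x \<in> l i" if "x \<in> ground N" for x
    proof -
      have "lines_through N x \<noteq> {}"
        using that p(2) other[of x] by (cases "x \<in> p ` {..<n}") auto
      then show ?thesis
        by (auto simp: lines_through_def lines_eq)
    qed
    have l_sub: "l i \<subseteq> ground N" if "i < n" for i
      using lines_subset_ground[of "l i" N] lines_eq that by blast
    have ground_eq: "ground N = (\<Union>i<n. l i)"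
      using on_line l_sub by blast
    have fin_l: "finite (g ` l i)" if "i < n" for i
      using finite_subset[OF l_sub[OF that] fin] by simp
    \<comment> \<open>The cycle condition also admits one or two lines; these cases are built
      without the closing step, which needs three lines.\<close>
    have "n \<noteq> 0" using on_line[OF q] by auto
    then consider "n = 1" | "n = 2" | "n \<ge> 3" by linarith
    then show ?thesis
    proof cases
      case 1
      then have eq: "ground N = l 0" "lines N = {l 0}"
        using ground_eq lines_eq by auto
      have "buildable (P \<union> g ` l 0) (insert (g ` l 0) L)"
      proof (rule buildable_add_line[OF bld fin_l sub])
        show "x = y" if "x \<in> P" "y \<in> P" "x \<in> g ` l 0" "y \<in> g ` l 0" for x y
          using meet' that eq by metis
      qed (use 1 in simp)
      then show ?thesis using eq by simp
    next
      case 2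
      have "{..<n} = {0, 1}" using 2 by auto
      then have eq: "ground N = l 0 \<union> l 1" "lines N = {l 0, l 1}"
        using ground_eq lines_eq by auto
      have "l 0 \<noteq> l 1"
        using inj_onD[OF bij_betw_imp_inj_on[OF bij], of 0 1] 2 by auto
      obtain i j where ij: "i < n" "j < n" "l i \<noteq> l j" "q \<in> l i" "{l i, l j} = {l 0, l 1}"
      proof (cases "q \<in> l 0")
        case True
        then show ?thesis using that[of 0 1] 2 \<open>l 0 \<noteq> l 1\<close> by simp
      next
        case False
        then show ?thesis using that[of 1 0] 2 \<open>l 0 \<noteq> l 1\<close> q eq by auto
      qed
      have union: "g ` ground N = g ` l i \<union> g ` l j"
        using ij(5) unfolding eq by (metis Union_insert Un_empty_right Union_empty image_Un)
      have g_mem: "g z \<in> g ` l j \<longleftrightarrow> z \<in> l j" if "z \<in> l i" for z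
        using inj_on_image_mem_iff[OF g _ l_sub[OF ij(2)]] l_sub[OF ij(1)] that by blast
      have "buildable (P \<union> (g ` l i \<union> g ` l j)) (L \<union> {g ` l i, g ` l j})"
      proof (rule buildable_add_two_lines[OF bld fin_l[OF ij(1)] fin_l[OF ij(2)] sub])
        show "(g ` l i \<union> g ` l j) \<inter> P \<subseteq> {g q}" using meet union by simp
        show "g q \<in> g ` l i" using ij(4) by simp
        fix x y assume "x \<in> g ` l i" "x \<in> g ` l j" "y \<in> g ` l i" "y \<in> g ` l j"
        then obtain x' y' where "x = g x'" "y = g y'" "x' \<in> l i" "y' \<in> l i" "x' \<in> l j" "y' \<in> l j"
          using g_mem by blast
        then show "x = y"
          using two_lines_meet_once[OF simple _ _ ij(3), of x' y'] lines_eq ij(1,2) by blast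
      qed
      moreover have "{g ` l i, g ` l j} = (`) g ` lines N"
        unfolding eq(2) ij(5)[symmetric] by simp
      ultimately show ?thesis by (simp only: union)
    next
      case 3
      have cyc: "cyclic_lines n p l"
        by (rule cycle_matroid_cyclic_lines[OF bij fin 3 p(2) other])
      obtain j where j: "j < n" "q \<in> l j" using on_line[OF q] by blast
      obtain r where r: "q \<in> l ((1 + r) mod n)" "q \<noteq> p ((1 + r) mod n)"
        using cyclic_lines_through[OF cyc j] .
      define p' l' where "p' i = p ((i + r) mod n)" and "l' i = l ((i + r) mod n)" for i
      have n: "n > 0" using 3 by simp
      have "cyclic_lines n p' l'"
        using cyclic_lines_rotate[OF cyc, of r] by (simp add: p'_def[abs_def] l'_def[abs_def])
      moreover have l'_sub: "l' i \<subseteq> ground N" for i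
        using l_sub n by (simp add: l'_def)
      ultimately have cyc': "cyclic_lines n (\<lambda>i. g (p' i)) (\<lambda>i. g ` l' i)"
        using cyclic_lines_image[OF _ g] by blast
      have "inj_on l' {..<n}"
        using cyclic_linesD(2)[OF \<open>cyclic_lines n p' l'\<close>] .
      then have "card (l' ` {..<n}) = card (lines N)"
        using bij by (simp add: card_image lines_eq bij_betw_def)
      moreover have "l' ` {..<n} \<subseteq> lines N"
        using n by (auto simp: l'_def lines_eq)
      ultimately have l'_lines: "l' ` {..<n} = lines N"
        by (intro card_subset_eq) (auto simp: lines_eq)
      have "buildable (P \<union> (\<Union>i<n. g ` l' i)) (L \<union> (\<lambda>i. g ` l' i) ` {..<n})"
      proof (rule buildable_add_cycle[OF cyc' bld sub, where x = "g q"])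
        show "z = g q" if "z \<in> g ` l' i" "z \<in> P" for i z
          using meet' that l'_sub[of i] by blast
        show "g q \<in> g ` l' 1" using r(1) by (simp add: l'_def)
        have "p' 1 \<in> ground N" using p(1) n by (simp add: p'_def)
        moreover have "q \<noteq> p' 1" using r(2) by (simp add: p'_def)
        ultimately show "g q \<noteq> g (p' 1)"
          using inj_onD[OF g, of q "p' 1"] q by blast
      qed
      moreover have "(\<Union>i<n. g ` l' i) = g ` ground N"
      proof -
        have "(\<Union>i<n. g ` l' i) = g ` (\<Union>(l' ` {..<n}))" by blast
        also have "\<Union>(l' ` {..<n}) = ground N"
          unfolding l'_lines ground_eq lines_eq by blast
        finally show ?thesis .
      qed
      moreover have "(\<lambda>i. g ` l' i) ` {..<n} = (`) g ` lines N"
        unfolding l'_lines[symmetric] by (simp add: image_image)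
      ultimately show ?thesis by simp
    qed
  qed
qed

text \<open>Any point of the block is first put down as an isolated point, which reduces this to the
  glued case.\<close>

lemma buildable_add_disjoint_block:
  assumes N: "line_matroid N \<or> cycle_matroid N" and g: "inj_on g (ground N)"
    and bld: "buildable P L" and sub: "\<And>l. l \<in> L \<Longrightarrow> l \<subseteq> P" and disj: "g ` ground N \<inter> P = {}"
  shows "buildable (P \<union> g ` ground N) (L \<union> (`) g ` lines N)"
proof (cases "ground N = {}")
  case True
  have "l \<notin> lines N" for l
  proof
    assume "l \<in> lines N"
    moreover from this have "l = {}" using lines_subset_ground[of l N] True by simp
    ultimately show False by (simp add: lines_def collinear_set_def)
  qed
  then have "lines N = {}" by blast
  then show ?thesis using True bld by simp
next
  case False
  then obtain q where q: "q \<in> ground N" by blast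
  have "g q \<notin> P" using q disj by blast
  then have "buildable (insert (g q) P) L"
    by (intro buildable.point[OF bld]) (use sub in blast)+
  then have "buildable (insert (g q) P \<union> g ` ground N) (L \<union> (`) g ` lines N)"
    by (rule buildable_add_block[OF N q g]) (use sub disj q in blast)+
  moreover have "insert (g q) P \<union> g ` ground N = P \<union> g ` ground N" using q by blast
  ultimately show ?thesis by simp
qed

text \<open>The embedding \<open>h\<close> is left arbitrary in the induction, because a part of a
  gluing sits in \<open>K\<close> only after relabelling by \<open>f\<close>.\<close>

lemma buildable_add_connected_cactus:
  assumes "connected_cactus K" "inj_on h (ground K)" "buildable P L" "\<And>l. l \<in> L \<Longrightarrow> l \<subseteq> P"
    and "h ` ground K \<inter> P = {}"
  shows "buildable (P \<union> h ` ground K) (L \<union> (`) h ` lines K)"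
  using assms(1,2,5)
proof (induction arbitrary: h rule: connected_cactus.induct)
  case (line M)
  then show ?case using assms(3,4) by (intro buildable_add_disjoint_block) simp_all
next
  case (cycle M)
  then show ?case using assms(3,4) by (intro buildable_add_disjoint_block) simp_all
next
  case (glue M N p q K)
  obtain f g where q: "q \<in> ground N" and f: "inj_on f (ground M)" and g: "inj_on g (ground N)" "f p = g q"
    "f ` ground M \<inter> g ` ground N = {f p}" "ground K = f ` ground M \<union> g ` ground N"
    "lines K = (\<lambda>l. f ` l) ` lines M \<union> (\<lambda>l. g ` l) ` lines N"
    using glue.hyps(3) unfolding free_gluing_def by blast
  have sub: "f ` ground M \<subseteq> ground K" "g ` ground N \<subseteq> ground K" using g(4) by blast+
  have hf: "inj_on (h \<circ> f) (ground M)" and hg: "inj_on (h \<circ> g) (ground N)"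
    using comp_inj_on[OF f inj_on_subset[OF glue.prems(1) sub(1)]]
      comp_inj_on[OF g(1) inj_on_subset[OF glue.prems(1) sub(2)]] .
  have disj: "(h \<circ> f) ` ground M \<inter> P = {}" "(h \<circ> g) ` ground N \<inter> P = {}"
    using glue.prems(2) sub unfolding image_comp[symmetric] by blast+
  have "h ` (g ` ground N) \<inter> h ` (f ` ground M) = {h (g q)}"
    using inj_on_image_Int[OF glue.prems(1) sub(2,1)] g(2,3) by (simp add: Int_commute)
  then have meet: "(h \<circ> g) ` ground N \<inter> (P \<union> (h \<circ> f) ` ground M) = {(h \<circ> g) q}"
    using disj(2) by (simp add: image_comp Int_Un_distrib)
  have "buildable (P \<union> (h \<circ> f) ` ground M \<union> (h \<circ> g) ` ground N)
      (L \<union> (`) (h \<circ> f) ` lines M \<union> (`) (h \<circ> g) ` lines N)"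
  proof (rule buildable_add_block[OF glue.hyps(2) q hg glue.IH[OF hf disj(1)] _ meet])
    fix l assume "l \<in> L \<union> (`) (h \<circ> f) ` lines M"
    then show "l \<subseteq> P \<union> (h \<circ> f) ` ground M"
      using assms(4) lines_subset_ground[of _ M] by blast
  qed
  moreover have "P \<union> (h \<circ> f) ` ground M \<union> (h \<circ> g) ` ground N = P \<union> h ` ground K"
    unfolding g(4) by (simp add: image_Un image_comp Un_assoc)
  moreover have "L \<union> (`) (h \<circ> f) ` lines M \<union> (`) (h \<circ> g) ` lines N = L \<union> (`) h ` lines K"
    unfolding g(5) by (simp add: image_Un image_image image_comp Un_assoc)
  ultimately show ?case by simp
qed

text \<open>A collinear set inside \<open>C\<close> extends to a line of \<open>M\<close>, and this
  line cannot leave \<open>C\<close>; hence maximality inside \<open>C\<close> and in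
  \<open>M\<close> agree.\<close>

lemma lines_restrict_matroid:
  assumes "finite (ground M)" "\<And>l. l \<in> lines M \<Longrightarrow> l \<inter> C \<noteq> {} \<Longrightarrow> l \<subseteq> C"
  shows "lines (restrict_matroid M C) = {l \<in> lines M. l \<subseteq> C}"
proof -
  have coll: "collinear_set (restrict_matroid M C) l \<longleftrightarrow> collinear_set M l \<and> l \<subseteq> C" for l
    by (auto simp: collinear_set_def restrict_matroid_def dependent_set_def)
  show ?thesis
  proof (intro equalityI subsetI)
    fix l assume l: "l \<in> lines (restrict_matroid M C)"
    then have cl: "collinear_set M l" "l \<subseteq> C"
      by (auto simp: lines_def coll)
    obtain l' where l': "l' \<in> lines M" "l \<subseteq> l'"
      using collinear_imp_subset_line[OF assms(1) cl(1)] .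
    have "l \<noteq> {}" using cl(1) by (auto simp: collinear_set_def)
    then have "l' \<subseteq> C" using assms(2) l' cl(2) by blast
    then have "l' = l" using l l' by (auto simp: lines_def coll)
    then show "l \<in> {l \<in> lines M. l \<subseteq> C}" using l' cl(2) by simp
  qed (auto simp: lines_def coll)
qed

theorem cactus_buildable:
  assumes "cactus_configuration M"
  shows "buildable (ground M) (lines M)"
proof -
  let ?R = "{(x, y) \<in> ground M \<times> ground M. (x, y) \<in> (on_common_line M)\<^sup>*}"
  have fin: "finite (ground M)"
    using assms by (simp add: cactus_configuration_def simple_matroid_def is_matroid_def)
  have "sym (on_common_line M)"
    by (auto simp: sym_def on_common_line_def)
  then have "equiv (ground M) ?R"
    using sym_rtrancl[of "on_common_line M"]
    by (intro equivI) (auto simp: refl_on_def sym_def trans_def intro: rtrancl_trans)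
  note eq = this
  have closed: "l \<subseteq> C" if C: "C \<in> connected_components M" and l: "l \<in> lines M" "l \<inter> C \<noteq> {}" for C l
  proof
    fix y assume "y \<in> l"
    obtain x where x: "x \<in> l" "x \<in> C" using l(2) by blast
    have "(x, y) \<in> on_common_line M"
      using x \<open>y \<in> l\<close> l(1) by (auto simp: on_common_line_def)
    then have "(x, y) \<in> ?R"
      using x \<open>y \<in> l\<close> lines_subset_ground[OF l(1)] by auto
    then show "y \<in> C"
      using C x(2) in_quotient_imp_closed[OF eq] unfolding connected_components_def by blast
  qed
  have disj: "C = D \<or> C \<inter> D = {}" if "C \<in> connected_components M" "D \<in> connected_components M" for C D
    using quotient_disj[OF eq] that unfolding connected_components_def by blast
  have Un: "\<Union>(connected_components M) = ground M"
    using Union_quotient[OF eq] by (simp add: connected_components_def)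
  have fin_comps: "finite (connected_components M)"
    using Un fin by (metis finite_UnionD)
  have sub: "C \<subseteq> ground M" if "C \<in> connected_components M" for C
    using Un that by blast
  have nonempty: "l \<noteq> {}" if "l \<in> lines M" for l
    using that by (auto simp: lines_def collinear_set_def)
  have "buildable (\<Union>S) {l \<in> lines M. \<exists>C\<in>S. l \<subseteq> C}" if "S \<subseteq> connected_components M" for S
    using finite_subset[OF that fin_comps] that
  proof (induction rule: finite_induct)
    case empty
    then show ?case by (simp add: buildable.empty)
  next
    case (insert C S)
    have C: "C \<in> connected_components M" "S \<subseteq> connected_components M" using insert.prems by auto
    have disjC: "D \<inter> C = {}" if "D \<in> S" for D
      using disj[OF C(1), of D] C(2) that insert.hyps(2) by blast
    have cactus: "connected_cactus (restrict_matroid M C)"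
      using assms C(1) by (simp add: cactus_configuration_def)
    have ground_C: "ground (restrict_matroid M C) = C"
      using sub[OF C(1)] by (auto simp: restrict_matroid_def)
    have "buildable (\<Union>S \<union> id ` ground (restrict_matroid M C))
        ({l \<in> lines M. \<exists>C\<in>S. l \<subseteq> C} \<union> (`) id ` lines (restrict_matroid M C))"
      by (rule buildable_add_connected_cactus[OF cactus _ insert.IH[OF C(2)]])
         (use disjC in \<open>auto simp: ground_C\<close>)
    then have "buildable (C \<union> \<Union>S) ({l \<in> lines M. l \<subseteq> C} \<union> {l \<in> lines M. \<exists>C\<in>S. l \<subseteq> C})"
      using lines_restrict_matroid[OF fin closed[OF C(1)]] by (simp add: ground_C Un_commute)
    moreover have "{l \<in> lines M. l \<subseteq> C} \<union> {l \<in> lines M. \<exists>C\<in>S. l \<subseteq> C} = {l \<in> lines M. \<exists>D\<in>insert C S. l \<subseteq> D}"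
      by blast
    ultimately show ?case by simp
  qed
  from this[OF subset_refl] have "buildable (ground M) {l \<in> lines M. \<exists>C\<in>connected_components M. l \<subseteq> C}"
    by (simp add: Un)
  moreover have "\<exists>C\<in>connected_components M. l \<subseteq> C" if l: "l \<in> lines M" for l
  proof -
    obtain x where "x \<in> l" using nonempty[OF l] by blast
    then obtain C where "C \<in> connected_components M" "x \<in> C"
      using Un lines_subset_ground[OF l] by blast
    then show ?thesis using closed[of C l] l \<open>x \<in> l\<close> by blast
  qed
  then have "{l \<in> lines M. \<exists>C\<in>connected_components M. l \<subseteq> C} = lines M" by blast
  ultimately show ?thesis by simp
qed

section \<open>Realizations in terms of brackets\<close>

definition of_columns :: "('n \<Rightarrow> complex^3) \<Rightarrow> complex^'n::finite^3" where
  "of_columns y = (\<chi> i j. y j $ i)"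

lemma column_of_columns [simp]: "column j (of_columns y) = y j"
  by (simp add: of_columns_def column_def vec_eq_iff)

lemma of_columns_column [simp]: "of_columns (\<lambda>j. column j A) = A"
  by (simp add: of_columns_def column_def vec_eq_iff)

lemma eval_poly_generic_matrix [simp]: "eval_poly (generic_matrix $ i $ j) A = A $ i $ j"
  by (simp add: generic_matrix_def)

lemma eval_poly_bracket [simp]:
  "eval_poly (bracket i j k) A = dot (crs (column i A) (column j A)) (column k A)"
  unfolding bracket_def det_3
  by (simp add: transpose_def dot_def column_def algebra_simps)

text \<open>The meet of the lines \<open>p1 p2\<close> and \<open>p3 p4\<close>: the combination of
  \<open>y p3\<close> and \<open>y p4\<close> whose bracket with \<open>y p1\<close> and
  \<open>y p2\<close> vanishes.\<close>

definition gc_vector :: "('n \<Rightarrow> complex^3) \<Rightarrow> 'n \<Rightarrow> 'n \<Rightarrow> 'n \<Rightarrow> 'n \<Rightarrow> complex^3" where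
  "gc_vector y p1 p2 p3 p4 =
     dot (crs (y p1) (y p2)) (y p3) *s y p4 - dot (crs (y p1) (y p2)) (y p4) *s y p3"

lemma eval_poly_gc_vector:
  "(\<chi> i. eval_poly ((bracket p1 p2 p3 *s generic_column p4 - bracket p1 p2 p4 *s generic_column p3) $ i)
      (of_columns y)) = gc_vector y p1 p2 p3 p4"
  by (simp add: vec_eq_iff gc_vector_def of_columns_def column_def)

definition gc_step :: "'n::finite matroid \<Rightarrow> ('n \<Rightarrow> complex^3) \<Rightarrow> 'n \<Rightarrow> complex^3 \<Rightarrow> bool" where
  "gc_step M y x v \<longleftrightarrow> (\<exists>l1 l2 p1 p2 p3 p4. v = gc_vector y p1 p2 p3 p4 \<and>
        l1 \<in> lines_through M x \<and> l2 \<in> lines_through M x \<and> l1 \<noteq> l2 \<and>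
        p1 \<in> l1 \<and> p2 \<in> l1 \<and> p1 \<noteq> p2 \<and> p3 \<in> l2 \<and> p4 \<in> l2 \<and> p3 \<noteq> p4)"

lemma eval_poly_replace_columns_of_columns:
  "eval_poly (replace_columns s P) (of_columns y) =
     eval_poly P (of_columns (\<lambda>j. \<chi> i. eval_poly (s j $ i) (of_columns y)))"
  by (simp add: eval_poly_replace_columns of_columns_def)

lemma grassmann_cayley_vectors_eval:
  assumes "s \<in> grassmann_cayley_vectors M x"
  shows "gc_step M y x (\<chi> i. eval_poly (s $ i) (of_columns y))"
proof -
  obtain l1 l2 p1 p2 p3 p4 where
    s: "s = bracket p1 p2 p3 *s generic_column p4 - bracket p1 p2 p4 *s generic_column p3"
    and *: "l1 \<in> lines_through M x" "l2 \<in> lines_through M x" "l1 \<noteq> l2" "p1 \<in> l1" "p2 \<in> l1"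
      "p1 \<noteq> p2" "p3 \<in> l2" "p4 \<in> l2" "p3 \<noteq> p4"
    using assms unfolding grassmann_cayley_vectors_def by blast
  show ?thesis
    unfolding gc_step_def s eval_poly_gc_vector by (intro exI conjI) (rule refl *)+
qed

lemma gc_step_imp_grassmann_cayley_vectors:
  assumes "gc_step M y x v"
  obtains s where "s \<in> grassmann_cayley_vectors M x" "(\<chi> i. eval_poly (s $ i) (of_columns y)) = v"
proof -
  obtain l1 l2 p1 p2 p3 p4 where v: "v = gc_vector y p1 p2 p3 p4"
    and *: "l1 \<in> lines_through M x" "l2 \<in> lines_through M x" "l1 \<noteq> l2" "p1 \<in> l1" "p2 \<in> l1"
      "p1 \<noteq> p2" "p3 \<in> l2" "p4 \<in> l2" "p3 \<noteq> p4"
    using assms unfolding gc_step_def by blast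
  let ?s = "bracket p1 p2 p3 *s generic_column p4 - bracket p1 p2 p4 *s generic_column p3"
  have "?s \<in> grassmann_cayley_vectors M x"
    unfolding grassmann_cayley_vectors_def by (intro CollectI exI conjI) (rule refl *)+
  then show ?thesis
    using eval_poly_gc_vector that unfolding v by blast
qed

lemma eval_poly_generic_column: "(\<chi> i. eval_poly (generic_column x $ i) (of_columns y)) = y x"
  by (simp add: vec_eq_iff column_def of_columns_def)

definition gc_zero :: "'n::finite matroid \<Rightarrow> ('n \<Rightarrow> complex^3) \<Rightarrow> bool" where
  "gc_zero M y \<longleftrightarrow> (\<forall>m. \<forall>P\<in>grassmann_cayley_set M m. eval_poly P (of_columns y) = 0)"

text \<open>The value of \<open>P\<close> at the moved configuration is the value of a replacement
  of \<open>P\<close> at the old one, and that replacement is a generator of the next stage.\<close>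

lemma gc_zero_step:
  assumes "gc_zero M y" "gc_step M y x v"
  shows "gc_zero M (y(x := v))"
  unfolding gc_zero_def
proof (intro allI ballI)
  fix m P assume P: "P \<in> grassmann_cayley_set M m"
  obtain t where t: "t \<in> grassmann_cayley_vectors M x" "(\<chi> i. eval_poly (t $ i) (of_columns y)) = v"
    using gc_step_imp_grassmann_cayley_vectors[OF assms(2)] .
  define s where "s = generic_column(x := t)"
  have "(\<lambda>j. \<chi> i. eval_poly (s j $ i) (of_columns y)) = y(x := v)"
    using t(2) by (auto simp: fun_eq_iff s_def eval_poly_generic_column)
  then have "eval_poly (replace_columns s P) (of_columns y) = eval_poly P (of_columns (y(x := v)))"
    by (simp add: eval_poly_replace_columns_of_columns)
  moreover have "replace_columns s P \<in> grassmann_cayley_set M (Suc m)"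
  proof -
    have "\<forall>z. s z = generic_column z \<or> s z \<in> grassmann_cayley_vectors M z"
      using t(1) by (simp add: s_def)
    then show ?thesis using P by auto
  qed
  ultimately show "eval_poly P (of_columns (y(x := v))) = 0"
    using assms(1) unfolding gc_zero_def by metis
qed

text \<open>Induction over the stages in terms of configurations: a set closed under simultaneous
  replacements, on which the initial brackets vanish, consists of common zeros.\<close>

lemma gc_zero_if_invariant:
  assumes "\<And>y. y \<in> W \<Longrightarrow> (\<forall>P\<in>grassmann_cayley_set M 0. eval_poly P (of_columns y) = 0)"
    and "\<And>y y'. y \<in> W \<Longrightarrow> (\<And>x. y' x = y x \<or> gc_step M y x (y' x)) \<Longrightarrow> y' \<in> W"
    and "y \<in> W"
  shows "gc_zero M y"
proof -
  have "\<forall>y\<in>W. \<forall>P\<in>grassmann_cayley_set M m. eval_poly P (of_columns y) = 0" for m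
  proof (induction m)
    case 0
    then show ?case using assms(1) by blast
  next
    case (Suc m)
    show ?case
    proof (intro ballI)
      fix y Q assume y: "y \<in> W" and "Q \<in> grassmann_cayley_set M (Suc m)"
      then obtain s P where s: "Q = replace_columns s P" "P \<in> grassmann_cayley_set M m"
        "\<And>x. s x = generic_column x \<or> s x \<in> grassmann_cayley_vectors M x" by auto
      define y' where "y' = (\<lambda>j. \<chi> i. eval_poly (s j $ i) (of_columns y))"
      have "y' x = y x \<or> gc_step M y x (y' x)" for x
        using s(3)[of x] grassmann_cayley_vectors_eval[of "s x" M x y] eval_poly_generic_column[of x y]
        by (auto simp: y'_def)
      then have "y' \<in> W" using assms(2) y by blast
      then show "eval_poly Q (of_columns y) = 0"
        using Suc.IH s by (simp add: eval_poly_replace_columns_of_columns y'_def)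
    qed
  qed
  then show ?thesis using assms(3) by (simp add: gc_zero_def)
qed

section \<open>Linear dependence of families of vectors expressed by cross products and
  brackets\<close>

lemma dependent_family_card_4:
  assumes "finite S" "card S > 3"
  shows "dependent_family y S"
proof (rule ccontr)
  assume "\<not> dependent_family y S"
  then have "inj_on y S" "vec.independent (y ` S)"
    by (auto simp: dependent_family_def)
  then have "card S \<le> vec.dim (UNIV :: (complex^3) set)"
    using vec.independent_card_le_dim[of "y ` S" UNIV] by (simp only: card_image subset_UNIV simp_thms)
  then show False using assms(2) unfolding vec_dim_card by simp
qed

lemma dependent_family_triple:
  assumes "i \<noteq> j" "j \<noteq> k" "i \<noteq> k"
  shows "dependent_family y {i, j, k} \<longleftrightarrow> dot (crs (y i) (y j)) (y k) = 0"
proof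
  assume dep: "dependent_family y {i, j, k}"
  show "dot (crs (y i) (y j)) (y k) = 0"
  proof (rule ccontr)
    assume nz: "dot (crs (y i) (y j)) (y k) \<noteq> 0"
    then have crs_nz: "crs (y i) (y j) \<noteq> 0" by auto
    then have "y i \<noteq> 0" by auto
    have "y i \<noteq> y j" "y k \<noteq> y i" "y k \<noteq> y j"
      using nz crs_nz by auto
    then have "inj_on y {i, j, k}" using assms by auto
    have i: "vec.independent {y i}"
      using \<open>y i \<noteq> 0\<close> by (simp add: vec.dependent_single)
    have j: "y j \<notin> vec.span {y i}"
      using crs_nz by (auto simp: vec.span_singleton crs_linear)
    have k: "y k \<notin> vec.span {y j, y i}"
    proof
      assume "y k \<in> vec.span {y j, y i}"
      then obtain s where "y k - s *s y j \<in> vec.span {y i}"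
        using vec.span_breakdown_eq by blast
      then obtain t where "y k - s *s y j = t *s y i" by (auto simp: vec.span_singleton)
      then have "y k = t *s y i + s *s y j" by (simp add: algebra_simps)
      then show False using nz by simp
    qed
    have "vec.independent {y k, y j, y i}"
      by (rule vec.independent_insertI[OF k vec.independent_insertI[OF j i]])
    moreover have "y ` {i, j, k} = {y k, y j, y i}" by auto
    ultimately show False
      using dep \<open>inj_on y {i, j, k}\<close> by (simp add: dependent_family_def)
  qed
next
  assume zero: "dot (crs (y i) (y j)) (y k) = 0"
  show "dependent_family y {i, j, k}"
  proof (rule ccontr)
    assume "\<not> dependent_family y {i, j, k}"
    then have "inj_on y {i, j, k}" and indep: "vec.independent (y ` {i, j, k})"
      by (auto simp: dependent_family_def)
    then have neq: "y i \<noteq> y j" "y k \<noteq> y i" "y k \<noteq> y j"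
      using assms by auto
    have indep: "vec.independent {y i, y j, y k}" using indep by simp
    have "y i \<noteq> 0"
      using indep vec.dependent_zero[of "{y i, y j, y k}"] by auto
    have "crs (y i) (y j) \<noteq> 0"
    proof
      assume "crs (y i) (y j) = 0"
      then obtain c where "y j = c *s y i"
        using crs_eq_0_iff[OF \<open>y i \<noteq> 0\<close>] crs_swap_eq_0 by blast
      then have "y j \<in> vec.span {y i}" by (auto simp: vec.span_singleton)
      then have "y j \<in> vec.span ({y i, y j, y k} - {y j})"
        by (rule subsetD[OF vec.span_mono, rotated]) (use neq in auto)
      then show False using indep unfolding vec.dependent_def by blast
    qed
    then obtain s t where "y k = s *s y i + t *s y j"
      using span_pair_if_dot_crs_eq_0 zero by blast
    then have "y k \<in> vec.span {y i, y j}"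
      by (simp add: vec.span_add vec.span_scale vec.span_base)
    then have "y k \<in> vec.span ({y i, y j, y k} - {y k})"
      by (rule subsetD[OF vec.span_mono, rotated]) (use neq in auto)
    then show False using indep unfolding vec.dependent_def by blast
  qed
qed

lemma independent_pair_if_crs_nonzero:
  assumes "crs (y i) (y j) \<noteq> 0"
  shows "\<not> dependent_family y {i, j}"
proof -
  have "y i \<noteq> 0" "y i \<noteq> y j" using assms by auto
  moreover have j: "y j \<notin> vec.span {y i}"
    using assms by (auto simp: vec.span_singleton crs_linear)
  have i: "vec.independent {y i}"
    using \<open>y i \<noteq> 0\<close> by (simp add: vec.dependent_single)
  have "vec.independent {y j, y i}"
    by (rule vec.independent_insertI[OF j i])
  ultimately show ?thesis
    by (auto simp: dependent_family_def insert_commute)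
qed

lemma dependent_family_single: "dependent_family y {i} \<longleftrightarrow> y i = 0"
  by (simp add: dependent_family_def vec.dependent_single)

section \<open>Simple matroids of rank three\<close>

locale simple_rank_three =
  fixes M :: "'n::finite matroid"
  assumes ground: "ground M = UNIV" and simple: "simple_matroid M" and rank: "matroid_rank M = 3"
begin

lemma indep_card_le_3:
  assumes "indep M S"
  shows "card S \<le> 3"
proof -
  have "card S \<le> Max (card ` {S. indep M S})"
    by (rule Max_ge) (use assms in auto)
  then show ?thesis using rank by (simp add: matroid_rank_def)
qed

lemma indep_small: "card S \<le> 2 \<Longrightarrow> indep M S"
proof -
  assume "card S \<le> 2"
  then consider "card S = 0" | "card S = 1" | "card S = 2" by linarith
  then show "indep M S"
  proof cases
    case 1
    then have "S = {}" by simp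
    then show ?thesis using simple by (simp add: simple_matroid_def is_matroid_def)
  next
    case 2
    then obtain x where "S = {x}" by (rule card_1_singletonE)
    then show ?thesis using simple ground by (simp add: simple_matroid_def)
  next
    case 3
    then obtain x y where "S = {x, y}" by (auto simp: card_2_iff)
    then show ?thesis using simple ground by (simp add: simple_matroid_def)
  qed
qed

lemma dependent_iff: "dependent_set M S \<longleftrightarrow> \<not> indep M S"
  by (simp add: dependent_set_def ground)

lemma dependent_if_subset_line:
  assumes "l \<in> lines M" "{i, j, k} \<subseteq> l" "i \<noteq> j" "j \<noteq> k" "i \<noteq> k"
  shows "dependent_set M {i, j, k}"
proof -
  have "card {i, j, k} = 3" using assms by simp
  then show ?thesis using assms(1,2) unfolding lines_def collinear_set_def by blast
qed

lemma subset_line_if_dependent: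
  assumes "dependent_set M {i, j, k}" "i \<noteq> j" "j \<noteq> k" "i \<noteq> k"
  shows "\<exists>l\<in>lines M. {i, j, k} \<subseteq> l"
proof -
  have c: "card {i, j, k} = 3" using assms by simp
  have "T = {i, j, k}" if "T \<subseteq> {i, j, k}" "card T = 3" for T
    using card_subset_eq[of "{i, j, k}" T] that c by simp
  then have "collinear_set M {i, j, k}"
    using assms(1) c unfolding collinear_set_def by (auto simp: ground)
  then show ?thesis
    using collinear_imp_subset_line[of M "{i, j, k}"] by (metis finite)
qed

lemma circuit_if_subset_line:
  assumes "l \<in> lines M" "{i, j, k} \<subseteq> l" "i \<noteq> j" "j \<noteq> k" "i \<noteq> k"
  shows "circuit M {i, j, k}"
  unfolding circuit_def
proof (intro conjI allI impI)
  show "dependent_set M {i, j, k}"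
    by (rule dependent_if_subset_line[OF assms])
  fix T assume "T \<subset> {i, j, k}"
  then have "card T < card {i, j, k}" by (intro psubset_card_mono) auto
  moreover have "card {i, j, k} = 3" using assms by simp
  ultimately show "indep M T" by (intro indep_small) simp
qed

lemma dependent_card: "dependent_set M S \<Longrightarrow> card S \<ge> 3"
  using indep_small[of S] by (cases "card S \<le> 2") (simp_all add: dependent_iff)

lemma circuit_card: "circuit M B \<Longrightarrow> card B \<ge> 3"
  by (simp add: circuit_def dependent_card)

lemma realizations_iff: "A \<in> realizations M \<longleftrightarrow>
    (\<forall>S. dependent_set M S \<longleftrightarrow> dependent_family (\<lambda>i. column i A) S)"
  by (simp add: realizations_def ground)

text \<open>Only triples carry information: up to two points are independent on both sides, and four
  or more are dependent on both sides.\<close>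

lemma general_position_realization:
  assumes "in_general_position UNIV (lines M) y h"
  shows "of_columns y \<in> realizations M"
  unfolding realizations_iff
proof (intro allI)
  note g = in_general_positionD[OF assms]
  note f = flaggedD[OF g(1)]
  fix S
  have dep: "dependent_family y S" if S_dep: "dependent_set M S"
  proof -
    have "card S \<ge> 3" by (rule dependent_card[OF S_dep])
    then consider "card S > 3" | "card S = 3" by linarith
    then show ?thesis
    proof cases
      case 1
      then show ?thesis by (simp add: dependent_family_card_4)
    next
      case 2
      then obtain i j k where S: "S = {i, j, k}" "i \<noteq> j" "j \<noteq> k" "i \<noteq> k"
        by (auto simp: card_3_iff)
      obtain l where "l \<in> lines M" "{i, j, k} \<subseteq> l"
        using subset_line_if_dependent S_dep S by blast
      then have "dot (crs (y i) (y j)) (y k) = 0"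
        using f by (intro dot_crs_eq_0_if_common_covector[of "h l"]) auto
      then show ?thesis using S by (simp add: dependent_family_triple)
    qed
  qed
  have indep: "\<not> dependent_family y S" if "indep M S"
  proof -
    have "card S \<le> 3" by (rule indep_card_le_3[OF that])
    then consider "card S = 0" | "card S = 1" | "card S = 2" | "card S = 3" by linarith
    then show ?thesis
    proof cases
      case 1
      then have "S = {}" by simp
      then show ?thesis by (simp add: dependent_family_def vec.independent_empty)
    next
      case 2
      then obtain x where "S = {x}" by (rule card_1_singletonE)
      then show ?thesis using f(1) by (simp add: dependent_family_single)
    next
      case 3
      then obtain x z where "S = {x, z}" "x \<noteq> z" by (auto simp: card_2_iff)
      then show ?thesis
        using independent_pair_if_crs_nonzero[of y x z] g(3)[of x z] by simp
    next
      case 4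
      then obtain i j k where S: "S = {i, j, k}" "i \<noteq> j" "j \<noteq> k" "i \<noteq> k"
        by (auto simp: card_3_iff)
      have "\<not> (\<exists>l\<in>lines M. {i, j, k} \<subseteq> l)"
        using dependent_if_subset_line S that by (metis dependent_iff)
      then have "dot (crs (y i) (y j)) (y k) \<noteq> 0"
        using g(5) S by blast
      then show ?thesis using S by (simp add: dependent_family_triple)
    qed
  qed
  show "dependent_set M S \<longleftrightarrow> dependent_family (\<lambda>i. column i (of_columns y)) S"
    using dep indep by (auto simp: dependent_iff)
qed

text \<open>The lines have rank at most two, phrased so that choosing the covectors gives a
  \<open>flagged\<close> configuration once no column vanishes.\<close>

definition line_configuration :: "('n \<Rightarrow> complex^3) \<Rightarrow> bool" where
  "line_configuration y \<longleftrightarrow> (\<forall>l\<in>lines M. \<exists>h. h \<noteq> 0 \<and> (\<forall>p\<in>l. dot h (y p) = 0))"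

lemma line_configurationI:
  assumes "\<And>l p q r. l \<in> lines M \<Longrightarrow> p \<in> l \<Longrightarrow> q \<in> l \<Longrightarrow> r \<in> l \<Longrightarrow> p \<noteq> q \<Longrightarrow> q \<noteq> r \<Longrightarrow> p \<noteq> r \<Longrightarrow>
      dot (crs (y p) (y q)) (y r) = 0"
  shows "line_configuration y"
  unfolding line_configuration_def
proof
  fix l assume l: "l \<in> lines M"
  have "dot (crs a b) c = 0" if abc: "a \<in> y ` l" "b \<in> y ` l" "c \<in> y ` l" for a b c
  proof -
    obtain p q r where "a = y p" "b = y q" "c = y r" "p \<in> l" "q \<in> l" "r \<in> l"
      using abc by blast
    then show ?thesis
      using assms[OF l, of p q r] by (cases "p = q \<or> q = r \<or> p = r") auto
  qed
  then obtain h where "h \<noteq> 0" "\<And>a. a \<in> y ` l \<Longrightarrow> dot h a = 0"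
    using exists_common_covector[of "y ` l"] by blast
  then show "\<exists>h. h \<noteq> 0 \<and> (\<forall>p\<in>l. dot h (y p) = 0)" by blast
qed

lemma line_configurationD:
  assumes "line_configuration y" "l \<in> lines M" "p \<in> l" "q \<in> l" "r \<in> l"
  shows "dot (crs (y p) (y q)) (y r) = 0"
proof -
  obtain h where "h \<noteq> 0" "\<And>p. p \<in> l \<Longrightarrow> dot h (y p) = 0"
    using assms(1,2) unfolding line_configuration_def by blast
  then show ?thesis
    using assms(3-5) by (intro dot_crs_eq_0_if_common_covector[of h]) auto
qed

lemma gc_zero_line_configuration:
  assumes "gc_zero M y"
  shows "line_configuration y"
proof (rule line_configurationI)
  fix l p q r assume *: "l \<in> lines M" "p \<in> l" "q \<in> l" "r \<in> l" "p \<noteq> q" "q \<noteq> r" "p \<noteq> r"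
  then have "circuit M {p, q, r}" by (intro circuit_if_subset_line) auto
  then have "bracket p q r \<in> grassmann_cayley_set M 0" by auto
  then have "eval_poly (bracket p q r) (of_columns y) = 0"
    using assms unfolding gc_zero_def by blast
  then show "dot (crs (y p) (y q)) (y r) = 0" by simp
qed

lemma realization_line_configuration:
  assumes "of_columns y \<in> realizations M"
  shows "line_configuration y"
proof (rule line_configurationI)
  fix l p q r assume *: "l \<in> lines M" "p \<in> l" "q \<in> l" "r \<in> l" "p \<noteq> q" "q \<noteq> r" "p \<noteq> r"
  then have "dependent_set M {p, q, r}" by (intro dependent_if_subset_line) auto
  then have "dependent_family y {p, q, r}"
    using assms by (simp add: realizations_iff)
  then show "dot (crs (y p) (y q)) (y r) = 0"
    using * by (simp add: dependent_family_triple)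
qed

text \<open>With equal planes the union of the two lines would be collinear in the realization,
  hence in \<open>M\<close>, against maximality.\<close>

lemma realization_distinct_lines:
  assumes y: "of_columns y \<in> realizations M" and lm: "l \<in> lines M" "m \<in> lines M" "l \<noteq> m"
    and h: "\<And>p. p \<in> l \<Longrightarrow> dot h (y p) = 0" "h \<noteq> 0" and k: "\<And>p. p \<in> m \<Longrightarrow> dot k (y p) = 0" "k \<noteq> 0"
  shows "crs h k \<noteq> 0"
proof
  assume "crs h k = 0"
  then obtain c where c: "h = c *s k"
    using crs_eq_0_iff[OF k(2)] by blast
  then have "c \<noteq> 0" using h(2) by auto
  have on: "dot h (y p) = 0" if "p \<in> l \<union> m" for p
    using that h(1) k(1) c by auto
  have coll: "collinear_set M l" "collinear_set M m"
    using lm by (auto simp: lines_def)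
  have "dependent_set M T" if T: "T \<subseteq> l \<union> m" "card T = 3" for T
  proof -
    obtain i j k where T': "T = {i, j, k}" "i \<noteq> j" "j \<noteq> k" "i \<noteq> k"
      using T(2) by (auto simp: card_3_iff)
    then have "dot (crs (y i) (y j)) (y k) = 0"
      using T(1) on h(2) by (intro dot_crs_eq_0_if_common_covector[of h]) auto
    then show ?thesis
      using y T' by (simp add: realizations_iff dependent_family_triple)
  qed
  moreover have "card (l \<union> m) \<ge> 3"
    using coll card_mono[of "l \<union> m" l] by (auto simp: collinear_set_def)
  ultimately have "collinear_set M (l \<union> m)"
    by (simp add: collinear_set_def ground)
  then have "l \<union> m = l" "l \<union> m = m"
    using lm(1,2) by (auto simp: lines_def)
  then show False using lm(3) by auto
qed

lemma realization_gc_zero: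
  assumes y: "of_columns y \<in> realizations M"
  shows "gc_zero M y"
proof -
  have "\<forall>l\<in>lines M. \<exists>h. h \<noteq> 0 \<and> (\<forall>p\<in>l. dot h (y p) = 0)"
    using realization_line_configuration[OF y] by (simp add: line_configuration_def)
  then obtain h where h: "\<And>l. l \<in> lines M \<Longrightarrow> h l \<noteq> 0" "\<And>l p. l \<in> lines M \<Longrightarrow> p \<in> l \<Longrightarrow> dot (h l) (y p) = 0"
    by metis
  \<comment> \<open>The planes of the realization are fixed while the columns may be any vectors in
    them, zero included; this is the invariant under repeated replacements.\<close>
  define W where "W = {z. \<forall>l\<in>lines M. \<forall>p\<in>l. dot (h l) (z p) = 0}"
  have W: "dot (h l) (z p) = 0" if "z \<in> W" "l \<in> lines M" "p \<in> l" for z l p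
    using that by (simp add: W_def)
  have nonzero: "y x \<noteq> 0" for x
  proof -
    have "\<not> dependent_set M {x}" by (simp add: dependent_iff indep_small)
    then show ?thesis using y by (simp add: realizations_iff dependent_family_single)
  qed
  show ?thesis
  proof (rule gc_zero_if_invariant[of W])
    show "y \<in> W" using h by (simp add: W_def)
  next
    fix z assume z: "z \<in> W"
    show "\<forall>P\<in>grassmann_cayley_set M 0. eval_poly P (of_columns z) = 0"
    proof
      fix P assume "P \<in> grassmann_cayley_set M 0"
      then obtain i j k where P: "P = bracket i j k" and c: "circuit M {i, j, k}" by auto
      have "card {i, j, k} \<ge> 3" by (rule circuit_card[OF c])
      then have "i \<noteq> j" "j \<noteq> k" "i \<noteq> k" by (auto simp: card_insert_if split: if_splits)
      moreover have "dependent_set M {i, j, k}" using c by (simp add: circuit_def)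
      ultimately obtain l where "l \<in> lines M" "{i, j, k} \<subseteq> l"
        using subset_line_if_dependent by blast
      then have "dot (crs (z i) (z j)) (z k) = 0"
        using W[OF z] h(1) by (intro dot_crs_eq_0_if_common_covector[of "h l"]) auto
      then show "eval_poly P (of_columns z) = 0" by (simp add: P)
    qed
  next
    fix z z' assume z: "z \<in> W" and step: "\<And>x. z' x = z x \<or> gc_step M z x (z' x)"
    show "z' \<in> W"
      unfolding W_def
    proof (intro CollectI ballI)
      fix l x assume l: "l \<in> lines M" "x \<in> l"
      show "dot (h l) (z' x) = 0"
        using step[of x]
      proof
        assume "z' x = z x"
        then show ?thesis using W[OF z l] by simp
      next
        assume "gc_step M z x (z' x)"
        then obtain l1 l2 p1 p2 p3 p4 where v: "z' x = gc_vector z p1 p2 p3 p4"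
          and ls: "l1 \<in> lines_through M x" "l2 \<in> lines_through M x" "l1 \<noteq> l2"
          and ps: "p1 \<in> l1" "p2 \<in> l1" "p3 \<in> l2" "p4 \<in> l2"
          unfolding gc_step_def by blast
        have l12: "l1 \<in> lines M" "l2 \<in> lines M" "x \<in> l1" "x \<in> l2"
          using ls by (auto simp: lines_through_def)
        have 2: "dot (h l2) (z' x) = 0"
          using W[OF z l12(2)] ps unfolding v gc_vector_def by simp
        have 1: "dot (h l1) (z' x) = 0"
        \<comment> \<open>For parallel \<open>z p1\<close> and \<open>z p2\<close> both brackets
          vanish and the new column is zero. Otherwise these two vectors span the plane of
          \<open>l1\<close>, and the combination was made to lie in it.\<close>
        proof (cases "crs (z p1) (z p2) = 0")
          case True
          then show ?thesis by (simp add: v gc_vector_def)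
        next
          case False
          then obtain c where c: "h l1 = c *s crs (z p1) (z p2)"
            using orthogonal_parallel_crs[of "z p1" "z p2" "h l1"] W[OF z l12(1)] ps
            by (metis dot_commute)
          show ?thesis
            unfolding v gc_vector_def c by (simp add: algebra_simps)
        qed
        \<comment> \<open>Two different planes meet in the multiples of \<open>y x\<close>; such a
          multiple lies in the planes of all lines through \<open>x\<close>.\<close>
        have "crs (h l1) (h l2) \<noteq> 0"
          using realization_distinct_lines[OF y l12(1,2) ls(3)] h l12 by blast
        then have "crs (z' x) (y x) = 0"
          using 1 2 h(2) l12 by (intro parallel_if_both_orthogonal[of "h l1" "h l2"]) auto
        then obtain c where "z' x = c *s y x"
          using crs_eq_0_iff[OF nonzero] by blast
        then show ?thesis using h(2)[OF l] by simp
      qed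
    qed
  qed
qed

lemma eval_poly_minor_UNIV:
  "eval_poly (minor UNIV f) A = dot (crs (column (f 1) A) (column (f 2) A)) (column (f 3) A)"
proof -
  have "eval_poly (minor UNIV f) A = det (\<chi> i j. A $ j $ f i)"
    unfolding minor_def det_def
    by (simp add: eval_poly_sum eval_poly_prod generic_matrix_def)
  then show ?thesis
    by (simp add: det_3 dot_def column_def algebra_simps)
qed

text \<open>A circuit has at least three elements and a row set at most three, so every generating
  minor is a full determinant of a three-element circuit.\<close>

lemma realization_circuit_minor:
  assumes y: "of_columns y \<in> realizations M" and "circuit M B" "bij_betw f A B"
  shows "eval_poly (minor A f) (of_columns y) = 0"
proof -
  have "card A \<ge> 3"
    using circuit_card[OF assms(2)] bij_betw_same_card[OF assms(3)] by simp
  then have A: "A = UNIV"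
    by (intro card_subset_eq) (auto intro: antisym simp: card_mono[of UNIV A, simplified])
  have inj: "inj f" and range: "f ` UNIV = B"
    using assms(3) unfolding A by (simp_all add: bij_betw_def)
  have B: "B = {f 1, f 2, f 3}"
    unfolding range[symmetric] UNIV_3 by (simp only: image_insert image_empty)
  have neq: "f 1 \<noteq> f 2" "f 2 \<noteq> f 3" "f 1 \<noteq> f 3"
    by (simp_all add: inj_eq[OF inj])
  have "dependent_family y B"
    using assms(2) y by (simp add: circuit_def realizations_iff)
  then show ?thesis
    using neq by (simp add: A B eval_poly_minor_UNIV dependent_family_triple)
qed

end

section \<open>Filling in vanishing columns\<close>

text \<open>Without such a point, a walk in \<open>Y\<close> that changes its line at every step
  never gets stuck. A shortest return, to a point or to a line, is a cycle.\<close>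

lemma acyclic_imp_leaf:
  fixes M :: "'n::finite matroid"
  assumes acyc: "\<not> contains_cycle M Y" and "Y \<noteq> {}"
  shows "\<exists>x\<in>Y. \<exists>l0. \<forall>l\<in>lines_through M x. l \<noteq> l0 \<longrightarrow> l \<inter> Y \<subseteq> {x}"
proof (rule ccontr)
  assume no: "\<not> ?thesis"
  have step: "\<exists>l z. l \<in> lines_through M x \<and> l \<noteq> l0 \<and> z \<in> l \<and> z \<in> Y \<and> z \<noteq> x" if "x \<in> Y" for x l0
  proof -
    obtain l where "l \<in> lines_through M x" "l \<noteq> l0" "\<not> l \<inter> Y \<subseteq> {x}"
      using no \<open>x \<in> Y\<close> by blast
    then show ?thesis by blast
  qed
  obtain x0 where x0: "x0 \<in> Y" using \<open>Y \<noteq> {}\<close> by blast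
  define next_step where "next_step s t \<longleftrightarrow> snd t \<in> lines_through M (fst s) \<and> snd t \<noteq> snd s \<and>
      fst t \<in> snd t \<and> fst t \<in> Y \<and> fst t \<noteq> fst s" for s t :: "'n \<times> 'n set"
  have "\<exists>f. \<forall>n. fst (f n) \<in> Y \<and> next_step (f n) (f (Suc n))"
  proof (rule dependent_nat_choice)
    show "\<exists>s :: 'n \<times> 'n set. fst s \<in> Y" using x0 by (intro exI[of _ "(x0, {})"]) simp
  next
    fix s :: "'n \<times> 'n set" and n :: nat assume "fst s \<in> Y"
    then obtain l z where "l \<in> lines_through M (fst s)" "l \<noteq> snd s" "z \<in> l" "z \<in> Y" "z \<noteq> fst s"
      using step by blast
    then show "\<exists>t. fst t \<in> Y \<and> next_step s t"
      by (intro exI[of _ "(z, l)"]) (simp add: next_step_def)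
  qed
  then obtain f where f: "\<And>n. fst (f n) \<in> Y" "\<And>n. next_step (f n) (f (Suc n))" by blast
  \<comment> \<open>A state pairs a point with the line by which it was reached; the shift makes
    \<open>l n\<close> the line from \<open>x n\<close> to \<open>x (Suc n)\<close>.\<close>
  define x l where "x n = fst (f n)" and "l n = snd (f (Suc n))" for n
  have x: "x n \<in> Y" "x (Suc n) \<noteq> x n" and l: "l n \<in> lines M" "x n \<in> l n" "x (Suc n) \<in> l n" "l (Suc n) \<noteq> l n" for n
    using f(1)[of n] f(2)[of n] f(2)[of "Suc n"] by (simp_all add: next_step_def x_def l_def lines_through_def)
  \<comment> \<open>Repeated points and repeated lines are treated together, so the minimal distance
    makes both families injective on every window of that length.\<close>
  define rep where "rep k \<longleftrightarrow> k \<ge> 1 \<and> (\<exists>i. x (i + k) = x i \<or> l (i + k) = l i)" for k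
  have "\<exists>k. rep k"
  proof -
    have "\<not> inj x"
      using finite_imageD[of x UNIV] by (auto simp: finite_subset[OF subset_UNIV])
    then obtain i j where "i < j" "x i = x j"
      unfolding inj_def by (metis linorder_neqE_nat)
    then have "rep (j - i)"
      unfolding rep_def by (intro conjI exI[of _ i]) auto
    then show ?thesis by blast
  qed
  then obtain k where k: "rep k" "\<And>m. m < k \<Longrightarrow> \<not> rep m"
    by (metis LeastI not_less_Least)
  have "k \<noteq> 1"
    using k(1) x(2) l(4) unfolding rep_def by auto
  then have k2: "k \<ge> 2" using k(1) by (simp add: rep_def)
  have x_inj: "inj_on (\<lambda>m. x (s + m)) {..<k}" and l_inj: "inj_on (\<lambda>m. l (s + m)) {..<k}" for s
  proof -
    have "x (s + a) \<noteq> x (s + b) \<and> l (s + a) \<noteq> l (s + b)" if ab: "a < b" "b < k" for a b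
    proof -
      obtain d where d: "d > 0" "b = a + d"
        using less_imp_add_positive[OF ab(1)] by blast
      then have "\<not> rep d" using k(2) ab by simp
      then have "x ((s + a) + d) \<noteq> x (s + a)" "l ((s + a) + d) \<noteq> l (s + a)"
        using d(1) unfolding rep_def by fastforce+
      then show ?thesis unfolding d(2) by (simp add: add.assoc)
    qed
    then show "inj_on (\<lambda>m. x (s + m)) {..<k}" "inj_on (\<lambda>m. l (s + m)) {..<k}"
      unfolding inj_on_def by (metis lessThan_iff linorder_neqE_nat)+
  qed
  have cyc: "contains_cycle M Y" if "x s \<in> l (s + k - 1)" for s
    unfolding contains_cycle_def
  proof (intro exI[of _ k] exI[of _ "\<lambda>m. x (s + m)"] exI[of _ "\<lambda>m. l (s + m)"] conjI allI impI k2 x_inj l_inj)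
    show "(\<lambda>m. x (s + m)) ` {..<k} \<subseteq> Y" using x(1) by blast
    show "(\<lambda>m. l (s + m)) ` {..<k} \<subseteq> lines M" using l(1) by blast
    fix i assume i: "i < k"
    have "x (s + Suc i mod k) \<in> l (s + i)"
    proof (cases "Suc i = k")
      case True
      then have "s + k - 1 = s + i" by simp
      then show ?thesis using that True by simp
    next
      case False
      then have "Suc i mod k = Suc i" using i by simp
      then show ?thesis using l(3)[of "s + i"] by simp
    qed
    then show "{x (s + i), x (s + Suc i mod k)} \<subseteq> l (s + i)" using l(2)[of "s + i"] by simp
  qed
  obtain i where "x (i + k) = x i \<or> l (i + k) = l i"
    using k(1) by (auto simp: rep_def)
  then show False
  proof
    assume "x (i + k) = x i"
    moreover have "Suc (i + k - 1) = i + k" using k2 by simp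
    ultimately have "x i \<in> l (i + k - 1)" using l(3)[of "i + k - 1"] by simp
    then show False using cyc acyc by blast
  next
    \<comment> \<open>Here the cycle is the window that starts one step later: its last line is
      \<open>l i\<close>, which contains \<open>x (Suc i)\<close>.\<close>
    assume "l (i + k) = l i"
    then have "x (Suc i) \<in> l (Suc i + k - 1)" using l(3)[of i] by simp
    then show False using cyc acyc by blast
  qed
qed

lemma contains_cycle_mono: "contains_cycle M Y \<Longrightarrow> Y \<subseteq> Z \<Longrightarrow> contains_cycle M Z"
  unfolding contains_cycle_def by (meson subset_trans)

context simple_rank_three
begin

section \<open>When a vanishing column can be given a nonzero value\<close>

definition rank_two :: "('n \<Rightarrow> complex^3) \<Rightarrow> 'n set \<Rightarrow> bool" where
  "rank_two y l \<longleftrightarrow> (\<exists>p\<in>l. \<exists>q\<in>l. crs (y p) (y q) \<noteq> 0)"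

text \<open>For a line \<open>l\<close> of lower rank the equations are trivial, so for a line
  configuration this says that the rank-two members of \<open>K\<close> all span one plane.\<close>

definition concurrent_at :: "('n \<Rightarrow> complex^3) \<Rightarrow> 'n set set \<Rightarrow> bool" where
  "concurrent_at y K \<longleftrightarrow> (\<forall>l\<in>K. \<forall>m\<in>K. rank_two y m \<longrightarrow>
     (\<forall>p\<in>l. \<forall>q\<in>l. \<forall>r\<in>m. dot (crs (y p) (y q)) (y r) = 0))"

text \<open>The new vector is orthogonal to two covectors, one for the exceptional line
  \<open>l0\<close> and one for the common plane of the other rank-two lines. A line of rank at most
  one imposes nothing, as it spans at most a plane together with any new vector.\<close>

lemma fill_column:
  assumes y: "line_configuration y" and zero: "y x = 0"
    and conc: "concurrent_at y (lines_through M x - {l0})"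
  obtains v where "v \<noteq> 0" "line_configuration (y(x := v))"
proof -
  obtain h0 where h0: "l0 \<in> lines M \<Longrightarrow> h0 \<noteq> 0 \<and> (\<forall>p\<in>l0. dot h0 (y p) = 0)"
    using y unfolding line_configuration_def by blast
  let ?K = "lines_through M x - {l0}"
  obtain h1 where h1: "\<And>m r. m \<in> ?K \<Longrightarrow> rank_two y m \<Longrightarrow> r \<in> m \<Longrightarrow> dot h1 (y r) = 0"
    "\<And>m. m \<in> ?K \<Longrightarrow> rank_two y m \<Longrightarrow> h1 \<noteq> 0"
  proof (cases "\<exists>m\<in>?K. rank_two y m")
    case True
    then obtain l p q where l: "l \<in> ?K" "p \<in> l" "q \<in> l" "crs (y p) (y q) \<noteq> 0"
      unfolding rank_two_def by blast
    show ?thesis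
    proof (rule that[of "crs (y p) (y q)"])
      show "dot (crs (y p) (y q)) (y r) = 0" if "m \<in> ?K" "rank_two y m" "r \<in> m" for m r
        using conc l that unfolding concurrent_at_def by blast
    qed (use l in simp)
  next
    case False
    then show ?thesis using that by blast
  qed
  obtain v where v: "v \<noteq> 0" "dot v h0 = 0" "dot v h1 = 0"
    using exists_orthogonal_nonzero[of h0 h1] by blast
  have "line_configuration (y(x := v))"
    unfolding line_configuration_def
  proof
    fix l assume l: "l \<in> lines M"
    have *: "\<exists>h. h \<noteq> 0 \<and> (\<forall>p\<in>l. dot h ((y(x := v)) p) = 0)"
      if "h \<noteq> 0" "\<And>p. p \<in> l \<Longrightarrow> dot h (y p) = 0" "x \<in> l \<Longrightarrow> dot h v = 0" for h
      using that by (intro exI[of _ h]) auto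
    show "\<exists>h. h \<noteq> 0 \<and> (\<forall>p\<in>l. dot h ((y(x := v)) p) = 0)"
    proof (cases "x \<in> l")
      case False
      obtain h where "h \<noteq> 0" "\<And>p. p \<in> l \<Longrightarrow> dot h (y p) = 0"
        using y l unfolding line_configuration_def by blast
      then show ?thesis using * False by blast
    next
      case x: True
      show ?thesis
      proof (cases "l = l0")
        case True
        then show ?thesis
          using h0 l v(2) dot_commute[of v h0] by (intro *[of h0]) auto
      next
        case False
        then have lK: "l \<in> ?K" using l x by (simp add: lines_through_def)
        show ?thesis
        proof (cases "rank_two y l")
          case True
          then show ?thesis
            using h1[OF lK] lK v(3) dot_commute[of v h1] h1(2)[OF lK] by (intro *[of h1]) auto
        next
          case False
          then have par: "crs (y p) (y q) = 0" if "p \<in> l" "q \<in> l" for p q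
            using that unfolding rank_two_def by blast
          obtain a where a: "a \<in> l" "y a \<noteq> 0 \<or> (\<forall>p\<in>l. y p = 0)"
            using x by blast
          obtain h where h: "h \<noteq> 0" "dot h (y a) = 0" "dot h v = 0"
            using exists_orthogonal_nonzero[of "y a" v] by blast
          have "dot h (y p) = 0" if p: "p \<in> l" for p
          proof (cases "y a = 0")
            case True
            then show ?thesis using a(2) p by simp
          next
            case False
            then obtain c where "y p = c *s y a"
              using crs_eq_0_iff[OF False] par[OF p a(1)] by blast
            then show ?thesis using h(2) by simp
          qed
          then show ?thesis using h by (intro *[of h]) auto
        qed
      qed
    qed
  qed
  then show ?thesis using v(1) that by blast
qed

text \<open>The leaf is filled in last. Apart from \<open>l0\<close>, the lines through it contain
  no other point of \<open>Y\<close>, so they are still as in \<open>y\<close> and keep the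
  concurrency assumed there.\<close>

lemma fill_acyclic:
  assumes y: "line_configuration y"
    and sat: "\<And>x. x \<in> Y \<Longrightarrow> concurrent_at y (lines_through M x)"
    and acyc: "\<not> contains_cycle M Y" and zero: "\<And>x. x \<in> Y \<Longrightarrow> y x = 0"
  shows "\<exists>y'. line_configuration y' \<and> (\<forall>x. x \<notin> Y \<longrightarrow> y' x = y x) \<and> (\<forall>x\<in>Y. y' x \<noteq> 0)"
proof -
  have "finite Y" by simp
  then show ?thesis
    using sat acyc zero
  proof (induction Y rule: finite_psubset_induct)
    case (psubset Y)
    show ?case
    proof (cases "Y = {}")
      case True
      then show ?thesis using y by blast
    next
      case False
      obtain x l0 where x: "x \<in> Y" and leaf: "\<And>l. l \<in> lines_through M x \<Longrightarrow> l \<noteq> l0 \<Longrightarrow> l \<inter> Y \<subseteq> {x}"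
        using acyclic_imp_leaf[OF psubset.prems(2) False] by metis
      have "Y - {x} \<subset> Y" using x by blast
      moreover have "\<not> contains_cycle M (Y - {x})"
        using psubset.prems(2) contains_cycle_mono[of M "Y - {x}" Y] by blast
      ultimately have "\<exists>y'. line_configuration y' \<and> (\<forall>z. z \<notin> Y - {x} \<longrightarrow> y' z = y z) \<and> (\<forall>z\<in>Y - {x}. y' z \<noteq> 0)"
        using psubset.prems by (intro psubset.IH) auto
      then obtain y' where y': "line_configuration y'" "\<And>z. z \<notin> Y - {x} \<Longrightarrow> y' z = y z"
        "\<And>z. z \<in> Y - {x} \<Longrightarrow> y' z \<noteq> 0" by blast
      have same: "y' p = y p" if "p \<in> l" "l \<in> lines_through M x - {l0}" for p l
        using leaf[of l] that y'(2)[of p] by blast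
      have "concurrent_at y' (lines_through M x - {l0})"
      proof -
        have "concurrent_at y (lines_through M x)" by (rule psubset.prems(1)[OF x])
        then show ?thesis
          unfolding concurrent_at_def rank_two_def
          by (intro ballI impI) (simp add: same, blast)
      qed
      moreover have "y' x = 0" using y'(2)[of x] psubset.prems(3)[OF x] by simp
      ultimately obtain v where v: "v \<noteq> 0" "line_configuration (y'(x := v))"
        using fill_column[OF y'(1)] by blast
      show ?thesis
      proof (intro exI[of _ "y'(x := v)"] conjI allI impI ballI)
        show "line_configuration (y'(x := v))" by (rule v(2))
        show "(y'(x := v)) z = y z" if "z \<notin> Y" for z
          using that y'(2)[of z] x by auto
        show "(y'(x := v)) z \<noteq> 0" if "z \<in> Y" for z
          using that y'(3)[of z] v(1) by auto
      qed
    qed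
  qed
qed

text \<open>One of the at most two lines is taken as the exceptional one; for the other, concurrency
  only says that its own rank is at most two.\<close>

lemma fill_low_degree:
  assumes y: "line_configuration y" and "finite Z"
    and deg: "\<And>x. x \<in> Z \<Longrightarrow> card (lines_through M x) \<le> 2" and zero: "\<And>x. x \<in> Z \<Longrightarrow> y x = 0"
  shows "\<exists>y'. line_configuration y' \<and> (\<forall>x. x \<notin> Z \<longrightarrow> y' x = y x) \<and> (\<forall>x\<in>Z. y' x \<noteq> 0)"
  using assms(2-4)
proof (induction rule: finite_induct)
  case empty
  then show ?case using y by blast
next
  case (insert x Z)
  have "\<exists>y'. line_configuration y' \<and> (\<forall>x. x \<notin> Z \<longrightarrow> y' x = y x) \<and> (\<forall>x\<in>Z. y' x \<noteq> 0)"
    using insert.prems by (intro insert.IH) auto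
  then obtain y' where y': "line_configuration y'" "\<And>z. z \<notin> Z \<Longrightarrow> y' z = y z"
    "\<And>z. z \<in> Z \<Longrightarrow> y' z \<noteq> 0" by blast
  obtain l0 where l0: "lines_through M x = {} \<or> l0 \<in> lines_through M x" by blast
  have "card (lines_through M x - {l0}) \<le> 1"
    using l0 insert.prems(1)[of x] by auto
  then have one: "l = m" if "l \<in> lines_through M x - {l0}" "m \<in> lines_through M x - {l0}" for l m
    using card_le_Suc0_iff_eq[of "lines_through M x - {l0}"] that by simp
  have "concurrent_at y' (lines_through M x - {l0})"
    unfolding concurrent_at_def
  proof (intro ballI impI)
    fix l m p q r assume *: "l \<in> lines_through M x - {l0}" "m \<in> lines_through M x - {l0}" "p \<in> l" "q \<in> l" "r \<in> m"
    then have "r \<in> l" using one by blast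
    then show "dot (crs (y' p) (y' q)) (y' r) = 0"
      using line_configurationD[OF y'(1), of l] * by (simp add: lines_through_def)
  qed
  moreover have "y' x = 0" using y'(2) insert by simp
  ultimately obtain v where v: "v \<noteq> 0" "line_configuration (y'(x := v))"
    using fill_column[OF y'(1)] by blast
  show ?case
  proof (intro exI[of _ "y'(x := v)"] conjI allI impI ballI)
    show "line_configuration (y'(x := v))" by (rule v(2))
    show "(y'(x := v)) z = y z" if "z \<notin> insert x Z" for z
      using that y'(2)[of z] by auto
    show "(y'(x := v)) z \<noteq> 0" if "z \<in> insert x Z" for z
      using that y'(3)[of z] v(1) by auto
  qed
qed

text \<open>
  A Grassmann-Cayley replacement at a vanishing column leaves the zero locus invariant, so one may
  replace as long as this makes another column non-zero.
\<close>

lemma saturate: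
  assumes "gc_zero M z"
  obtains y where "gc_zero M y" "\<And>x. z x \<noteq> 0 \<Longrightarrow> y x = z x"
    "\<And>x. y x = 0 \<Longrightarrow> concurrent_at y (lines_through M x)"
proof -
  define S where "S = {y. gc_zero M y \<and> (\<forall>x. z x \<noteq> 0 \<longrightarrow> y x = z x)}"
  define c where "c y = card {x. y x \<noteq> 0}" for y :: "'n \<Rightarrow> complex^3"
  have "z \<in> S" using assms by (simp add: S_def)
  moreover have "\<forall>y. y \<in> S \<longrightarrow> c y < Suc (CARD('n))"
    by (simp add: c_def card_mono less_Suc_eq_le)
  ultimately obtain y where y: "y \<in> S" and max: "\<And>y'. y' \<in> S \<Longrightarrow> c y' \<le> c y"
    using ex_has_greatest_nat[of "\<lambda>y. y \<in> S" z c] by blast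
  have gc: "gc_zero M y" and ext: "\<And>x. z x \<noteq> 0 \<Longrightarrow> y x = z x"
    using y by (auto simp: S_def)
  note conf = gc_zero_line_configuration[OF gc]
  have no_step: "v = 0" if v: "gc_step M y x v" and x: "y x = 0" for x v
  proof (rule ccontr)
    assume "v \<noteq> 0"
    have "y(x := v) \<in> S"
      using gc_zero_step[OF gc v] ext x by (auto simp: S_def)
    then have "c (y(x := v)) \<le> c y" by (rule max)
    moreover have "{w. (y(x := v)) w \<noteq> 0} = insert x {w. y w \<noteq> 0}"
      using \<open>v \<noteq> 0\<close> by auto
    ultimately show False using x by (simp add: c_def)
  qed
  have "concurrent_at y (lines_through M x)" if x: "y x = 0" for x
    unfolding concurrent_at_def
  proof (intro ballI impI)
    fix l m p q r assume *: "l \<in> lines_through M x" "m \<in> lines_through M x" "rank_two y m" "p \<in> l" "q \<in> l" "r \<in> m"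
    have lm: "l \<in> lines M" "m \<in> lines M" using * by (auto simp: lines_through_def)
    show "dot (crs (y p) (y q)) (y r) = 0"
    proof (cases "l = m \<or> crs (y p) (y q) = 0")
      case True
      then show ?thesis
        using line_configurationD[OF conf lm(1)] * by auto
    next
      case False
      obtain s t where st: "s \<in> m" "t \<in> m" "crs (y s) (y t) \<noteq> 0"
        using *(3) unfolding rank_two_def by blast
      have "p \<noteq> q" "s \<noteq> t" using False st(3) by auto
      then have "gc_step M y x (gc_vector y p q s t)"
        using * st False unfolding gc_step_def by blast
      then have "gc_vector y p q s t = 0" using no_step x by blast
      \<comment> \<open>As \<open>y s\<close> and \<open>y t\<close> are independent, both
        coefficients vanish. So the vectors spanning \<open>m\<close> lie in the plane of
        \<open>y p\<close> and \<open>y q\<close>.\<close>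
      then have eq: "dot (crs (y p) (y q)) (y s) *s y t = dot (crs (y p) (y q)) (y t) *s y s"
        by (simp add: gc_vector_def)
      have "dot (crs (y p) (y q)) (y s) *s crs (y s) (y t) = crs (y s) (dot (crs (y p) (y q)) (y s) *s y t)"
        by (simp add: crs_linear)
      also have "\<dots> = 0" unfolding eq by (simp add: crs_linear)
      finally have s0: "dot (crs (y p) (y q)) (y s) = 0" using st(3) by simp
      have "dot (crs (y p) (y q)) (y t) *s crs (y s) (y t) = crs (dot (crs (y p) (y q)) (y t) *s y s) (y t)"
        by (simp add: crs_linear)
      also have "\<dots> = 0" unfolding eq[symmetric] by (simp add: crs_linear)
      finally have t0: "dot (crs (y p) (y q)) (y t) = 0" using st(3) by simp
      obtain a b where "y r = a *s y s + b *s y t"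
        using span_pair_if_dot_crs_eq_0[OF st(3) line_configurationD[OF conf lm(2) st(1,2) *(6)]] by blast
      then show ?thesis using s0 t0 by simp
    qed
  qed
  then show ?thesis using that gc ext by blast
qed

text \<open>Points of degree at least three come first, since they rely on the concurrency of the
  saturated configuration; the remaining ones can be filled in after lines have been
  altered.\<close>

lemma gc_zero_scaled_configuration:
  assumes "gc_zero M z" "\<not> contains_cycle M (points_of_degree_ge_3 M)"
  obtains y where "line_configuration y" "\<And>x. y x \<noteq> 0" "\<And>x. z x \<noteq> 0 \<Longrightarrow> y x = z x"
proof -
  obtain y where y: "gc_zero M y" "\<And>x. z x \<noteq> 0 \<Longrightarrow> y x = z x"
    "\<And>x. y x = 0 \<Longrightarrow> concurrent_at y (lines_through M x)"
    using saturate[OF assms(1)] by blast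
  let ?Y = "{x \<in> points_of_degree_ge_3 M. y x = 0}"
  have "\<not> contains_cycle M ?Y"
    using assms(2) contains_cycle_mono[of M ?Y "points_of_degree_ge_3 M"] by blast
  then have "\<exists>y'. line_configuration y' \<and> (\<forall>x. x \<notin> ?Y \<longrightarrow> y' x = y x) \<and> (\<forall>x\<in>?Y. y' x \<noteq> 0)"
    using y(3) by (intro fill_acyclic[OF gc_zero_line_configuration[OF y(1)]]) simp_all
  then obtain y' where y': "line_configuration y'" "\<And>x. x \<notin> ?Y \<Longrightarrow> y' x = y x" "\<And>x. x \<in> ?Y \<Longrightarrow> y' x \<noteq> 0"
    by blast
  let ?Z = "{x. y' x = 0}"
  have "card (lines_through M x) \<le> 2" if "x \<in> ?Z" for x
  proof -
    have "x \<notin> ?Y" using y'(3)[of x] that by auto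
    then have "x \<notin> points_of_degree_ge_3 M" using y'(2)[of x] that by auto
    then show ?thesis by (simp add: points_of_degree_ge_3_def ground)
  qed
  then have "\<exists>y''. line_configuration y'' \<and> (\<forall>x. x \<notin> ?Z \<longrightarrow> y'' x = y' x) \<and> (\<forall>x\<in>?Z. y'' x \<noteq> 0)"
    by (intro fill_low_degree[OF y'(1)]) simp_all
  then obtain y'' where y'': "line_configuration y''" "\<And>x. x \<notin> ?Z \<Longrightarrow> y'' x = y' x" "\<And>x. x \<in> ?Z \<Longrightarrow> y'' x \<noteq> 0"
    by blast
  show ?thesis
  proof (rule that[OF y''(1)])
    fix x
    show "y'' x \<noteq> 0" using y''(2,3)[of x] by (cases "y' x = 0") auto
    assume z: "z x \<noteq> 0"
    then have "y' x = z x" using y(2)[of x] y'(2)[of x] by auto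
    then show "y'' x = z x" using z y''(2)[of x] by simp
  qed
qed

end

section \<open>Approximation by realizations\<close>

text \<open>All conditions are homogeneous in each vector; this is what later lets a vanishing
  column be approached.\<close>

lemma in_general_position_scale:
  assumes "in_general_position P L y h" "\<And>p. c p \<noteq> 0"
  shows "in_general_position P L (\<lambda>p. c p *s y p) h"
proof -
  note g = in_general_positionD[OF assms(1)]
  note f = flaggedD[OF g(1)]
  have "flagged P L (\<lambda>p. c p *s y p) h"
    unfolding flagged_def using f assms(2) by simp
  then show ?thesis
    by (rule in_general_positionI) (use g assms(2) in \<open>simp_all add: crs_linear\<close>)
qed

lemma eval_poly_eq_0_limit:
  assumes zero: "\<And>w. of_columns w \<in> S \<Longrightarrow> eval_poly P (of_columns w) = 0"
    and appr: "\<And>\<epsilon>. \<epsilon> > 0 \<Longrightarrow> \<exists>w. of_columns w \<in> S \<and> (\<forall>x. norm (w x - z x) < \<epsilon>)"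
  shows "eval_poly P (of_columns z) = 0"
proof -
  have "\<exists>w. of_columns w \<in> S \<and> (\<forall>x. norm (w x - z x) < inverse (real (Suc k)))" for k
    by (rule appr) simp
  then obtain w where w: "\<And>k. of_columns (w k) \<in> S" "\<And>k x. norm (w k x - z x) < inverse (real (Suc k))"
    by metis
  have lim: "(\<lambda>k. w k x) \<longlonglongrightarrow> z x" for x
  proof (rule LIM_zero_cancel, rule Lim_null_comparison)
    show "\<forall>\<^sub>F k in sequentially. norm (w k x - z x) \<le> inverse (real (Suc k))"
      using w(2) by (intro always_eventually allI less_imp_le)
  qed (rule LIMSEQ_inverse_real_of_nat)
  have "(\<lambda>k. of_columns (w k)) \<longlonglongrightarrow> of_columns z"
    unfolding of_columns_def by (intro vec_tendstoI) (simp add: tendsto_vec_nth[OF lim])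
  moreover have "isCont (eval_poly P) (of_columns z)"
    using continuous_on_eval_poly[of P] by (simp add: continuous_on_eq_continuous_at)
  ultimately have "(\<lambda>k. eval_poly P (of_columns (w k))) \<longlonglongrightarrow> eval_poly P (of_columns z)"
    by (rule isCont_tendsto_compose[rotated])
  then show ?thesis
    using zero[OF w(1)] by (simp add: LIMSEQ_const_iff)
qed

context simple_rank_three
begin

lemma approximate_by_realization:
  assumes bld: "buildable UNIV (lines M)" and y: "line_configuration y" "\<And>x. y x \<noteq> 0"
    and z: "\<And>x. z x \<noteq> 0 \<Longrightarrow> y x = z x" and "\<epsilon> > 0"
  shows "\<exists>w. of_columns w \<in> realizations M \<and> (\<forall>x. norm (w x - z x) < \<epsilon>)"
proof -
  obtain h where h: "\<And>l. l \<in> lines M \<Longrightarrow> h l \<noteq> 0" "\<And>l p. l \<in> lines M \<Longrightarrow> p \<in> l \<Longrightarrow> dot (h l) (y p) = 0"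
    using y(1) unfolding line_configuration_def by metis
  have "flagged UNIV (lines M) y h"
    using h y(2) by (simp add: flagged_def)
  then obtain y' h' where gen: "in_general_position UNIV (lines M) y' h'"
    and near: "\<And>x. norm (y' x - y x) < \<epsilon>"
    using approximableD[OF buildable_approximable[OF bld] _ \<open>\<epsilon> > 0\<close>] by (metis UNIV_I)
  \<comment> \<open>The factor is small where the column of \<open>z\<close> vanishes and 1 where it
    agrees with that of \<open>y\<close>.\<close>
  have "\<exists>t. t \<noteq> 0 \<and> norm (t *s y' x - z x) < \<epsilon>" for x
  proof (cases "z x = 0")
    case True
    then show ?thesis
      using exists_small_multiple[OF \<open>\<epsilon> > 0\<close>, of "y' x"] by (metis diff_zero)
  next
    case False
    then show ?thesis
      using near[of x] z by (intro exI[of _ 1]) simp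
  qed
  then obtain c where c: "\<And>x. c x \<noteq> 0" "\<And>x. norm (c x *s y' x - z x) < \<epsilon>"
    by metis
  have "of_columns (\<lambda>x. c x *s y' x) \<in> realizations M"
    by (rule general_position_realization[OF in_general_position_scale[OF gen c(1)]])
  then show ?thesis using c(2) by blast
qed

end

lemma vanishing_ideal_zariski_closure: "vanishing_ideal (zariski_closure S) = vanishing_ideal S"
proof (intro equalityI subsetI)
  fix P assume "P \<in> vanishing_ideal (zariski_closure S)"
  moreover have "S \<subseteq> zariski_closure S" by (auto simp: zariski_closure_def)
  ultimately show "P \<in> vanishing_ideal S" by (auto simp: vanishing_ideal_def)
next
  fix P assume P: "P \<in> vanishing_ideal S"
  then have "S \<subseteq> zero_locus {P}" by (auto simp: vanishing_ideal_def zero_locus_def)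
  then have "zariski_closure S \<subseteq> zero_locus {P}" by (auto simp: zariski_closure_def)
  then show "P \<in> vanishing_ideal (zariski_closure S)" by (auto simp: vanishing_ideal_def zero_locus_def)
qed

theorem theorem3p14:
  fixes M :: "'n::finite matroid"
  assumes "ground M = UNIV"
    and "cactus_configuration M"
    and "\<not> contains_cycle M (points_of_degree_ge_3 M)"
  shows "matroid_ideal M = ideal_radical (circuit_ideal M + grassmann_cayley_ideal M)"
  proof -
  interpret simple_rank_three M
    using assms(1,2) by unfold_locales (simp_all add: cactus_configuration_def)
  let ?J = "circuit_ideal M + grassmann_cayley_ideal M"
  have circuit: "is_ideal (circuit_ideal M)"
    by (simp add: circuit_ideal_def is_ideal_generated)
  have J: "is_ideal ?J"
    by (rule is_ideal_sum[OF circuit is_ideal_grassmann_cayley_ideal])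
  have ideal_eq: "matroid_ideal M = vanishing_ideal (realizations M)"
    by (simp add: matroid_ideal_def matroid_variety_def vanishing_ideal_zariski_closure)
  have bld: "buildable UNIV (lines M)"
    using cactus_buildable[OF assms(2)] by (simp add: assms(1))
  show ?thesis
  proof (intro equalityI subsetI)
    fix P assume "P \<in> matroid_ideal M"
    then have P: "eval_poly P A = 0" if "A \<in> realizations M" for A
      using that by (simp add: ideal_eq vanishing_ideal_def)
    show "P \<in> ideal_radical ?J"
    proof (rule nullstellensatz[OF J])
      fix A assume A: "\<forall>Q\<in>?J. eval_poly Q A = 0"
      define z where "z j = column j A" for j
      have z: "of_columns z = A" by (simp add: z_def[abs_def])
      have "gc_zero M z"
        unfolding gc_zero_def z
      proof (intro allI ballI)
        fix m Q assume "Q \<in> grassmann_cayley_set M m"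
        then have "Q \<in> grassmann_cayley_ideal M"
          using ideal_generated_superset unfolding grassmann_cayley_ideal_def by blast
        then have "0 + Q \<in> ?J"
          by (rule set_plus_intro[OF is_idealD(1)[OF circuit]])
        then show "eval_poly Q A = 0" using A by simp
      qed
      then obtain y where "line_configuration y" "\<And>x. y x \<noteq> 0" "\<And>x. z x \<noteq> 0 \<Longrightarrow> y x = z x"
        using gc_zero_scaled_configuration assms(3) by blast
      then have near: "\<exists>w. of_columns w \<in> realizations M \<and> (\<forall>x. norm (w x - z x) < \<epsilon>)"
        if "\<epsilon> > 0" for \<epsilon>
        using approximate_by_realization[OF bld _ _ _ that] by blast
      have "eval_poly P (of_columns z) = 0"
        by (rule eval_poly_eq_0_limit[OF P near])
      then show "eval_poly P A = 0" by (simp add: z)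
    qed
  next
    fix P assume "P \<in> ideal_radical ?J"
    then obtain n where "n > 0" "P ^ n \<in> ?J"
      by (auto simp: ideal_radical_def)
    then obtain a b where ab: "P ^ n = a + b" "a \<in> circuit_ideal M" "b \<in> grassmann_cayley_ideal M"
      by (auto elim: set_plus_elim)
    have "eval_poly P A = 0" if "A \<in> realizations M" for A
    proof -
      define z where "z j = column j A" for j
      have z: "of_columns z = A" by (simp add: z_def[abs_def])
      have real: "of_columns z \<in> realizations M" using that z by simp
      have "eval_poly a (of_columns z) = 0"
        using ab(2) unfolding circuit_ideal_def
        by (rule eval_poly_ideal_generated) (use realization_circuit_minor[OF real] in blast)
      moreover obtain m where "b \<in> ideal_generated (grassmann_cayley_set M m)"
        using ab(3) by (auto simp: grassmann_cayley_ideal_def)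
      then have "eval_poly b (of_columns z) = 0"
        by (rule eval_poly_ideal_generated) (use realization_gc_zero[OF real] in \<open>simp add: gc_zero_def\<close>)
      ultimately have "eval_poly (P ^ n) A = 0"
        by (simp only: ab(1) z eval_poly_add add_0)
      then show ?thesis using \<open>n > 0\<close> by simp
    qed
    then show "P \<in> matroid_ideal M"
      by (simp add: ideal_eq vanishing_ideal_def)
  qed
qed

end
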